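(* Let $T>0$, let $p,\tilde p\in AC[0,T]$ and $q,\tilde q\in L(0,T)$ be complex-valued with $\int_0^T p(x)\,dx=\int_0^T\tilde p(x)\,dx$. Let $\sigma_1,\sigma_2$ be complex-valued functions of bounded variation on $[0,T]$, continuous from the right for $t>0$, with $H_1:=\sigma_1(+0)-\sigma_1(0)\neq 0$, and let $U_1,U_2$ be the associated linear forms $U_j(y)=\int_0^T y(t)\,d\sigma_j(t)$ (the same forms for both pairs $(p,q)$ and $(\tilde p,\tilde q)$). Let $\omega$, $M$, $\Lambda_1$, $\Xi$ be the characteristic function, Weyl-type function and eigenvalue sets (defined in the context) associated with $(p,q)$, and let $\tilde\omega,\tilde M$ be the corresponding characteristic function and Weyl-type function associated with $(\tilde p,\tilde q)$; assume $\omega\not\equiv 0$ and $\tilde\omega\not\equiv0$. Suppose that $\Lambda_1\cap\Xi=\emptyset$. If $M(\lambda)=\tilde M(\lambda)$ and $\omega(\lambda)=\tilde\omega(\lambda)$ (as meromorphic, respectively entire, functions of $\lambda$), then $p(x)=\tilde p(x)$ for all $x\in(0,T)$ and $q(x)=\tilde q(x)$ for almost every $x\in(0,T)$.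
   Context: $AC[0,T]$ is the set of absolutely continuous functions on $[0,T]$ and $L(0,T)$ the set of Lebesgue integrable functions on $(0,T)$. For a pair $(p,q)$ consider the differential pencil $$y''(x)+[\lambda^2-2\lambda p(x)-q(x)]y(x)=0,\quad x\in(0,T),\qquad ( * )$$ with spectral parameter $\lambda\in\mathbb{C}$ (solutions have $y,y'$ absolutely continuous on $[0,T]$ and satisfy $( * )$ almost everywhere). The Stieltjes integral $\int_0^T y(t)\,d\sigma_j(t)$ includes the possible jump of $\sigma_j$ at $0$, i.e. $U_j(y)=H_jy(0)+\int_0^T y(t)\,d\sigma_{j0}(t)$, where $H_j=\sigma_j(+0)-\sigma_j(0)$ and $\sigma_{j0}$ is of bounded variation and continuous from the right for $t\ge 0$. Let $X_1(x,\lambda),X_2(x,\lambda)$ be the solutions of $( * )$ with $X_1(0,\lambda)=X_2'(0,\lambda)=1$, $X_1'(0,\lambda)=X_2(0,\lambda)=0$. Let $V_1(y):=y(T)$. The characteristic function of the problem $( * )$, $U_1(y)=U_2(y)=0$ is $\omega(\lambda):=\det[U_j(X_k)]_{j,k=1,2}$; it is entire, and $\Xi$ is the set of its zeros (the eigenvalues of that problem). The characteristic function of the problem $( * )$, $U_1(y)=V_1(y)=0$ is $\Delta_1(\lambda):=U_1(X_1)V_1(X_2)-U_1(X_2)V_1(X_1)$; it is entire, and $\Lambda_1$ is the set of its zeros (the eigenvalues of that problem). For $\lambda\notin\Lambda_1$, let $\Phi(x,\lambda)$ be the solution of $( * )$ satisfying $U_1(\Phi)=1$ and $V_1(\Phi)=0$.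 The Weyl-type function is $M(\lambda):=U_2(\Phi)$. Objects with a tilde are defined in the same way with $(\tilde p,\tilde q)$ in place of $(p,q)$. *)

theory Defs
  imports "HOL-Analysis.Analysis"
begin

text \<open>
  In the next three definitions a compact interval \<open>K\<close> of a (tagged) division stands for
  \<open>[Inf K, Sup K]\<close>. Divisions may contain one-point intervals; these contribute \<open>0\<close> to every
  sum below.
\<close>

definition absolutely_continuous_fn :: "real \<Rightarrow> real \<Rightarrow> (real \<Rightarrow> complex) \<Rightarrow> bool" where
  "absolutely_continuous_fn a b f \<longleftrightarrow>
     (\<forall>\<epsilon>>0. \<exists>\<delta>>0. \<forall>D S. S \<subseteq> {a..b} \<longrightarrow> D division_of S \<longrightarrow>
        (\<Sum>K\<in>D. Sup K - Inf K) < \<delta> \<longrightarrow> (\<Sum>K\<in>D. norm (f (Sup K) - f (Inf K))) < \<epsilon>)"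

definition bounded_variation_fn :: "real \<Rightarrow> real \<Rightarrow> (real \<Rightarrow> complex) \<Rightarrow> bool" where
  "bounded_variation_fn a b f \<longleftrightarrow>
     (\<exists>B. \<forall>D. D division_of {a..b} \<longrightarrow> (\<Sum>K\<in>D. norm (f (Sup K) - f (Inf K))) \<le> B)"

definition has_stieltjes_integral ::
    "real \<Rightarrow> real \<Rightarrow> (real \<Rightarrow> complex) \<Rightarrow> (real \<Rightarrow> complex) \<Rightarrow> complex \<Rightarrow> bool" where
  "has_stieltjes_integral a b y \<sigma> I \<longleftrightarrow>
     (\<forall>\<epsilon>>0. \<exists>\<delta>>0. \<forall>D. D tagged_division_of {a..b} \<longrightarrow> (\<forall>(t, K)\<in>D. Sup K - Inf K < \<delta>) \<longrightarrow>
        norm ((\<Sum>(t, K)\<in>D. y t * (\<sigma> (Sup K) - \<sigma> (Inf K))) - I) < \<epsilon>)"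

text \<open>
  The Riemann-Stieltjes integral over the closed interval \<open>{a..b}\<close>. It exists for continuous \<open>y\<close>
  and \<open>\<sigma>\<close> of bounded variation, and includes the contributions of jumps of \<open>\<sigma>\<close> at both
  endpoints; in particular the jump at \<open>a\<close> contributes \<open>(\<sigma>(a+) - \<sigma>(a)) y(a)\<close>.
\<close>

definition stieltjes_integral ::
    "real \<Rightarrow> real \<Rightarrow> (real \<Rightarrow> complex) \<Rightarrow> (real \<Rightarrow> complex) \<Rightarrow> complex" where
  "stieltjes_integral a b y \<sigma> = (THE I. has_stieltjes_integral a b y \<sigma> I)"

definition jump_at_0 :: "(real \<Rightarrow> complex) \<Rightarrow> complex" where
  "jump_at_0 \<sigma> = Lim (at_right 0) \<sigma> - \<sigma> 0"

definition U_form :: "real \<Rightarrow> (real \<Rightarrow> complex) \<Rightarrow> (real \<Rightarrow> complex) \<Rightarrow> complex" where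
  "U_form T \<sigma> y = stieltjes_integral 0 T y \<sigma>"

definition V1_form :: "real \<Rightarrow> (real \<Rightarrow> complex) \<Rightarrow> complex" where
  "V1_form T y = y T"

text \<open>The derivative on \<open>{0..T}\<close>, one-sided at the endpoints.\<close>

definition D_on :: "real \<Rightarrow> (real \<Rightarrow> complex) \<Rightarrow> real \<Rightarrow> complex" where
  "D_on T y x = vector_derivative y (at x within {0..T})"

definition pencil_solution ::
    "real \<Rightarrow> (real \<Rightarrow> complex) \<Rightarrow> (real \<Rightarrow> complex) \<Rightarrow> complex \<Rightarrow> (real \<Rightarrow> complex) \<Rightarrow> bool" where
  "pencil_solution T p q \<mu> y \<longleftrightarrow>
     absolutely_continuous_fn 0 T y \<and>
     (\<forall>x\<in>{0..T}. y differentiable (at x within {0..T})) \<and>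
     absolutely_continuous_fn 0 T (D_on T y) \<and>
     (AE x in lebesgue_on {0<..<T}. \<exists>y2. (D_on T y has_vector_derivative y2) (at x) \<and>
        y2 + (\<mu>\<^sup>2 - 2 * \<mu> * p x - q x) * y x = 0)"

text \<open>
  Solutions are determined by the equation and their initial (or boundary) data on \<open>{0..T}\<close> only;
  the values outside \<open>{0..T}\<close> are left open, hence \<open>SOME\<close> rather than \<open>THE\<close>. None of the
  forms above depends on these values.
\<close>

definition X1 ::
    "real \<Rightarrow> (real \<Rightarrow> complex) \<Rightarrow> (real \<Rightarrow> complex) \<Rightarrow> complex \<Rightarrow> real \<Rightarrow> complex" where
  "X1 T p q \<mu> = (SOME y. pencil_solution T p q \<mu> y \<and> y 0 = 1 \<and> D_on T y 0 = 0)"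

definition X2 ::
    "real \<Rightarrow> (real \<Rightarrow> complex) \<Rightarrow> (real \<Rightarrow> complex) \<Rightarrow> complex \<Rightarrow> real \<Rightarrow> complex" where
  "X2 T p q \<mu> = (SOME y. pencil_solution T p q \<mu> y \<and> y 0 = 0 \<and> D_on T y 0 = 1)"

definition char_omega ::
    "real \<Rightarrow> (real \<Rightarrow> complex) \<Rightarrow> (real \<Rightarrow> complex) \<Rightarrow>
     (real \<Rightarrow> complex) \<Rightarrow> (real \<Rightarrow> complex) \<Rightarrow> complex \<Rightarrow> complex" where
  "char_omega T \<sigma>1 \<sigma>2 p q \<mu> =
     U_form T \<sigma>1 (X1 T p q \<mu>) * U_form T \<sigma>2 (X2 T p q \<mu>) -
     U_form T \<sigma>1 (X2 T p q \<mu>) * U_form T \<sigma>2 (X1 T p q \<mu>)"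

definition char_Delta1 ::
    "real \<Rightarrow> (real \<Rightarrow> complex) \<Rightarrow> (real \<Rightarrow> complex) \<Rightarrow> (real \<Rightarrow> complex) \<Rightarrow> complex \<Rightarrow> complex" where
  "char_Delta1 T \<sigma>1 p q \<mu> =
     U_form T \<sigma>1 (X1 T p q \<mu>) * V1_form T (X2 T p q \<mu>) -
     U_form T \<sigma>1 (X2 T p q \<mu>) * V1_form T (X1 T p q \<mu>)"

definition Xi_set ::
    "real \<Rightarrow> (real \<Rightarrow> complex) \<Rightarrow> (real \<Rightarrow> complex) \<Rightarrow>
     (real \<Rightarrow> complex) \<Rightarrow> (real \<Rightarrow> complex) \<Rightarrow> complex set" where
  "Xi_set T \<sigma>1 \<sigma>2 p q = {\<mu>. char_omega T \<sigma>1 \<sigma>2 p q \<mu> = 0}"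

definition Lambda1_set ::
    "real \<Rightarrow> (real \<Rightarrow> complex) \<Rightarrow> (real \<Rightarrow> complex) \<Rightarrow> (real \<Rightarrow> complex) \<Rightarrow> complex set" where
  "Lambda1_set T \<sigma>1 p q = {\<mu>. char_Delta1 T \<sigma>1 p q \<mu> = 0}"

text \<open>\<open>Phi\<close> and \<open>weyl_M\<close> are meaningful only for \<open>\<mu> \<notin> Lambda1_set T \<sigma>1 p q\<close>.\<close>

definition Phi ::
    "real \<Rightarrow> (real \<Rightarrow> complex) \<Rightarrow> (real \<Rightarrow> complex) \<Rightarrow> (real \<Rightarrow> complex) \<Rightarrow>
     complex \<Rightarrow> real \<Rightarrow> complex" where
  "Phi T \<sigma>1 p q \<mu> =
     (SOME y. pencil_solution T p q \<mu> y \<and> U_form T \<sigma>1 y = 1 \<and> V1_form T y = 0)"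

definition weyl_M ::
    "real \<Rightarrow> (real \<Rightarrow> complex) \<Rightarrow> (real \<Rightarrow> complex) \<Rightarrow>
     (real \<Rightarrow> complex) \<Rightarrow> (real \<Rightarrow> complex) \<Rightarrow> complex \<Rightarrow> complex" where
  "weyl_M T \<sigma>1 \<sigma>2 p q \<mu> = U_form T \<sigma>2 (Phi T \<sigma>1 p q \<mu>)"

end

theory Submission
  imports Defs "HOL-Complex_Analysis.Complex_Analysis"
begin

text \<open>
  Write \<open>\<Delta>\<close> for the characteristic function \<open>char_Delta1\<close>. Reflecting the interval, \<open>s = T - x\<close>, moves
  the condition at \<open>T\<close> to the initial point. Let \<open>S\<close> and \<open>C\<close> be the solutions of the reflected equation
  with the initial data of sine and cosine, and let \<open>L1\<close>, \<open>L2\<close> be the reflected forms. Since Wronskians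
  are constant, \<open>\<Delta> = L1 S\<close>, \<open>M = L2 S / L1 S\<close> and \<open>\<omega> = L1 S \<cdot> L2 C - L1 C \<cdot> L2 S\<close>
  (\<open>characteristic_functions_via_right_end\<close>, \<open>weyl_function_via_right_end\<close>). The jump of \<open>\<sigma>1\<close> makes
  \<open>L1\<close> a nonzero multiple of the evaluation at the end plus a remainder with little mass there
  (\<open>reflected_U_form_end_functional\<close>). As \<open>S\<close> grows exponentially towards the end, \<open>\<Delta>\<close> is
  comparable to \<open>exp (T \<bar>Im \<mu>\<bar>) / \<bar>\<mu>\<bar>\<close> off a strip around the real axis.

  The disjointness of \<open>\<Lambda>1\<close> and \<open>\<Xi>\<close> says that \<open>L1 S\<close> and \<open>L2 S\<close> have no common zero. Equality of
  the Weyl functions is a relation of cross products, so by coprimality (\<open>coprime_entire_divides\<close>) the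
  quotient of the two functions \<open>\<Delta>\<close> is entire. It is bounded, hence constant
  (\<open>entire_quotient_constant\<close>), and the asymptotics give the constant \<open>1\<close>, because the integrals of the
  coefficients \<open>p\<close> agree. Thus both pencils have the same \<open>L1 S\<close> and the same \<open>L2 S\<close>. Equality of the
  functions \<open>\<omega>\<close> and coprimality then show that the two functions \<open>L1 C\<close> differ by \<open>h \<Delta>\<close> with an
  entire function \<open>h\<close>.

  The heart of the proof is \<open>transition_matrix_constant\<close>. The combination \<open>L1 C \<cdot> S - L1 S \<cdot> C\<close>, which
  \<open>L1\<close> annihilates, is at a point \<open>x\<close> of the left half of the (reflected) interval of length \<open>b\<close> at most
  of size \<open>exp (\<bar>Im \<mu>\<bar> (b - x))\<close>, while \<open>S\<close> is of size \<open>exp (\<bar>Im \<mu>\<bar> x)\<close>. Sums of products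
  of the two, with one factor from each pencil, are \<open>\<Delta>\<close> times entries of the transition matrix
  between the pencils. So these entire functions are bounded, hence constant, and one of them vanishes.
  Therefore the sine-type solutions of the two pencils are proportional at each point of the left half,
  with factors independent of \<open>\<mu>\<close>. Their asymptotics in the two half planes yield equality of the coefficients \<open>p\<close>; then the
  solutions coincide, which yields equality of the coefficients \<open>q\<close> and \<open>h = 0\<close>
  (\<open>uniqueness_on_half_interval\<close>).

  Now the equation can be restarted at the midpoint with the functional \<open>L1\<close> alone, as \<open>L1\<close> agrees on
  the systems normalized there. Each step halves the remaining interval (\<open>uniqueness_by_halving\<close>), and
  the steps exhaust it up to its end point.

  The analytic basis is a calculus for absolutely continuous functions as indefinite integrals, which
  provides existence, analytic dependence on \<open>\<mu>\<close>, growth bounds and asymptotics of solutions when \<open>q\<close> is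
  only integrable, and the existence of Stieltjes integrals with integrators of bounded variation.
\<close>

section \<open>Absolutely continuous functions as indefinite integrals\<close>

lemma sum_integral_division_le:
  fixes g :: "real \<Rightarrow> real"
  assumes "D division_of S" "S \<subseteq> W" "g integrable_on W" "\<And>x. x \<in> W \<Longrightarrow> 0 \<le> g x"
  shows "(\<Sum>K\<in>D. integral K g) \<le> integral W g"
proof -
  have "(g has_integral (\<Sum>K\<in>D. integral K g)) S"
    using has_integral_combine_division_topdown[OF assms(3,1,2)] .
  then show ?thesis
    using has_integral_subset_le[OF assms(2) _ integrable_integral[OF assms(3)]] assms(4) by blast
qed

lemma interval_of_division:
  fixes D :: "real set set"
  assumes "D division_of S" "K \<in> D"
  shows "K = {Inf K..Sup K}" "Inf K \<le> Sup K" "Inf K \<in> K" "Sup K \<in> K" "K \<subseteq> S"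
proof -
  obtain a b where "K = cbox a b" "K \<noteq> {}" "K \<subseteq> S"
    using assms by (metis division_ofD(2,3,4))
  then show "K = {Inf K..Sup K}" "Inf K \<le> Sup K" "Inf K \<in> K" "Sup K \<in> K" "K \<subseteq> S" by auto
qed

lemma negligible_outer_open:
  fixes E :: "real set"
  assumes "negligible E" "0 < e"
  obtains T where "open T" "E \<subseteq> T" "T \<in> lmeasurable" "measure lebesgue T < e"
proof -
  have E: "E \<in> sets lebesgue" "E \<in> null_sets lebesgue"
    using assms(1) negligible_iff_null_sets by (auto simp: null_sets_def)
  obtain T where T: "open T" "E \<subseteq> T" "(T - E) \<in> lmeasurable" "emeasure lebesgue (T - E) < ennreal e"
    using sets_lebesgue_outer_open[OF E(1) assms(2)] by metis
  have eq: "emeasure lebesgue T = emeasure lebesgue (T - E)"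
    using E(2) T(1) by (metis emeasure_Diff_null_set borel_open sets_completionI_sets sets_lborel)
  have T': "T \<in> lmeasurable"
    using T(1,4) eq by (intro fmeasurableI) (auto intro: sets_completionI_sets order_less_trans)
  have "measure lebesgue T < e"
    using T(4) eq assms(2) emeasure_eq_measure2[OF T'] by (metis ennreal_less_iff measure_nonneg)
  with T T' that show ?thesis by blast
qed

text \<open>
  The gauge absorbs the exceptional set: around its points it is an open set so small that absolute
  continuity controls the increments of \<open>f\<close> over the intervals tagged there. At the
  other points differentiability controls the increments in the usual way.
\<close>
lemma fundamental_theorem_of_calculus_absolutely_continuous:
  assumes ab: "a \<le> b" and ac: "absolutely_continuous_fn a b f" and E: "negligible E"
    and der: "\<And>x. x \<in> {a..b} - E \<Longrightarrow> (f has_vector_derivative g x) (at x)"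
  shows "(g has_integral (f b - f a)) {a..b}"
proof -
  define g' where "g' x = (if x \<in> E then 0 else g x)" for x
  have "(g' has_integral (f b - f a)) {a..b}"
    unfolding has_integral_real
  proof (intro allI impI)
    fix e :: real assume e: "0 < e"
    define e1 where "e1 = e / (2 * (b - a + 1))"
    have e1: "0 < e1" "e1 * (b - a) < e / 2"
      using e ab by (auto simp: e1_def field_simps)
    obtain d where d: "0 < d" and D: "\<And>D S. S \<subseteq> {a..b} \<Longrightarrow> D division_of S \<Longrightarrow>
        (\<Sum>K\<in>D. Sup K - Inf K) < d \<Longrightarrow> (\<Sum>K\<in>D. norm (f (Sup K) - f (Inf K))) < e / 2"
      using ac e unfolding absolutely_continuous_fn_def by (metis half_gt_zero)
    obtain T where T: "open T" "E \<subseteq> T" "T \<in> lmeasurable" "measure lebesgue T < d"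
      using negligible_outer_open[OF E d] by metis
    \<comment> \<open>Away from \<open>E\<close> the gauge is the radius of linear approximation up to \<open>e1\<close>.\<close>
    have "\<exists>r>0. \<forall>y\<in>ball x r. norm (f y - f x - (y - x) *\<^sub>R g x) \<le> e1 * norm (y - x)"
      if "x \<in> {a..b} - E" for x
    proof -
      have "(f has_derivative (\<lambda>h. h *\<^sub>R g x)) (at x)"
        using der[OF that] by (simp add: has_vector_derivative_def)
      then obtain r where "r > 0" "\<And>y. norm (y - x) < r \<Longrightarrow>
          norm (f y - f x - (y - x) *\<^sub>R g x) \<le> e1 * norm (y - x)"
        using e1(1) unfolding has_derivative_at_alt by blast
      then show ?thesis by (intro exI[of _ r]) (auto simp: dist_norm norm_minus_commute)
    qed
    then obtain r where r: "\<And>x. x \<in> {a..b} - E \<Longrightarrow> 0 < r x"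
      "\<And>x y. x \<in> {a..b} - E \<Longrightarrow> y \<in> ball x (r x) \<Longrightarrow>
         norm (f y - f x - (y - x) *\<^sub>R g x) \<le> e1 * norm (y - x)"
      by metis
    define \<gamma> where "\<gamma> x = (if x \<in> E then T else if x \<in> {a..b} then ball x (r x) else ball x 1)" for x
    have g: "gauge \<gamma>"
      using T r(1) by (auto simp: gauge_def \<gamma>_def)
    have bound: "norm ((\<Sum>(x,k)\<in>P. measure lborel k *\<^sub>R g' x) - (f b - f a)) < e"
      if P: "P tagged_division_of {a..b}" "\<gamma> fine P" for P
    proof -
      have fin: "finite P" using P by auto
      define Q where "Q = {z \<in> P. fst z \<in> E}"
      have Q: "finite Q" "finite (P - Q)" "Q \<subseteq> P" using fin by (auto simp: Q_def)
      have PK: "K = {Inf K..Sup K}" "Inf K \<le> Sup K" "Inf K \<in> K" "Sup K \<in> K" "K \<subseteq> {a..b}" "x \<in> K"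
        "K \<subseteq> \<gamma> x" "x \<in> {a..b}" "measure lborel K = Sup K - Inf K"
        if "(x, K) \<in> P" for x K
      proof -
        have K: "K \<in> snd ` P" using that by force
        note interval_of_division[OF division_of_tagged_division[OF P(1)] K]
        then show 1: "K = {Inf K..Sup K}" "Inf K \<le> Sup K" "Inf K \<in> K" "Sup K \<in> K" "K \<subseteq> {a..b}" by auto
        show 2: "x \<in> K" "K \<subseteq> \<gamma> x"
          using P that by (auto simp: fine_def)
        show "x \<in> {a..b}" using 1 2 by blast
        show "measure lborel K = Sup K - Inf K" using 1
          by (metis content_real)
      qed
      have tel: "f b - f a = (\<Sum>(x,K)\<in>P. f (Sup K) - f (Inf K))"
        using additive_tagged_division_1[OF ab P(1), of f] by simp
      have "(\<Sum>(x,k)\<in>P. measure lborel k *\<^sub>R g' x) - (f b - f a)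
          = (\<Sum>(x,K)\<in>P. measure lborel K *\<^sub>R g' x - (f (Sup K) - f (Inf K)))"
        unfolding tel by (simp add: sum_subtractf case_prod_beta)
      also have "\<dots> = (\<Sum>(x,K)\<in>Q. measure lborel K *\<^sub>R g' x - (f (Sup K) - f (Inf K)))
           + (\<Sum>(x,K)\<in>P - Q. measure lborel K *\<^sub>R g' x - (f (Sup K) - f (Inf K)))"
        using sum.subset_diff[OF Q(3) fin] by (simp add: add.commute)
      also have "norm \<dots> \<le> (\<Sum>(x,K)\<in>Q. norm (f (Sup K) - f (Inf K))) + (\<Sum>(x,K)\<in>P - Q. e1 * measure lborel K)"
      proof (rule norm_triangle_mono)
        show "norm (\<Sum>(x,K)\<in>Q. measure lborel K *\<^sub>R g' x - (f (Sup K) - f (Inf K)))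
            \<le> (\<Sum>(x,K)\<in>Q. norm (f (Sup K) - f (Inf K)))"
          by (rule sum_norm_le) (auto simp: Q_def g'_def norm_minus_commute)
        show "norm (\<Sum>(x,K)\<in>P - Q. measure lborel K *\<^sub>R g' x - (f (Sup K) - f (Inf K)))
            \<le> (\<Sum>(x,K)\<in>P - Q. e1 * measure lborel K)"
        proof (rule sum_norm_le, clarify)
          fix x K assume xK: "(x, K) \<in> P" "(x, K) \<notin> Q"
          then have x: "x \<in> {a..b} - E" using PK[OF xK(1)] by (auto simp: Q_def)
          note K = PK[OF xK(1)]
          have sub: "K \<subseteq> ball x (r x)" using K x by (auto simp: \<gamma>_def)
          have le: "Inf K \<le> x" "x \<le> Sup K" using K(1,6) by (metis atLeastAtMost_iff)+
          have "measure lborel K *\<^sub>R g' x - (f (Sup K) - f (Inf K)) =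
             (f (Inf K) - f x - (Inf K - x) *\<^sub>R g x) - (f (Sup K) - f x - (Sup K - x) *\<^sub>R g x)"
            unfolding K(9) using x by (simp add: g'_def scaleR_diff_left)
          also have "norm \<dots> \<le> e1 * norm (Inf K - x) + e1 * norm (Sup K - x)"
            by (rule order_trans[OF norm_triangle_ineq4 add_mono])
               (use r(2)[OF x] sub K(3,4) in blast)+
          also have "\<dots> = e1 * measure lborel K" unfolding K(9) using le by (simp add: algebra_simps)
          finally show "norm (measure lborel K *\<^sub>R g' x - (f (Sup K) - f (Inf K))) \<le> e1 * measure lborel K" .
        qed
      qed
      also have "(\<Sum>(x,K)\<in>P - Q. e1 * measure lborel K) \<le> (\<Sum>(x,K)\<in>P. e1 * measure lborel K)"
        using fin e1 by (intro sum_mono2) auto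
      also have "\<dots> = e1 * (b - a)"
        using additive_content_tagged_division[of P a b] P ab
        by (simp add: sum_distrib_left[symmetric] case_prod_beta)
      also have "(\<Sum>(x,K)\<in>Q. norm (f (Sup K) - f (Inf K))) < e / 2"
      proof -
        have part: "Q tagged_partial_division_of {a..b}"
          using P(1) Q(3) tagged_partial_division_subset tagged_division_of_def by blast
        have dQ: "snd ` Q division_of \<Union>(snd ` Q)"
          by (rule partial_division_of_tagged_division[OF part])
        have QT: "K \<subseteq> T" if "K \<in> snd ` Q" for K
          using that PK by (auto simp: Q_def \<gamma>_def dest!: PK(7))
        \<comment> \<open>Only the empty set, where \<open>Sup\<close> and \<open>Inf\<close> are unspecified, needs a default value; degenerate intervals have increment \<open>0\<close>.\<close>
        define d' where "d' K = (if K = {} then 0 else norm (f (Sup K) - f (Inf K)))" for K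
        have "(\<Sum>(x,K)\<in>Q. norm (f (Sup K) - f (Inf K))) = (\<Sum>(x,K)\<in>Q. d' K)"
          using PK(6) Q(3) by (intro sum.cong) (fastforce simp: d'_def)+
        also have "\<dots> = (\<Sum>K\<in>snd ` Q. d' K)"
          by (rule sum.over_tagged_division_lemma[OF tagged_partial_division_of_Union_self[OF part]])
             (auto simp: d'_def order.order_iff_strict)
        also have "\<dots> = (\<Sum>K\<in>snd ` Q. norm (f (Sup K) - f (Inf K)))"
          using PK(6) Q(3) by (intro sum.cong) (fastforce simp: d'_def)+
        also have "\<dots> < e / 2"
        proof (rule D[OF _ dQ])
          show "\<Union>(snd ` Q) \<subseteq> {a..b}"
          proof (rule Union_least)
            fix K assume "K \<in> snd ` Q"
            then obtain x where "(x, K) \<in> P" using Q(3) by auto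
            then show "K \<subseteq> {a..b}" by (rule PK(5))
          qed
          have "(\<Sum>K\<in>snd ` Q. Sup K - Inf K) = (\<Sum>K\<in>snd ` Q. integral K (indicat_real T))"
          proof (rule sum.cong)
            fix K assume K: "K \<in> snd ` Q"
            have "integral K (indicat_real T) = integral K (\<lambda>_. 1)"
              using QT[OF K] by (intro integral_cong) auto
            also have "\<dots> = Sup K - Inf K"
              using interval_of_division[OF dQ K] by (metis content_real integral_const_real mult.right_neutral real_scaleR_def)
            finally show "Sup K - Inf K = integral K (indicat_real T)" by simp
          qed simp
          also have "\<dots> \<le> integral UNIV (indicat_real T)"
            using T(3) by (intro sum_integral_division_le[OF dQ])
              (auto simp: lmeasurable_iff_integrable[symmetric] integrable_on_indicator)
          also have "\<dots> = measure lebesgue T"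
            using T(3) by (simp add: lmeasure_integral_UNIV)
          finally show "(\<Sum>K\<in>snd ` Q. Sup K - Inf K) < d" using T(4) by simp
        qed
        finally show ?thesis .
      qed
      finally show ?thesis using e1 by simp
    qed
    show "\<exists>\<gamma>. gauge \<gamma> \<and> (\<forall>P. P tagged_division_of {a..b} \<and> \<gamma> fine P \<longrightarrow>
        norm ((\<Sum>(x,k)\<in>P. measure lborel k *\<^sub>R g' x) - (f b - f a)) < e)"
    proof (intro exI conjI allI impI)
      show "gauge \<gamma>" by (fact g)
      show "norm ((\<Sum>(x,k)\<in>P. measure lborel k *\<^sub>R g' x) - (f b - f a)) < e"
        if "P tagged_division_of {a..b} \<and> \<gamma> fine P" for P
        using that by (elim conjE) (rule bound)
    qed
  qed
  then show ?thesis
    by (rule has_integral_spike[OF E, rotated]) (auto simp: g'_def)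
qed

lemma absolutely_integrable_integrable:
  fixes f :: "'a::euclidean_space \<Rightarrow> 'b::euclidean_space"
  shows "f absolutely_integrable_on S \<Longrightarrow> f integrable_on S"
  by (rule set_lebesgue_integral_eq_integral(1))

lemma has_integral_shift_real:
  fixes f :: "real \<Rightarrow> 'a::banach"
  assumes "(f has_integral i) {u..v}"
  shows "((\<lambda>s. f (c + s)) has_integral i) {u - c..v - c}"
proof -
  have "((\<lambda>x. f (1 *\<^sub>R x + c)) has_integral (1 / (\<bar>1\<bar> ^ DIM(real))) *\<^sub>R i) ((\<lambda>x. (1/1) *\<^sub>R x + - ((1/1) *\<^sub>R c)) ` cbox u v)"
    using assms by (intro has_integral_affinity) auto
  moreover have "(\<lambda>x. x - c) ` {u..v} = {u - c..v - c}"
    using image_affinity_atLeastAtMost[of 1 "- c" u v] by auto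
  ultimately show ?thesis by (simp add: add.commute)
qed

lemma has_integral_reflect_shift_real:
  fixes f :: "real \<Rightarrow> 'a::banach"
  assumes "(f has_integral i) {u..v}"
  shows "((\<lambda>s. f (c - s)) has_integral i) {c - v..c - u}"
proof -
  have "((\<lambda>s. f (- s)) has_integral i) {-v..-u}" using assms by simp
  from has_integral_shift_real[OF this, of "- c"] show ?thesis by simp
qed

lemma absolutely_integrable_shift_real:
  fixes f :: "real \<Rightarrow> complex"
  assumes "f absolutely_integrable_on {u..v}"
  shows "(\<lambda>s. f (c + s)) absolutely_integrable_on {u - c..v - c}"
  using assms has_integral_shift_real[of f _ u v c] has_integral_shift_real[of "\<lambda>x. norm (f x)" _ u v c]
  unfolding absolutely_integrable_on_def integrable_on_def by blast

lemma absolutely_integrable_reflect_shift_real: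
  fixes f :: "real \<Rightarrow> complex"
  assumes "f absolutely_integrable_on {u..v}"
  shows "(\<lambda>s. f (c - s)) absolutely_integrable_on {c - v..c - u}"
  using assms has_integral_reflect_shift_real[of f _ u v c] has_integral_reflect_shift_real[of "\<lambda>x. norm (f x)" _ u v c]
  unfolding absolutely_integrable_on_def integrable_on_def by blast

lemma absolutely_integrable_norm':
  fixes f :: "real \<Rightarrow> complex"
  shows "f absolutely_integrable_on S \<Longrightarrow> (\<lambda>x. norm (f x)) absolutely_integrable_on S"
  using absolutely_integrable_norm by (simp add: o_def)

lemma absolutely_integrable_continuous_mult:
  fixes f g :: "real \<Rightarrow> complex"
  assumes "continuous_on {a..b} f" "g absolutely_integrable_on {a..b}"
  shows "(\<lambda>x. f x * g x) absolutely_integrable_on {a..b}"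
proof (rule absolutely_integrable_bounded_measurable_product[OF bilinear_times])
  show "f \<in> borel_measurable (lebesgue_on {a..b})"
    using assms(1) by (intro continuous_imp_measurable_on_sets_lebesgue) auto
  show "bounded (f ` {a..b})"
    using assms(1) compact_continuous_image compact_imp_bounded by blast
qed (use assms in auto)

lemma absolutely_integrable_mult_continuous_real:
  fixes k g :: "real \<Rightarrow> real"
  assumes "continuous_on {a..b} g" "k absolutely_integrable_on {a..b}"
  shows "(\<lambda>x. k x * g x) absolutely_integrable_on {a..b}"
proof -
  have "(\<lambda>x. g x * k x) absolutely_integrable_on {a..b}"
  proof (rule absolutely_integrable_bounded_measurable_product_real)
    show "g \<in> borel_measurable (lebesgue_on {a..b})"
      using assms(1) by (intro continuous_imp_measurable_on_sets_lebesgue) auto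
    show "bounded (g ` {a..b})"
      using assms(1) compact_continuous_image compact_imp_bounded by blast
  qed (use assms in auto)
  then show ?thesis by (simp add: mult.commute)
qed

text \<open>
  The integrand is truncated at a height \<open>n\<close>: the bounded part contributes at most
  \<open>n\<close> times the total length, and the integral of the excess is small by dominated
  convergence.
\<close>
lemma absolutely_continuous_indefinite_integral:
  fixes f :: "real \<Rightarrow> complex"
  assumes f: "f absolutely_integrable_on {a..b}"
    and F: "\<And>x. x \<in> {a..b} \<Longrightarrow> F x = c + integral {a..x} f"
  shows "absolutely_continuous_fn a b F"
  unfolding absolutely_continuous_fn_def
proof (intro allI impI)
  fix e :: real assume e: "0 < e"
  define g where "g n x = norm (f x) - min (norm (f x)) (real n)" for n x
  have nf: "(\<lambda>x. norm (f x)) absolutely_integrable_on {a..b}"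
    using f by (rule absolutely_integrable_norm[unfolded o_def])
  have mi: "(\<lambda>x. min (norm (f x)) (real n)) absolutely_integrable_on {a..b}" for n
    by (intro absolutely_integrable_min_1[OF nf] absolutely_integrable_continuous_real continuous_on_const)
  have gi: "g n integrable_on {a..b}" for n
    unfolding g_def by (intro integrable_diff absolutely_integrable_integrable nf mi)
  have "(\<lambda>n. integral {a..b} (g n)) \<longlonglongrightarrow> integral {a..b} (\<lambda>_. 0)"
  proof (rule dominated_convergence(2)[where h="\<lambda>x. norm (f x)"])
    show "(\<lambda>k. g k x) \<longlonglongrightarrow> 0" for x
    proof (rule tendsto_eventually)
      obtain N where "norm (f x) \<le> real N" using real_arch_simple by blast
      then show "\<forall>\<^sub>F k in sequentially. g k x = 0"
        by (intro eventually_sequentiallyI[of N]) (auto simp: g_def min_def)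
    qed
  qed (use nf gi in \<open>auto simp: g_def min_def intro: absolutely_integrable_integrable\<close>)
  then have "\<forall>\<^sub>F n in sequentially. integral {a..b} (g n) < e / 2"
    using e by (intro order_tendstoD) auto
  then obtain n where n: "integral {a..b} (g n) < e / 2"
    unfolding eventually_sequentially by blast
  show "\<exists>\<delta>>0. \<forall>D S. S \<subseteq> {a..b} \<longrightarrow> D division_of S \<longrightarrow>
        (\<Sum>K\<in>D. Sup K - Inf K) < \<delta> \<longrightarrow> (\<Sum>K\<in>D. norm (F (Sup K) - F (Inf K))) < e"
  proof (intro exI[of _ "e / (2 * (real n + 1))"] conjI allI impI)
    show "0 < e / (2 * (real n + 1))" using e by simp
    fix D S assume S: "S \<subseteq> {a..b}" and D: "D division_of S"
      and len: "(\<Sum>K\<in>D. Sup K - Inf K) < e / (2 * (real n + 1))"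
    have "(\<Sum>K\<in>D. norm (F (Sup K) - F (Inf K))) \<le> (\<Sum>K\<in>D. real n * (Sup K - Inf K) + integral K (g n))"
    proof (rule sum_mono)
      fix K assume "K \<in> D"
      note K = interval_of_division[OF D this]
      have KS: "{Inf K..Sup K} \<subseteq> {a..b}" using K S by blast
      have in': "Sup K \<in> {a..b}" "Inf K \<in> {a..b}" using K S by blast+
      have fi: "f integrable_on {a..Sup K}"
        using f in' by (auto intro: integrable_on_subinterval absolutely_integrable_integrable)
      have nfi: "(\<lambda>x. norm (f x)) integrable_on {Inf K..Sup K}"
        using nf KS by (auto intro: integrable_on_subinterval absolutely_integrable_integrable)
      have gK: "g n integrable_on {Inf K..Sup K}"
        using gi KS by (rule integrable_on_subinterval)
      have "F (Sup K) - F (Inf K) = integral {Inf K..Sup K} f"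
        using F[OF in'(1)] F[OF in'(2)] Henstock_Kurzweil_Integration.integral_combine[OF _ K(2) fi] in'
        by (auto simp: algebra_simps)
      also have "norm \<dots> \<le> integral {Inf K..Sup K} (\<lambda>x. norm (f x))"
        using f KS absolutely_integrable_on_subinterval absolutely_integrable_on_def
        by (intro integral_norm_bound_integral nfi) (blast intro: integrable_on_subinterval absolutely_integrable_integrable, simp)
      also have "\<dots> \<le> integral {Inf K..Sup K} (\<lambda>x. real n + g n x)"
      proof (rule integral_le[OF nfi])
        show "(\<lambda>x. real n + g n x) integrable_on {Inf K..Sup K}"
          by (intro integrable_add integrable_const_ivl gK)
      qed (auto simp: g_def min_def)
      also have "\<dots> = real n * (Sup K - Inf K) + integral {Inf K..Sup K} (g n)"
        using gK K(2) by (subst Henstock_Kurzweil_Integration.integral_add) auto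
      finally show "norm (F (Sup K) - F (Inf K)) \<le> real n * (Sup K - Inf K) + integral K (g n)"
        using K(1) by simp
    qed
    also have "\<dots> = real n * (\<Sum>K\<in>D. Sup K - Inf K) + (\<Sum>K\<in>D. integral K (g n))"
      by (simp add: sum.distrib sum_distrib_left)
    also have "(\<Sum>K\<in>D. integral K (g n)) \<le> integral {a..b} (g n)"
      by (rule sum_integral_division_le[OF D S gi]) (auto simp: g_def)
    also have "real n * (\<Sum>K\<in>D. Sup K - Inf K) \<le> real n * (e / (2 * (real n + 1)))"
      using len by (intro mult_left_mono) auto
    also have "\<dots> \<le> e / 2" using e by (simp add: field_simps)
    finally show "(\<Sum>K\<in>D. norm (F (Sup K) - F (Inf K))) < e" using n by linarith
  qed
qed

text \<open>
  Averages over intervals to the right of a point converge almost everywhere; those to the left are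
  averages to the right for the reflected integrand.
\<close>
lemma has_vector_derivative_indefinite_integral_ae:
  fixes f :: "real \<Rightarrow> complex"
  assumes f: "f integrable_on {a..b}"
    and F: "\<And>x. x \<in> {a..b} \<Longrightarrow> F x = c + integral {a..x} f"
  obtains N where "negligible N" "\<And>x. x \<in> {a..b} - N \<Longrightarrow> (F has_vector_derivative f x) (at x)"
proof -
  define g where "g x = (if x \<in> {a..b} then f x else 0)" for x
  have "g integrable_on UNIV"
    unfolding g_def using f by (simp only: integrable_restrict_UNIV)
  then have gi: "g integrable_on cbox u v" for u v
    by (rule integrable_on_subcbox) auto
  have gi': "(\<lambda>x. g (- x)) integrable_on cbox u v" for u v
    using gi[of "- v" "- u"] integrable_reflect[where f=g and a="-v" and b="-u"] by simp
  obtain N1 where N1: "negligible N1" "\<And>x e. \<lbrakk>x \<notin> N1; 0 < e\<rbrakk> \<Longrightarrow> \<exists>d>0. \<forall>h. 0 < h \<and> h < d \<longrightarrow>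
       norm (integral (cbox x (x + h *\<^sub>R One)) g /\<^sub>R h ^ DIM(real) - g x) < e"
    using integrable_ccontinuous_explicit[of g] gi by metis
  obtain N2 where N2: "negligible N2" "\<And>x e. \<lbrakk>x \<notin> N2; 0 < e\<rbrakk> \<Longrightarrow> \<exists>d>0. \<forall>h. 0 < h \<and> h < d \<longrightarrow>
       norm (integral (cbox x (x + h *\<^sub>R One)) (\<lambda>x. g (- x)) /\<^sub>R h ^ DIM(real) - g (- x)) < e"
    using integrable_ccontinuous_explicit[of "\<lambda>x. g (- x)"] gi' by metis
  define N where "N = {a, b} \<union> N1 \<union> uminus ` N2"
  have "negligible (uminus ` N2)"
    using N2(1) by (intro negligible_differentiable_image_negligible)
      (auto intro!: linear_imp_differentiable_on linear_uminus)
  then have N: "negligible N" using N1(1) by (auto simp: N_def)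
  have "(F has_vector_derivative f x) (at x)" if x: "x \<in> {a..b} - N" for x
    unfolding has_vector_derivative_def has_derivative_at_alt
  proof (intro conjI allI impI bounded_linear_intros)
    fix e :: real assume e: "0 < e"
    have xab: "a < x" "x < b" "x \<notin> N1" "- x \<notin> N2" "g x = f x"
      using x by (auto simp: N_def g_def image_iff)
    obtain d1 where d1: "0 < d1" "\<And>h. 0 < h \<Longrightarrow> h < d1 \<Longrightarrow>
       norm (integral (cbox x (x + h)) g /\<^sub>R h - g x) < e" using N1(2)[OF xab(3) e] by auto
    obtain d2 where d2: "0 < d2" "\<And>h. 0 < h \<Longrightarrow> h < d2 \<Longrightarrow>
       norm (integral (cbox (-x) (-x + h)) (\<lambda>x. g (- x)) /\<^sub>R h - g x) < e" using N2(2)[OF xab(4) e] by auto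
    define d where "d = min (min d1 d2) (min (x - a) (b - x))"
    have d: "0 < d" using d1 d2 xab by (auto simp: d_def)
    have comb: "F v - F u = integral {u..v} g" if "a \<le> u" "u \<le> v" "v \<le> b" for u v
    proof -
      have "F v - F u = integral {u..v} f"
        using F[of u] F[of v] Henstock_Kurzweil_Integration.integral_combine[of a u v f] that
          integrable_on_subinterval[OF f, of a v] by (auto simp: algebra_simps)
      also have "\<dots> = integral {u..v} g" using that by (intro integral_cong) (auto simp: g_def)
      finally show ?thesis .
    qed
    have scale: "norm (I - h *\<^sub>R f x) \<le> e * h" if "0 < h" "norm (I /\<^sub>R h - g x) < e" for h I
    proof -
      have "I - h *\<^sub>R f x = h *\<^sub>R (I /\<^sub>R h - g x)"
        using that xab by (simp add: scaleR_diff_right)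
      also have "norm \<dots> \<le> h * e" using that by (simp add: mult_left_mono)
      finally show ?thesis by (simp add: mult.commute)
    qed
    show "\<exists>d>0. \<forall>y. norm (y - x) < d \<longrightarrow> norm (F y - F x - (y - x) *\<^sub>R f x) \<le> e * norm (y - x)"
    proof (intro exI[of _ d] conjI allI impI d)
      fix y assume y: "norm (y - x) < d"
      consider "y = x" | "x < y" | "y < x" by linarith
      then show "norm (F y - F x - (y - x) *\<^sub>R f x) \<le> e * norm (y - x)"
      proof cases
        case 2
        then show ?thesis
          using comb[of x y] scale[OF _ d1(2)[of "y - x"]] y xab by (auto simp: d_def)
      next
        case 3
        have "integral {y..x} g = integral {-x..-y} (\<lambda>x. g (- x))"
          using integral_reflect_real[of "y" "x" g] by simp
        then have *: "F x - F y = integral (cbox (- x) (- x + (x - y))) (\<lambda>x. g (- x))"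
          using comb[of y x] 3 y xab by (auto simp: d_def)
        have "norm (F x - F y - (x - y) *\<^sub>R f x) \<le> e * (x - y)"
          unfolding * using scale[OF _ d2(2)[of "x - y"]] y 3 by (auto simp: d_def)
        moreover have "F y - F x - (y - x) *\<^sub>R f x = - (F x - F y - (x - y) *\<^sub>R f x)"
          by (simp add: algebra_simps)
        ultimately show ?thesis using 3 by (metis abs_minus_commute abs_of_pos diff_gt_0_iff_gt norm_minus_cancel real_norm_def)
      qed auto
    qed
  qed
  with N that show ?thesis by blast
qed

text \<open>
  By the fundamental theorem in both directions, \<open>F\<close> is absolutely continuous with
  derivative \<open>f\<close> almost everywhere. The integrated form turns differential equations
  into integral equations, which survive passage to the limit.
\<close>
definition has_ac_density :: "real \<Rightarrow> (real \<Rightarrow> complex) \<Rightarrow> (real \<Rightarrow> complex) \<Rightarrow> bool" where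
  "has_ac_density b F f \<longleftrightarrow>
     f absolutely_integrable_on {0..b} \<and> (\<forall>x\<in>{0..b}. F x = F 0 + integral {0..x} f)"

lemma ac_density_absolutely_continuous:
  "has_ac_density b F f \<Longrightarrow> absolutely_continuous_fn 0 b F"
  unfolding has_ac_density_def using absolutely_continuous_indefinite_integral by blast

lemma ac_density_derivative:
  assumes "has_ac_density b F f"
  obtains N where "negligible N" "\<And>x. x \<in> {0..b} - N \<Longrightarrow> (F has_vector_derivative f x) (at x)"
proof (rule has_vector_derivative_indefinite_integral_ae)
  show "f integrable_on {0..b}"
    using assms absolutely_integrable_integrable unfolding has_ac_density_def by blast
  show "F x = F 0 + integral {0..x} f" if "x \<in> {0..b}" for x
    using assms that unfolding has_ac_density_def by blast
qed (use that in blast)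

lemma absolutely_continuous_fn_mono:
  assumes "absolutely_continuous_fn a b F" "a \<le> c" "d \<le> b"
  shows "absolutely_continuous_fn c d F"
proof -
  have "{c..d} \<subseteq> {a..b}" using assms by auto
  then show ?thesis using assms(1) unfolding absolutely_continuous_fn_def by (meson order_trans)
qed

lemma absolutely_continuous_fnD:
  assumes "absolutely_continuous_fn a b F" "0 < e"
  shows "\<exists>d. 0 < d \<and> (\<forall>D S. S \<subseteq> {a..b} \<longrightarrow> D division_of S \<longrightarrow>
        (\<Sum>K\<in>D. Sup K - Inf K) < d \<longrightarrow> (\<Sum>K\<in>D. norm (F (Sup K) - F (Inf K))) < e)"
  using assms unfolding absolutely_continuous_fn_def by simp

lemma absolutely_continuous_fn_continuous:
  assumes "absolutely_continuous_fn a b f"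
  shows "continuous_on {a..b} f"
  unfolding continuous_on_iff
proof (intro ballI allI impI)
  fix x e assume x: "x \<in> {a..b}" and e: "(0::real) < e"
  obtain d where d: "0 < d \<and> (\<forall>D S. S \<subseteq> {a..b} \<longrightarrow> D division_of S \<longrightarrow>
        (\<Sum>K\<in>D. Sup K - Inf K) < d \<longrightarrow> (\<Sum>K\<in>D. norm (f (Sup K) - f (Inf K))) < e)"
    by (rule exE[OF absolutely_continuous_fnD[OF assms e]])
  have step: "norm (f v - f u) < e" if "a \<le> u" "u \<le> v" "v \<le> b" "v - u < d" for u v
  proof -
    have "cbox u v \<noteq> {}" using that by simp
    then have "{{u..v}} division_of {u..v}" using division_of_self by (metis box_real(2))
    then have "(\<Sum>K\<in>{{u..v}}. norm (f (Sup K) - f (Inf K))) < e"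
      using that by (intro d[THEN conjunct2, rule_format, of "{u..v}"]) auto
    then show ?thesis using that by simp
  qed
  show "\<exists>d>0. \<forall>x'\<in>{a..b}. dist x' x < d \<longrightarrow> dist (f x') (f x) < e"
  proof (intro exI[of _ d] conjI ballI impI)
    fix y assume y: "y \<in> {a..b}" "dist y x < d"
    show "dist (f y) (f x) < e"
    proof (cases "x \<le> y")
      case True
      then show ?thesis using step[of x y] x y by (simp add: dist_norm)
    next
      case False
      then show ?thesis using step[of y x] x y by (simp add: dist_norm norm_minus_commute)
    qed
  qed (use d in simp)
qed

text \<open>Covers products and Lipschitz images of absolutely continuous functions alike.\<close>
lemma absolutely_continuous_fn_dominated:
  assumes F: "absolutely_continuous_fn a b F" and G: "absolutely_continuous_fn a b G" and B: "0 < B"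
    and le: "\<And>u v. u \<in> {a..b} \<Longrightarrow> v \<in> {a..b} \<Longrightarrow> norm (H v - H u) \<le> B * (norm (F v - F u) + norm (G v - G u))"
  shows "absolutely_continuous_fn a b H"
  unfolding absolutely_continuous_fn_def
proof (intro allI impI)
  fix e :: real assume "0 < e"
  then have e: "0 < e / (2 * B)" using B by simp
  obtain d1 where d1: "0 < d1 \<and> (\<forall>D S. S \<subseteq> {a..b} \<longrightarrow> D division_of S \<longrightarrow>
        (\<Sum>K\<in>D. Sup K - Inf K) < d1 \<longrightarrow> (\<Sum>K\<in>D. norm (F (Sup K) - F (Inf K))) < e / (2 * B))"
    by (rule exE[OF absolutely_continuous_fnD[OF F e]])
  obtain d2 where d2: "0 < d2 \<and> (\<forall>D S. S \<subseteq> {a..b} \<longrightarrow> D division_of S \<longrightarrow>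
        (\<Sum>K\<in>D. Sup K - Inf K) < d2 \<longrightarrow> (\<Sum>K\<in>D. norm (G (Sup K) - G (Inf K))) < e / (2 * B))"
    by (rule exE[OF absolutely_continuous_fnD[OF G e]])
  show "\<exists>\<delta>>0. \<forall>D S. S \<subseteq> {a..b} \<longrightarrow> D division_of S \<longrightarrow>
        (\<Sum>K\<in>D. Sup K - Inf K) < \<delta> \<longrightarrow> (\<Sum>K\<in>D. norm (H (Sup K) - H (Inf K))) < e"
  proof (intro exI[of _ "min d1 d2"] conjI allI impI)
    fix D S assume D: "S \<subseteq> {a..b}" "D division_of S" "(\<Sum>K\<in>D. Sup K - Inf K) < min d1 d2"
    have "(\<Sum>K\<in>D. norm (H (Sup K) - H (Inf K)))
       \<le> (\<Sum>K\<in>D. B * (norm (F (Sup K) - F (Inf K)) + norm (G (Sup K) - G (Inf K))))"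
    proof (rule sum_mono)
      fix K assume "K \<in> D"
      note K = interval_of_division(3-5)[OF D(2) this]
      have "Inf K \<in> {a..b}" "Sup K \<in> {a..b}" using K D(1) by blast+
      then show "norm (H (Sup K) - H (Inf K)) \<le> B * (norm (F (Sup K) - F (Inf K)) + norm (G (Sup K) - G (Inf K)))"
        by (rule le)
    qed
    also have "\<dots> = B * ((\<Sum>K\<in>D. norm (F (Sup K) - F (Inf K))) + (\<Sum>K\<in>D. norm (G (Sup K) - G (Inf K))))"
      by (simp only: sum_distrib_left[symmetric] sum.distrib)
    also have "\<dots> < B * (e / (2 * B) + e / (2 * B))"
      using d1[THEN conjunct2, rule_format, OF D(1,2)] d2[THEN conjunct2, rule_format, OF D(1,2)] D(3) B by (intro mult_strict_left_mono add_strict_mono) auto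
    also have "\<dots> = e" using B by simp
    finally show "(\<Sum>K\<in>D. norm (H (Sup K) - H (Inf K))) < e" .
  qed (use d1 d2 in auto)
qed

lemma ac_densityI:
  assumes "absolutely_continuous_fn 0 b F" "f absolutely_integrable_on {0..b}" "negligible N"
    and der: "\<And>x. x \<in> {0..b} - N \<Longrightarrow> (F has_vector_derivative f x) (at x)"
  shows "has_ac_density b F f"
  unfolding has_ac_density_def
proof (intro conjI ballI)
  fix x assume x: "x \<in> {0..b}"
  have "(f has_integral F x - F 0) {0..x}"
    using x assms by (intro fundamental_theorem_of_calculus_absolutely_continuous[OF _ _ assms(3)])
      (auto intro: absolutely_continuous_fn_mono)
  then show "F x = F 0 + integral {0..x} f" by (simp add: integral_unique)
qed fact

lemma ac_density_continuous:
  assumes "has_ac_density b F f" shows "continuous_on {0..b} F"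
proof -
  have "continuous_on {0..b} (\<lambda>x. F 0 + integral {0..x} f)"
    using assms unfolding has_ac_density_def
    by (intro continuous_intros indefinite_integral_continuous_1 absolutely_integrable_integrable) auto
  then show ?thesis using assms unfolding has_ac_density_def
    by (metis (no_types, lifting) continuous_on_cong)
qed

lemma ac_density_increment:
  assumes "has_ac_density b F f" "0 \<le> s" "s \<le> t" "t \<le> b"
  shows "(f has_integral F t - F s) {s..t}"
proof -
  have fi: "f integrable_on {0..b}"
    using assms by (auto simp: has_ac_density_def intro: absolutely_integrable_integrable)
  have fi': "f integrable_on {u..v}" if "0 \<le> u" "v \<le> b" for u v
    using integrable_on_subinterval[OF fi] that by auto
  have Fi: "F u = F 0 + integral {0..u} f" if "0 \<le> u" "u \<le> b" for u
    using assms(1) that unfolding has_ac_density_def by (metis atLeastAtMost_iff)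
  have "integral {0..s} f + integral {s..t} f = integral {0..t} f"
    using fi'[of 0 t] assms by (intro Henstock_Kurzweil_Integration.integral_combine) auto
  then have "F t - F s = integral {s..t} f"
    using Fi[of s] Fi[of t] assms by (auto simp: algebra_simps)
  then show ?thesis using fi'[of s t] assms by (simp add: integrable_integral)
qed

lemma ac_density_increment_bound:
  assumes "has_ac_density b F f" "0 \<le> s" "s \<le> t" "t \<le> b"
    and "g integrable_on {s..t}" "\<And>x. x \<in> {s..t} \<Longrightarrow> norm (f x) \<le> g x"
  shows "norm (F t - F s) \<le> integral {s..t} g"
  using ac_density_increment[OF assms(1-4)] assms(5,6)
  by (metis has_integral_integrable integral_norm_bound_integral integral_unique)

lemma ac_densityI_has_integral:
  assumes "f absolutely_integrable_on {0..b}"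
    and "\<And>x. 0 \<le> x \<Longrightarrow> x \<le> b \<Longrightarrow> (f has_integral F x - F 0) {0..x}"
  shows "has_ac_density b F f"
  unfolding has_ac_density_def
proof (intro conjI ballI)
  fix x assume "x \<in> {0..b}"
  then show "F x = F 0 + integral {0..x} f" using integral_unique[OF assms(2), of x] by simp
qed fact

lemma ac_density_cong:
  assumes "has_ac_density b F f" "0 \<le> b" "negligible N"
    and "\<And>x. x \<in> {0..b} \<Longrightarrow> G x = F x" "\<And>x. x \<in> {0..b} - N \<Longrightarrow> g x = f x"
  shows "has_ac_density b G g"
proof (rule ac_densityI_has_integral)
  show "g absolutely_integrable_on {0..b}"
    using assms absolutely_integrable_spike unfolding has_ac_density_def by metis
  fix x assume "0 \<le> x" "x \<le> b"
  then show "(g has_integral G x - G 0) {0..x}"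
    using has_integral_spike[OF assms(3) _ ac_density_increment[OF assms(1), of 0 x]] assms(4,5) by auto
qed

lemma ac_density_C1:
  assumes "\<And>x. x \<in> {0..b} \<Longrightarrow> (F has_vector_derivative f x) (at x within {0..b})" "continuous_on {0..b} f"
  shows "has_ac_density b F f"
proof (rule ac_densityI_has_integral)
  show "f absolutely_integrable_on {0..b}" using assms(2) by (rule absolutely_integrable_continuous_real)
  fix x assume "0 \<le> x" "x \<le> b"
  then show "(f has_integral F x - F 0) {0..x}"
    by (intro fundamental_theorem_of_calculus has_vector_derivative_within_subset[OF assms(1)]) auto
qed

lemma ac_density_add:
  assumes "has_ac_density b F f" "has_ac_density b G g"
  shows "has_ac_density b (\<lambda>x. F x + G x) (\<lambda>x. f x + g x)"
proof (rule ac_densityI_has_integral)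
  show "(\<lambda>x. f x + g x) absolutely_integrable_on {0..b}"
    using assms unfolding has_ac_density_def by (auto intro: set_integral_add)
  fix x assume x: "0 \<le> x" "x \<le> b"
  show "((\<lambda>x. f x + g x) has_integral F x + G x - (F 0 + G 0)) {0..x}"
    using has_integral_add[OF ac_density_increment[OF assms(1), of 0 x] ac_density_increment[OF assms(2), of 0 x]] x
    by (simp add: algebra_simps)
qed

lemma ac_density_cmult:
  assumes "has_ac_density b F f"
  shows "has_ac_density b (\<lambda>x. c * F x) (\<lambda>x. c * f x)"
proof (rule ac_densityI_has_integral)
  show "(\<lambda>x. c * f x) absolutely_integrable_on {0..b}"
    using assms unfolding has_ac_density_def by (auto intro!: absolutely_integrable_continuous_mult)
  fix x assume x: "0 \<le> x" "x \<le> b"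
  show "((\<lambda>x. c * f x) has_integral c * F x - c * F 0) {0..x}"
    using has_integral_mult_right[OF ac_density_increment[OF assms(1), of 0 x], of c] x
    by (simp add: algebra_simps)
qed

lemma ac_density_diff:
  assumes "has_ac_density b F f" "has_ac_density b G g"
  shows "has_ac_density b (\<lambda>x. F x - G x) (\<lambda>x. f x - g x)"
  using ac_density_add[OF assms(1) ac_density_cmult[OF assms(2), of "-1"]] by simp

lemma ac_density_restrict:
  assumes "has_ac_density b F f" "c \<le> b"
  shows "has_ac_density c F f"
proof (rule ac_densityI_has_integral)
  show "f absolutely_integrable_on {0..c}"
    using assms unfolding has_ac_density_def by (auto intro: absolutely_integrable_on_subinterval)
qed (use assms in \<open>auto intro: ac_density_increment\<close>)

lemma ac_density_shift:
  assumes "has_ac_density b F f" "0 \<le> c"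
  shows "has_ac_density (b - c) (\<lambda>s. F (c + s)) (\<lambda>s. f (c + s))"
proof (rule ac_densityI_has_integral)
  have "f absolutely_integrable_on {c..b}"
    using assms unfolding has_ac_density_def by (auto intro: absolutely_integrable_on_subinterval)
  from absolutely_integrable_shift_real[OF this, of c]
  show "(\<lambda>s. f (c + s)) absolutely_integrable_on {0..b - c}" by simp
  fix x assume x: "0 \<le> x" "x \<le> b - c"
  show "((\<lambda>s. f (c + s)) has_integral F (c + x) - F (c + 0)) {0..x}"
    using has_integral_shift_real[OF ac_density_increment[OF assms(1), of c "c + x"], of c] x assms(2) by simp
qed

lemma ac_density_reflect:
  assumes "has_ac_density b F f"
  shows "has_ac_density b (\<lambda>s. F (b - s)) (\<lambda>s. - f (b - s))"
proof (rule ac_densityI_has_integral)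
  have "f absolutely_integrable_on {0..b}" using assms unfolding has_ac_density_def by auto
  from absolutely_integrable_continuous_mult[OF _ absolutely_integrable_reflect_shift_real[OF this, of b], of "\<lambda>_. - 1"]
  show "(\<lambda>s. - f (b - s)) absolutely_integrable_on {0..b}" by simp
  fix x assume x: "0 \<le> x" "x \<le> b"
  have "((\<lambda>s. f (b - s)) has_integral F b - F (b - x)) {0..x}"
    using has_integral_reflect_shift_real[OF ac_density_increment[OF assms(1), of "b - x" b], of b] x by simp
  from has_integral_neg[OF this]
  show "((\<lambda>s. - f (b - s)) has_integral F (b - x) - F (b - 0)) {0..x}" by simp
qed

lemma ac_density_bounded:
  assumes "has_ac_density b F f"
  obtains B where "0 < B" "\<And>x. x \<in> {0..b} \<Longrightarrow> norm (F x) \<le> B"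
proof -
  have "bounded (F ` {0..b})"
    using ac_density_continuous[OF assms] compact_continuous_image compact_imp_bounded by blast
  then show ?thesis using that unfolding bounded_pos by auto
qed

lemma ac_density_mult:
  assumes F: "has_ac_density b F f" and G: "has_ac_density b G g"
  shows "has_ac_density b (\<lambda>x. F x * G x) (\<lambda>x. F x * g x + G x * f x)"
proof -
  obtain B1 where B1: "0 < B1" "\<And>x. x \<in> {0..b} \<Longrightarrow> norm (F x) \<le> B1" using ac_density_bounded[OF F] by blast
  obtain B2 where B2: "0 < B2" "\<And>x. x \<in> {0..b} \<Longrightarrow> norm (G x) \<le> B2" using ac_density_bounded[OF G] by blast
  obtain N1 where N1: "negligible N1" "\<And>x. x \<in> {0..b} - N1 \<Longrightarrow> (F has_vector_derivative f x) (at x)"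
    using ac_density_derivative[OF F] by blast
  obtain N2 where N2: "negligible N2" "\<And>x. x \<in> {0..b} - N2 \<Longrightarrow> (G has_vector_derivative g x) (at x)"
    using ac_density_derivative[OF G] by blast
  show ?thesis
  proof (rule ac_densityI)
    show "absolutely_continuous_fn 0 b (\<lambda>x. F x * G x)"
    proof (rule absolutely_continuous_fn_dominated[OF ac_density_absolutely_continuous[OF F]
          ac_density_absolutely_continuous[OF G], of "B1 + B2"])
      fix u v assume uv: "u \<in> {0..b}" "v \<in> {0..b}"
      have "F v * G v - F u * G u = F v * (G v - G u) + G u * (F v - F u)" by (simp add: algebra_simps)
      also have "norm \<dots> \<le> B1 * norm (G v - G u) + B2 * norm (F v - F u)"
        using B1 B2 uv by (intro norm_triangle_le add_mono) (auto simp: norm_mult intro!: mult_right_mono)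
      also have "\<dots> \<le> (B1 + B2) * (norm (F v - F u) + norm (G v - G u))"
        using B1(1) B2(1) by (simp add: algebra_simps)
      finally show "norm (F v * G v - F u * G u) \<le> (B1 + B2) * (norm (F v - F u) + norm (G v - G u))" .
    qed (use B1 B2 in auto)
    show "(\<lambda>x. F x * g x + G x * f x) absolutely_integrable_on {0..b}"
      using F G ac_density_continuous[OF F] ac_density_continuous[OF G] unfolding has_ac_density_def
      by (intro set_integral_add absolutely_integrable_continuous_mult) auto
    show "negligible (N1 \<union> N2)" using N1 N2 by simp
    fix x assume "x \<in> {0..b} - (N1 \<union> N2)"
    then show "((\<lambda>x. F x * G x) has_vector_derivative F x * g x + G x * f x) (at x)"
      using has_vector_derivative_mult[OF N1(2) N2(2)] by (simp add: mult.commute)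
  qed
qed

lemma ac_density_exp:
  assumes F: "has_ac_density b F f"
  shows "has_ac_density b (\<lambda>x. exp (F x)) (\<lambda>x. exp (F x) * f x)"
proof -
  obtain B where B: "0 < B" "\<And>x. x \<in> {0..b} \<Longrightarrow> norm (F x) \<le> B" using ac_density_bounded[OF F] by blast
  obtain N where N: "negligible N" "\<And>x. x \<in> {0..b} - N \<Longrightarrow> (F has_vector_derivative f x) (at x)"
    using ac_density_derivative[OF F] by blast
  show ?thesis
  proof (rule ac_densityI)
    show "absolutely_continuous_fn 0 b (\<lambda>x. exp (F x))"
    proof (rule absolutely_continuous_fn_dominated[OF ac_density_absolutely_continuous[OF F]
          ac_density_absolutely_continuous[OF F], of "exp B"])
      fix u v assume uv: "u \<in> {0..b}" "v \<in> {0..b}"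
      have "norm (exp (F v) - exp (F u)) \<le> exp B * norm (F v - F u)"
      proof (rule field_differentiable_bound[of "cball 0 B"])
        show "norm (exp z) \<le> exp B" if "z \<in> cball 0 B" for z :: complex
          using that by (metis dist_0_norm dual_order.trans exp_le_cancel_iff mem_cball norm_exp)
      qed (use B uv in \<open>auto intro!: derivative_eq_intros\<close>)
      also have "\<dots> \<le> exp B * (norm (F v - F u) + norm (F v - F u))"
        by (intro mult_left_mono) auto
      finally show "norm (exp (F v) - exp (F u)) \<le> exp B * (norm (F v - F u) + norm (F v - F u))" .
    qed auto
    show "(\<lambda>x. exp (F x) * f x) absolutely_integrable_on {0..b}"
      using F ac_density_continuous[OF F] unfolding has_ac_density_def
      by (intro absolutely_integrable_continuous_mult continuous_intros) auto
    show "negligible N" by fact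
    fix x assume "x \<in> {0..b} - N"
    then show "((\<lambda>x. exp (F x)) has_vector_derivative exp (F x) * f x) (at x)"
      using field_vector_diff_chain_at[OF N(2) DERIV_exp] by (simp add: o_def mult.commute)
  qed
qed

lemma ac_density_unique:
  assumes "has_ac_density b F f" "has_ac_density b F g"
  shows "negligible {x \<in> {0..b}. f x \<noteq> g x}"
proof -
  obtain N1 where N1: "negligible N1" "\<And>x. x \<in> {0..b} - N1 \<Longrightarrow> (F has_vector_derivative f x) (at x)"
    using ac_density_derivative[OF assms(1)] by blast
  obtain N2 where N2: "negligible N2" "\<And>x. x \<in> {0..b} - N2 \<Longrightarrow> (F has_vector_derivative g x) (at x)"
    using ac_density_derivative[OF assms(2)] by blast
  show ?thesis
  proof (rule negligible_subset[of "N1 \<union> N2"])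
    show "{x \<in> {0..b}. f x \<noteq> g x} \<subseteq> N1 \<union> N2"
      using N1(2) N2(2) vector_derivative_unique_at by blast
  qed (use N1 N2 in simp)
qed

section \<open>Gronwall's inequality with an integrable kernel\<close>

text \<open>
  The chain rule for absolutely continuous functions, for an integral whose integrand is only
  integrable.
\<close>
lemma integral_exp_indefinite_integral:
  fixes k :: "real \<Rightarrow> real"
  assumes k: "k absolutely_integrable_on {0..b}" and x: "0 \<le> x" "x \<le> b"
  defines "\<kappa> \<equiv> \<lambda>x. integral {0..x} k"
  shows "((\<lambda>t. k t * exp (c * \<kappa> t) * c) has_integral exp (c * \<kappa> x) - 1) {0..x}"
proof -
  have "has_ac_density b (\<lambda>x. of_real (\<kappa> x)) (\<lambda>x. of_real (k x))"
  proof (rule ac_densityI_has_integral)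
    show "(\<lambda>x. complex_of_real (k x)) absolutely_integrable_on {0..b}"
      using absolutely_integrable_linear[OF k bounded_linear_of_real[where 'a=complex]] by (simp add: o_def)
    fix x assume x: "0 \<le> x" "x \<le> b"
    have "k integrable_on {0..x}"
      using x by (intro absolutely_integrable_integrable absolutely_integrable_on_subinterval[OF k]) auto
    then have "(k has_integral \<kappa> x - \<kappa> 0) {0..x}" by (auto simp: \<kappa>_def)
    from has_integral_linear[OF this bounded_linear_of_real[where 'a=complex]]
    show "((\<lambda>x. complex_of_real (k x)) has_integral complex_of_real (\<kappa> x) - complex_of_real (\<kappa> 0)) {0..x}"
      by (simp add: o_def)
  qed
  from ac_density_increment[OF ac_density_exp[OF ac_density_cmult[OF this, of "of_real c"]], of 0 x]
  have "((\<lambda>t. exp (of_real c * of_real (\<kappa> t)) * (complex_of_real c * of_real (k t))) has_integral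
      exp (of_real c * of_real (\<kappa> x)) - 1) {0..x}"
    using x by (simp add: \<kappa>_def)
  from has_integral_linear[OF this bounded_linear_Re]
  show ?thesis by (simp add: o_def mult_ac exp_of_real flip: of_real_mult)
qed

text \<open>
  Let \<open>\<kappa>\<close> be the integral of the kernel. The best constant \<open>c\<close> in
  \<open>u \<le> c exp \<kappa>\<close> is attained at some point, and the hypothesis there, with
  \<open>u\<close> estimated by \<open>c exp \<kappa>\<close> under the integral, yields \<open>c
  \<le> a\<close>.
\<close>
lemma gronwall_integrable_kernel:
  fixes u k :: "real \<Rightarrow> real"
  assumes u: "continuous_on {0..b} u" and k: "k absolutely_integrable_on {0..b}" "\<And>x. x \<in> {0..b} \<Longrightarrow> 0 \<le> k x"
    and le: "\<And>x. 0 \<le> x \<Longrightarrow> x \<le> b \<Longrightarrow> u x \<le> a + integral {0..x} (\<lambda>t. k t * u t)"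
    and x: "0 \<le> x" "x \<le> b"
  shows "u x \<le> a * exp (integral {0..x} k)"
proof -
  define \<kappa> where "\<kappa> x = integral {0..x} k" for x
  have \<kappa>: "continuous_on {0..b} \<kappa>"
    unfolding \<kappa>_def using k(1) by (intro indefinite_integral_continuous_1 absolutely_integrable_integrable)
  have "continuous_on {0..b} (\<lambda>x. u x * exp (- \<kappa> x))" using u \<kappa> by (intro continuous_intros)
  moreover have "{0..b} \<noteq> {}" using x by auto
  ultimately obtain z where z: "z \<in> {0..b}" "\<And>y. y \<in> {0..b} \<Longrightarrow> u y * exp (- \<kappa> y) \<le> u z * exp (- \<kappa> z)"
    using continuous_attains_sup[of "{0..b}" "\<lambda>x. u x * exp (- \<kappa> x)"] by blast
  define c where "c = u z * exp (- \<kappa> z)"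
  have uc: "u y \<le> c * exp (\<kappa> y)" if "y \<in> {0..b}" for y
    using z(2)[OF that] by (simp add: c_def exp_minus field_simps)
  have I: "((\<lambda>t. k t * exp (\<kappa> t)) has_integral exp (\<kappa> z) - 1) {0..z}"
    using integral_exp_indefinite_integral[OF k(1), of z 1] z by (simp add: \<kappa>_def)
  have ki: "(\<lambda>t. k t * u t) integrable_on {0..z}"
  proof (rule integrable_on_subinterval)
    show "(\<lambda>t. k t * u t) integrable_on {0..b}"
      using absolutely_integrable_mult_continuous_real[OF u k(1)] by (rule absolutely_integrable_integrable)
  qed (use z in auto)
  have "c * exp (\<kappa> z) = u z" by (simp add: c_def exp_minus)
  also have "\<dots> \<le> a + integral {0..z} (\<lambda>t. k t * u t)" using le z by auto
  also have "integral {0..z} (\<lambda>t. k t * u t) \<le> integral {0..z} (\<lambda>t. c * (k t * exp (\<kappa> t)))"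
  proof (rule integral_le[OF ki])
    show "(\<lambda>t. c * (k t * exp (\<kappa> t))) integrable_on {0..z}"
      using I by (intro integrable_on_mult_right) blast
    fix t assume "t \<in> {0..z}"
    then have "t \<in> {0..b}" using z by auto
    then show "k t * u t \<le> c * (k t * exp (\<kappa> t))"
      using mult_left_mono[OF uc k(2)] by (simp add: mult_ac)
  qed
  also have "\<dots> = c * (exp (\<kappa> z) - 1)"
    using has_integral_mult_right[OF I, of c] by (rule integral_unique)
  finally have "c \<le> a" by (simp add: algebra_simps)
  then have "c * exp (\<kappa> x) \<le> a * exp (\<kappa> x)" by simp
  with uc[of x] x have "u x \<le> a * exp (\<kappa> x)" by (meson atLeastAtMost_iff order_trans)
  then show ?thesis by (simp add: \<kappa>_def)
qed

section \<open>The pencil as a Caratheodory system\<close>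

definition pencil_coeffs :: "real \<Rightarrow> (real \<Rightarrow> complex) \<Rightarrow> (real \<Rightarrow> complex) \<Rightarrow> bool" where
  "pencil_coeffs b p q \<longleftrightarrow> 0 < b \<and> continuous_on {0..b} p \<and> q absolutely_integrable_on {0..b}"

text \<open>
  The equation as a first-order system for \<open>y\<close> and its derivative \<open>z\<close>; in
  this form the interval can be restricted, translated and reflected.
\<close>
definition pencil_pair ::
    "real \<Rightarrow> (real \<Rightarrow> complex) \<Rightarrow> (real \<Rightarrow> complex) \<Rightarrow> complex \<Rightarrow> (real \<Rightarrow> complex) \<Rightarrow> (real \<Rightarrow> complex) \<Rightarrow> bool" where
  "pencil_pair b p q \<mu> y z \<longleftrightarrow>
     has_ac_density b y z \<and> has_ac_density b z (\<lambda>x. (q x + 2 * \<mu> * p x - \<mu>\<^sup>2) * y x)"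

lemma pencil_coeffs_D:
  assumes "pencil_coeffs b p q"
  shows "0 < b" "continuous_on {0..b} p" "q absolutely_integrable_on {0..b}"
    "p absolutely_integrable_on {0..b}"
    "(\<lambda>x. norm (p x)) absolutely_integrable_on {0..b}"
    "(\<lambda>x. norm (q x)) absolutely_integrable_on {0..b}"
proof -
  show "0 < b" and p: "continuous_on {0..b} p" and q: "q absolutely_integrable_on {0..b}"
    using assms unfolding pencil_coeffs_def by auto
  show p': "p absolutely_integrable_on {0..b}" using p by (rule absolutely_integrable_continuous_real)
  show "(\<lambda>x. norm (p x)) absolutely_integrable_on {0..b}" "(\<lambda>x. norm (q x)) absolutely_integrable_on {0..b}"
    using p' q by (auto intro: absolutely_integrable_norm')
qed

lemma potential_absolutely_integrable:
  assumes "pencil_coeffs b p q"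
  shows "(\<lambda>x. q x + 2 * \<mu> * p x - \<mu>\<^sup>2) absolutely_integrable_on {0..b}"
  using pencil_coeffs_D(2)[OF assms]
  by (intro set_integral_diff(1) set_integral_add(1) pencil_coeffs_D(3)[OF assms]
      absolutely_integrable_continuous_real continuous_intros)

lemma pencil_pair_continuous:
  assumes "pencil_pair b p q \<mu> y z"
  shows "continuous_on {0..b} y" "continuous_on {0..b} z"
  using assms ac_density_continuous unfolding pencil_pair_def by blast+

lemma pencil_pair_lincomb:
  assumes "pencil_pair b p q \<mu> y z" "pencil_pair b p q \<mu> y' z'"
  shows "pencil_pair b p q \<mu> (\<lambda>x. c * y x + d * y' x) (\<lambda>x. c * z x + d * z' x)"
proof -
  have "has_ac_density b (\<lambda>x. c * z x + d * z' x)
     (\<lambda>x. c * ((q x + 2 * \<mu> * p x - \<mu>\<^sup>2) * y x) + d * ((q x + 2 * \<mu> * p x - \<mu>\<^sup>2) * y' x))"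
    using assms unfolding pencil_pair_def by (intro ac_density_add ac_density_cmult) auto
  moreover have "(\<lambda>x. c * ((q x + 2 * \<mu> * p x - \<mu>\<^sup>2) * y x) + d * ((q x + 2 * \<mu> * p x - \<mu>\<^sup>2) * y' x))
     = (\<lambda>x. (q x + 2 * \<mu> * p x - \<mu>\<^sup>2) * (c * y x + d * y' x))"
    by (simp add: algebra_simps)
  ultimately show ?thesis
    using assms unfolding pencil_pair_def by (auto intro!: ac_density_add ac_density_cmult)
qed

lemma pencil_pair_cong:
  assumes "pencil_pair b p q \<mu> y z" "0 \<le> b"
    and "\<And>x. x \<in> {0..b} \<Longrightarrow> y' x = y x" "\<And>x. x \<in> {0..b} \<Longrightarrow> z' x = z x"
    and N: "negligible N" "\<And>x. x \<in> {0..b} - N \<Longrightarrow> p' x = p x \<and> q' x = q x"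
  shows "pencil_pair b p' q' \<mu> y' z'"
  unfolding pencil_pair_def
proof
  show "has_ac_density b y' z'"
    using assms ac_density_cong[of b y z "{}" y' z'] unfolding pencil_pair_def by auto
  show "has_ac_density b z' (\<lambda>x. (q' x + 2 * \<mu> * p' x - \<mu>\<^sup>2) * y' x)"
    by (rule ac_density_cong[OF _ assms(2) N(1), of z "\<lambda>x. (q x + 2 * \<mu> * p x - \<mu>\<^sup>2) * y x"])
       (use assms in \<open>auto simp: pencil_pair_def\<close>)
qed

lemma pencil_pair_restrict:
  assumes "pencil_pair b p q \<mu> y z" "c \<le> b"
  shows "pencil_pair c p q \<mu> y z"
  using assms ac_density_restrict unfolding pencil_pair_def by blast

lemma pencil_pair_shift:
  assumes "pencil_pair b p q \<mu> y z" "0 \<le> c"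
  shows "pencil_pair (b - c) (\<lambda>s. p (c + s)) (\<lambda>s. q (c + s)) \<mu> (\<lambda>s. y (c + s)) (\<lambda>s. z (c + s))"
  using assms ac_density_shift[of b y z c] ac_density_shift[of b z _ c] unfolding pencil_pair_def by auto

lemma pencil_pair_reflect:
  assumes "pencil_pair b p q \<mu> y z"
  shows "pencil_pair b (\<lambda>s. p (b - s)) (\<lambda>s. q (b - s)) \<mu> (\<lambda>s. y (b - s)) (\<lambda>s. - z (b - s))"
  unfolding pencil_pair_def
proof
  show "has_ac_density b (\<lambda>s. y (b - s)) (\<lambda>s. - z (b - s))"
    using assms unfolding pencil_pair_def by (intro ac_density_reflect) auto
  have "has_ac_density b (\<lambda>s. (-1) * z (b - s)) (\<lambda>s. (-1) * - ((q (b - s) + 2 * \<mu> * p (b - s) - \<mu>\<^sup>2) * y (b - s)))"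
    using assms unfolding pencil_pair_def by (intro ac_density_cmult ac_density_reflect) auto
  then show "has_ac_density b (\<lambda>s. - z (b - s)) (\<lambda>s. (q (b - s) + 2 * \<mu> * p (b - s) - \<mu>\<^sup>2) * y (b - s))" by simp
qed

text \<open>Carries estimates in the upper half plane of the spectral parameter over to the lower one.\<close>
lemma pencil_pair_neg:
  "pencil_pair b p q \<mu> y z \<longleftrightarrow> pencil_pair b (\<lambda>x. - p x) q (- \<mu>) y z"
  unfolding pencil_pair_def by simp

lemma pencil_pair_unique_zero:
  assumes co: "pencil_coeffs b p q" and yz: "pencil_pair b p q \<mu> y z" and 0: "y 0 = 0" "z 0 = 0"
    and x: "x \<in> {0..b}"
  shows "y x = 0 \<and> z x = 0"
proof -
  define V where "V x = q x + 2 * \<mu> * p x - \<mu>\<^sup>2" for x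
  define u where "u x = norm (y x) + norm (z x)" for x
  define k where "k x = 1 + norm (V x)" for x
  note D = pencil_coeffs_D[OF co] and c = pencil_pair_continuous[OF yz]
  have V: "V absolutely_integrable_on {0..b}"
    unfolding V_def using potential_absolutely_integrable[OF co] .
  have k: "k absolutely_integrable_on {0..b}"
    unfolding k_def
    by (intro set_integral_add(1) absolutely_integrable_continuous_real[OF continuous_on_const] absolutely_integrable_norm'[OF V])
  have cu: "continuous_on {0..b} u" unfolding u_def using c by (intro continuous_intros)
  have "u x \<le> 0 * exp (integral {0..x} k)"
  proof (rule gronwall_integrable_kernel[OF cu k])
    fix x assume x: "0 \<le> x" "x \<le> b"
    have sub: "{0..x} \<subseteq> {0..b}" using x by auto
    have i1: "(\<lambda>t. norm (z t)) integrable_on {0..x}"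
      using c sub by (intro integrable_continuous_real continuous_intros) (auto intro: continuous_on_subset)
    have "(\<lambda>t. norm (V t) * norm (y t)) absolutely_integrable_on {0..b}"
      using c by (intro absolutely_integrable_mult_continuous_real absolutely_integrable_norm'[OF V] continuous_intros)
    then have i2: "(\<lambda>t. norm (V t) * norm (y t)) integrable_on {0..x}"
      using absolutely_integrable_integrable absolutely_integrable_on_subinterval[OF _ sub] by blast
    have i3: "(\<lambda>t. k t * u t) integrable_on {0..x}"
      using absolutely_integrable_integrable absolutely_integrable_on_subinterval[OF _ sub]
        absolutely_integrable_mult_continuous_real[OF cu k] by blast
    have "norm (y x - y 0) \<le> integral {0..x} (\<lambda>t. norm (z t))"
      using yz x i1 unfolding pencil_pair_def by (intro ac_density_increment_bound) auto
    moreover have "norm (z x - z 0) \<le> integral {0..x} (\<lambda>t. norm (V t) * norm (y t))"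
      using yz x i2 unfolding pencil_pair_def
      by (intro ac_density_increment_bound[where f="\<lambda>x. (q x + 2 * \<mu> * p x - \<mu>\<^sup>2) * y x"]) (auto simp: V_def norm_mult)
    ultimately have "u x \<le> integral {0..x} (\<lambda>t. norm (z t)) + integral {0..x} (\<lambda>t. norm (V t) * norm (y t))"
      using 0 by (simp add: u_def)
    also have "\<dots> = integral {0..x} (\<lambda>t. norm (z t) + norm (V t) * norm (y t))"
      using i1 i2 by (simp add: Henstock_Kurzweil_Integration.integral_add)
    also have "\<dots> \<le> integral {0..x} (\<lambda>t. k t * u t)"
    proof (rule integral_le[OF integrable_add[OF i1 i2] i3])
      fix t
      have "0 \<le> norm (y t) + norm (V t) * norm (z t)" by simp
      then show "norm (z t) + norm (V t) * norm (y t) \<le> k t * u t"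
        unfolding k_def u_def by (simp add: algebra_simps)
    qed
    finally show "u x \<le> 0 + integral {0..x} (\<lambda>t. k t * u t)" by simp
  qed (use x in \<open>auto simp: k_def\<close>)
  then have "norm (y x) + norm (z x) \<le> 0" by (simp add: u_def)
  then show ?thesis by (smt (verit) norm_ge_zero norm_eq_zero)
qed

lemma pencil_pair_unique:
  assumes co: "pencil_coeffs b p q" and yz: "pencil_pair b p q \<mu> y z" "pencil_pair b p q \<mu> y' z'"
    and 0: "y 0 = y' 0" "z 0 = z' 0" and x: "x \<in> {0..b}"
  shows "y x = y' x" "z x = z' x"
  using pencil_pair_unique_zero[OF co pencil_pair_lincomb[OF yz, of 1 "-1"] _ _ x] 0 by auto

text \<open>
  The spectral parameter enters the system only through the potential, which cancels in the
  derivative of the Wronskian.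
\<close>
lemma pencil_pair_wronskian:
  assumes yz: "pencil_pair b p q \<mu> y z" and y'z': "pencil_pair b p q \<mu> y' z'" and x: "x \<in> {0..b}"
  shows "y x * z' x - z x * y' x = y 0 * z' 0 - z 0 * y' 0"
proof -
  define V where "V x = q x + 2 * \<mu> * p x - \<mu>\<^sup>2" for x
  have 1: "has_ac_density b (\<lambda>x. y x * z' x) (\<lambda>x. y x * (V x * y' x) + z' x * z x)"
    using yz y'z' unfolding pencil_pair_def V_def by (intro ac_density_mult) auto
  have 2: "has_ac_density b (\<lambda>x. z x * y' x) (\<lambda>x. z x * z' x + y' x * (V x * y x))"
    using yz y'z' unfolding pencil_pair_def V_def by (intro ac_density_mult) auto
  have "((\<lambda>x. y x * (V x * y' x) + z' x * z x - (z x * z' x + y' x * (V x * y x))) has_integral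
      (y x * z' x - z x * y' x) - (y 0 * z' 0 - z 0 * y' 0)) {0..x}"
    using ac_density_increment[OF ac_density_diff[OF 1 2], of 0 x] x by auto
  moreover have "(\<lambda>x. y x * (V x * y' x) + z' x * z x - (z x * z' x + y' x * (V x * y x))) = (\<lambda>x. 0)"
    by (simp add: algebra_simps)
  ultimately show ?thesis by simp
qed

section \<open>Bounded functionals and weakly entire families\<close>

text \<open>
  All requirements are restricted to functions continuous on the interval: a Stieltjes form is a
  definite description whose value may be undetermined for other functions.
\<close>
definition bounded_functional :: "real \<Rightarrow> ((real \<Rightarrow> complex) \<Rightarrow> complex) \<Rightarrow> bool" where
  "bounded_functional b L \<longleftrightarrow>
     (\<forall>f g. continuous_on {0..b} f \<longrightarrow> continuous_on {0..b} g \<longrightarrow> L (\<lambda>x. f x + g x) = L f + L g) \<and>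
     (\<forall>c f. continuous_on {0..b} f \<longrightarrow> L (\<lambda>x. c * f x) = c * L f) \<and>
     (\<exists>K\<ge>0. \<forall>f M. continuous_on {0..b} f \<longrightarrow> (\<forall>x\<in>{0..b}. norm (f x) \<le> M) \<longrightarrow> norm (L f) \<le> K * M)"

lemma bounded_functionalD:
  assumes "bounded_functional b L"
  shows "continuous_on {0..b} f \<Longrightarrow> continuous_on {0..b} g \<Longrightarrow> L (\<lambda>x. f x + g x) = L f + L g"
    and "continuous_on {0..b} f \<Longrightarrow> L (\<lambda>x. c * f x) = c * L f"
    and "continuous_on {0..b} f \<Longrightarrow> continuous_on {0..b} g \<Longrightarrow> L (\<lambda>x. f x - g x) = L f - L g"
proof -
  show *: "L (\<lambda>x. f x + g x) = L f + L g" if "continuous_on {0..b} f" "continuous_on {0..b} g" for f g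
    using assms that unfolding bounded_functional_def by blast
  show **: "L (\<lambda>x. c * f x) = c * L f" if "continuous_on {0..b} f" for c f
    using assms that unfolding bounded_functional_def by blast
  show "L (\<lambda>x. f x - g x) = L f - L g" if "continuous_on {0..b} f" "continuous_on {0..b} g"
    using *[of f "\<lambda>x. (-1) * g x"] **[of g "-1"] that by (auto intro: continuous_intros)
qed

lemma bounded_functional_bound:
  assumes "bounded_functional b L"
  shows "\<exists>K\<ge>0. \<forall>f M. continuous_on {0..b} f \<longrightarrow> (\<forall>x\<in>{0..b}. norm (f x) \<le> M) \<longrightarrow> norm (L f) \<le> K * M"
  using assms unfolding bounded_functional_def by (elim conjE)

lemma bounded_functional_cong:
  assumes L: "bounded_functional b L" and "continuous_on {0..b} f" "\<And>x. x \<in> {0..b} \<Longrightarrow> f x = g x"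
  shows "L f = L g"
proof -
  obtain K where K0: "0 \<le> K" and
    Kb: "\<forall>f M. continuous_on {0..b} f \<longrightarrow> (\<forall>x\<in>{0..b}. norm (f x) \<le> M) \<longrightarrow> norm (L f) \<le> K * M"
    using bounded_functional_bound[OF L] by blast
  note K = K0 Kb[rule_format]
  have g: "continuous_on {0..b} g" using assms(2,3) by (rule continuous_on_eq)
  have "norm (L (\<lambda>x. f x - g x)) \<le> K * 0"
    using assms g by (intro K(2) continuous_intros) auto
  then show ?thesis using bounded_functionalD(3)[OF L assms(2) g] by simp
qed

lemma bounded_functional_eval: "x \<in> {0..b} \<Longrightarrow> bounded_functional b (\<lambda>f. f x)"
  unfolding bounded_functional_def by (intro conjI exI[of _ 1]) auto

text \<open>
  A functional stays bounded when it is composed with a Volterra operator; this carries weak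
  analyticity through the integral equation.
\<close>
lemma bounded_functional_indefinite_integral:
  assumes L: "bounded_functional b L" and g: "g absolutely_integrable_on {0..b}"
  shows "bounded_functional b (\<lambda>f. L (\<lambda>x. integral {0..x} (\<lambda>t. g t * f t)))"
proof -
  obtain K where K0: "0 \<le> K" and
    Kb: "\<forall>f M. continuous_on {0..b} f \<longrightarrow> (\<forall>x\<in>{0..b}. norm (f x) \<le> M) \<longrightarrow> norm (L f) \<le> K * M"
    using bounded_functional_bound[OF L] by blast
  note K = K0 Kb[rule_format]
  have ai: "(\<lambda>t. g t * f t) integrable_on {0..x}" if "continuous_on {0..b} f" "x \<in> {0..b}" for f :: "real \<Rightarrow> complex" and x
    using absolutely_integrable_continuous_mult[OF that(1) g] that(2)
    by (intro absolutely_integrable_integrable) (auto simp: mult.commute intro: absolutely_integrable_on_subinterval)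
  have cont: "continuous_on {0..b} (\<lambda>x. integral {0..x} (\<lambda>t. g t * f t))" if "continuous_on {0..b} f" for f :: "real \<Rightarrow> complex"
    using absolutely_integrable_continuous_mult[OF that g]
    by (intro indefinite_integral_continuous_1 absolutely_integrable_integrable) (simp add: mult.commute)
  have ng: "(\<lambda>t. norm (g t)) integrable_on {0..b}"
    by (intro absolutely_integrable_integrable absolutely_integrable_norm'[OF g])
  show ?thesis
    unfolding bounded_functional_def
  proof (intro conjI allI impI)
    fix f h :: "real \<Rightarrow> complex" assume fh: "continuous_on {0..b} f" "continuous_on {0..b} h"
    have "L (\<lambda>x. integral {0..x} (\<lambda>t. g t * (f t + h t))) =
        L (\<lambda>x. integral {0..x} (\<lambda>t. g t * f t) + integral {0..x} (\<lambda>t. g t * h t))"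
      using fh ai by (intro bounded_functional_cong[OF L] cont continuous_intros)
        (auto simp: distrib_left Henstock_Kurzweil_Integration.integral_add)
    then show "L (\<lambda>x. integral {0..x} (\<lambda>t. g t * (f t + h t))) =
        L (\<lambda>x. integral {0..x} (\<lambda>t. g t * f t)) + L (\<lambda>x. integral {0..x} (\<lambda>t. g t * h t))"
      using bounded_functionalD(1)[OF L cont[OF fh(1)] cont[OF fh(2)]] by simp
  next
    fix c :: complex and f :: "real \<Rightarrow> complex" assume f: "continuous_on {0..b} f"
    have "(\<lambda>x. integral {0..x} (\<lambda>t. g t * (c * f t))) = (\<lambda>x. c * integral {0..x} (\<lambda>t. g t * f t))"
      by (simp add: mult.left_commute flip: integral_mult_right)
    then show "L (\<lambda>x. integral {0..x} (\<lambda>t. g t * (c * f t))) = c * L (\<lambda>x. integral {0..x} (\<lambda>t. g t * f t))"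
      using bounded_functionalD(2)[OF L cont[OF f]] by simp
  next
    show "\<exists>K\<ge>0. \<forall>f M. continuous_on {0..b} f \<longrightarrow> (\<forall>x\<in>{0..b}. norm (f x) \<le> M) \<longrightarrow>
       norm (L (\<lambda>x. integral {0..x} (\<lambda>t. g t * f t))) \<le> K * M"
    proof (intro exI[of _ "K * integral {0..b} (\<lambda>t. norm (g t))"] conjI allI impI)
      fix f :: "real \<Rightarrow> complex" and M assume f: "continuous_on {0..b} f" and M: "\<forall>x\<in>{0..b}. norm (f x) \<le> M"
      have "norm (integral {0..x} (\<lambda>t. g t * f t)) \<le> integral {0..b} (\<lambda>t. norm (g t)) * M" if x: "x \<in> {0..b}" for x
      proof -
        have M0: "0 \<le> M" using M x by (metis norm_ge_zero order_trans)
        have ngx: "(\<lambda>t. norm (g t)) integrable_on {0..x}"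
          using x by (intro integrable_on_subinterval[OF ng]) auto
        have "norm (integral {0..x} (\<lambda>t. g t * f t)) \<le> integral {0..x} (\<lambda>t. norm (g t) * M)"
          using x M ngx by (intro integral_norm_bound_integral ai f integrable_on_mult_left)
            (auto simp: norm_mult intro!: mult_left_mono)
        also have "\<dots> = integral {0..x} (\<lambda>t. norm (g t)) * M" by simp
        also have "\<dots> \<le> integral {0..b} (\<lambda>t. norm (g t)) * M"
          using x M0 ng ngx by (intro mult_right_mono integral_subset_le) auto
        finally show ?thesis .
      qed
      from K(2)[OF cont[OF f] this]
      show "norm (L (\<lambda>x. integral {0..x} (\<lambda>t. g t * f t))) \<le> K * integral {0..b} (\<lambda>t. norm (g t)) * M"
        by (simp add: mult.assoc)
    qed (use K in \<open>simp add: integral_nonneg ng\<close>)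
  qed
qed

text \<open>Testing with every bounded functional covers point values and Stieltjes forms at once.\<close>
definition weakly_entire :: "real \<Rightarrow> (complex \<Rightarrow> real \<Rightarrow> complex) \<Rightarrow> bool" where
  "weakly_entire b F \<longleftrightarrow>
     (\<forall>\<mu>. continuous_on {0..b} (F \<mu>)) \<and>
     (\<forall>L. bounded_functional b L \<longrightarrow> (\<lambda>\<mu>. L (F \<mu>)) holomorphic_on UNIV)"

lemma weakly_entire_const: "continuous_on {0..b} f \<Longrightarrow> weakly_entire b (\<lambda>\<mu>. f)"
  unfolding weakly_entire_def by auto

lemma weakly_entire_add:
  assumes "weakly_entire b F" "weakly_entire b G"
  shows "weakly_entire b (\<lambda>\<mu> x. F \<mu> x + G \<mu> x)"
  unfolding weakly_entire_def
proof (intro conjI allI impI)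
  fix L assume L: "bounded_functional b L"
  have "L (\<lambda>x. F \<mu> x + G \<mu> x) = L (F \<mu>) + L (G \<mu>)" for \<mu>
    by (rule bounded_functionalD(1)[OF L]) (use assms in \<open>auto simp: weakly_entire_def\<close>)
  then show "(\<lambda>\<mu>. L (\<lambda>x. F \<mu> x + G \<mu> x)) holomorphic_on UNIV"
    using assms L unfolding weakly_entire_def by (auto intro: holomorphic_on_add)
qed (use assms in \<open>auto simp: weakly_entire_def intro!: continuous_intros\<close>)

lemma weakly_entire_cmult:
  assumes "weakly_entire b F" "c holomorphic_on UNIV"
  shows "weakly_entire b (\<lambda>\<mu> x. c \<mu> * F \<mu> x)"
  unfolding weakly_entire_def
proof (intro conjI allI impI)
  fix L assume L: "bounded_functional b L"
  have "L (\<lambda>x. c \<mu> * F \<mu> x) = c \<mu> * L (F \<mu>)" for \<mu>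
    by (rule bounded_functionalD(2)[OF L]) (use assms in \<open>auto simp: weakly_entire_def\<close>)
  then show "(\<lambda>\<mu>. L (\<lambda>x. c \<mu> * F \<mu> x)) holomorphic_on UNIV"
    using assms L unfolding weakly_entire_def by (auto intro!: holomorphic_on_mult)
qed (use assms in \<open>auto simp: weakly_entire_def intro!: continuous_intros\<close>)

lemma weakly_entire_indefinite_integral:
  assumes F: "weakly_entire b F" and g: "g absolutely_integrable_on {0..b}"
  shows "weakly_entire b (\<lambda>\<mu> x. integral {0..x} (\<lambda>t. g t * F \<mu> t))"
  unfolding weakly_entire_def
proof (intro conjI allI impI)
  fix \<mu>
  show "continuous_on {0..b} (\<lambda>x. integral {0..x} (\<lambda>t. g t * F \<mu> t))"
    using F absolutely_integrable_continuous_mult[of 0 b "F \<mu>", OF _ g] unfolding weakly_entire_def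
    by (intro indefinite_integral_continuous_1 absolutely_integrable_integrable) (simp add: mult.commute)
qed (use F bounded_functional_indefinite_integral[OF _ g] in \<open>auto simp: weakly_entire_def\<close>)

lemma weakly_entire_cong:
  assumes "weakly_entire b F" "\<And>\<mu> x. x \<in> {0..b} \<Longrightarrow> F \<mu> x = G \<mu> x"
  shows "weakly_entire b G"
  unfolding weakly_entire_def
proof (intro conjI allI impI)
  show "continuous_on {0..b} (G \<mu>)" for \<mu>
    by (rule continuous_on_eq[of _ "F \<mu>"]) (use assms in \<open>auto simp: weakly_entire_def\<close>)
  fix L assume L: "bounded_functional b L"
  have "L (F \<mu>) = L (G \<mu>)" for \<mu>
    using assms by (intro bounded_functional_cong[OF L]) (auto simp: weakly_entire_def)
  then have "(\<lambda>\<mu>. L (G \<mu>)) = (\<lambda>\<mu>. L (F \<mu>))" by (intro ext) (rule sym)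
  then show "(\<lambda>\<mu>. L (G \<mu>)) holomorphic_on UNIV" using assms L by (simp only: weakly_entire_def)
qed

text \<open>Weierstrass' theorem on locally uniform limits, applied to each functional.\<close>
lemma weakly_entire_uniform_limit:
  assumes F: "\<And>n. weakly_entire b (F n)"
    and C: "\<And>R. \<exists>C r. r \<longlonglongrightarrow> (0::real) \<and> (\<forall>n \<mu> x. norm \<mu> \<le> R \<longrightarrow> x \<in> {0..b} \<longrightarrow> norm (F n \<mu> x - G \<mu> x) \<le> C * r n)"
  shows "weakly_entire b G"
proof -
  have cG: "continuous_on {0..b} (G \<mu>)" for \<mu>
  proof -
    obtain C r where r: "r \<longlonglongrightarrow> (0::real)" "\<And>n x. x \<in> {0..b} \<Longrightarrow> norm (F n \<mu> x - G \<mu> x) \<le> C * r n"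
      using C[of "norm \<mu>"] by (metis order_refl)
    have "uniform_limit {0..b} (\<lambda>n. F n \<mu>) (G \<mu>) sequentially"
    proof (rule uniform_limitI)
      fix e :: real assume e: "0 < e"
      have "(\<lambda>n. C * r n) \<longlonglongrightarrow> C * 0" by (intro tendsto_intros r)
      then have "\<forall>\<^sub>F n in sequentially. C * r n < e" using e by (intro order_tendstoD) auto
      then show "\<forall>\<^sub>F n in sequentially. \<forall>x\<in>{0..b}. dist (F n \<mu> x) (G \<mu> x) < e"
        by eventually_elim (auto simp: dist_norm intro: le_less_trans[OF r(2)])
    qed
    then show ?thesis
      by (rule uniform_limit_theorem[rotated]) (use F in \<open>auto simp: weakly_entire_def\<close>)
  qed
  show ?thesis
    unfolding weakly_entire_def
  proof (intro conjI allI impI cG)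
    fix L assume L: "bounded_functional b L"
    obtain K where K0: "0 \<le> K" and
    Kb: "\<forall>f M. continuous_on {0..b} f \<longrightarrow> (\<forall>x\<in>{0..b}. norm (f x) \<le> M) \<longrightarrow> norm (L f) \<le> K * M"
    using bounded_functional_bound[OF L] by blast
  note K = K0 Kb[rule_format]
    have cF: "continuous_on {0..b} (F n \<mu>)" for n \<mu> using F by (simp add: weakly_entire_def)
    show "(\<lambda>\<mu>. L (G \<mu>)) holomorphic_on UNIV"
    proof (rule holomorphic_uniform_sequence[of UNIV "\<lambda>n \<mu>. L (F n \<mu>)"])
      show "(\<lambda>\<mu>. L (F n \<mu>)) holomorphic_on UNIV" for n using F L by (simp add: weakly_entire_def)
      fix x :: complex
      obtain C r where r: "r \<longlonglongrightarrow> (0::real)"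
        "\<And>n \<mu> t. norm \<mu> \<le> norm x + 1 \<Longrightarrow> t \<in> {0..b} \<Longrightarrow> norm (F n \<mu> t - G \<mu> t) \<le> C * r n"
        using C[of "norm x + 1"] by blast
      have "uniform_limit (cball x 1) (\<lambda>n \<mu>. L (F n \<mu>)) (\<lambda>\<mu>. L (G \<mu>)) sequentially"
      proof (rule uniform_limitI)
        fix e :: real assume e: "0 < e"
        have "(\<lambda>n. K * (C * r n)) \<longlonglongrightarrow> K * (C * 0)" by (intro tendsto_intros r)
        then have "\<forall>\<^sub>F n in sequentially. K * (C * r n) < e" using e by (intro order_tendstoD) auto
        then show "\<forall>\<^sub>F n in sequentially. \<forall>\<mu>\<in>cball x 1. dist (L (F n \<mu>)) (L (G \<mu>)) < e"
        proof eventually_elim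
          case (elim n)
          show ?case
          proof
            fix \<mu> assume "\<mu> \<in> cball x 1"
            then have "norm \<mu> \<le> norm x + 1"
              using norm_triangle_ineq[of x "\<mu> - x"] by (simp add: dist_norm norm_minus_commute)
            then have "norm (L (\<lambda>t. F n \<mu> t - G \<mu> t)) \<le> K * (C * r n)"
              by (intro K(2) continuous_intros cF cG r(2))
            then show "dist (L (F n \<mu>)) (L (G \<mu>)) < e"
              using elim bounded_functionalD(3)[OF L cF cG] by (simp add: dist_norm)
          qed
        qed
      qed
      then show "\<exists>d>0. cball x d \<subseteq> UNIV \<and> uniform_limit (cball x d) (\<lambda>n \<mu>. L (F n \<mu>)) (\<lambda>\<mu>. L (G \<mu>)) sequentially"
        by (intro exI[of _ 1]) auto
    qed auto
  qed
qed

lemma weakly_entire_eval: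
  assumes "weakly_entire b F" "x \<in> {0..b}"
  shows "(\<lambda>\<mu>. F \<mu> x) holomorphic_on UNIV"
  using assms(1)[unfolded weakly_entire_def, THEN conjunct2, rule_format, OF bounded_functional_eval[OF assms(2)]] .

section \<open>Successive approximations\<close>

lemma geometric_steps_limit:
  fixes a :: "nat \<Rightarrow> complex"
  assumes a: "\<And>n. norm (a (Suc n) - a n) \<le> C / 2 ^ n"
  shows "norm (a n - lim a) \<le> 2 * C / 2 ^ n" "a \<longlonglongrightarrow> lim a"
proof -
  have C: "0 \<le> C" using order_trans[OF norm_ge_zero a[of 0]] by simp
  have *: "norm (a (n + j) - a n) \<le> C / 2 ^ n * (2 - 2 / 2 ^ j)" for n j
  proof (induction j)
    case (Suc j)
    have "norm (a (n + Suc j) - a n) \<le> norm (a (Suc (n + j)) - a (n + j)) + norm (a (n + j) - a n)"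
      using norm_triangle_ineq[of "a (Suc (n + j)) - a (n + j)" "a (n + j) - a n"] by simp
    also have "\<dots> \<le> C / 2 ^ (n + j) + C / 2 ^ n * (2 - 2 / 2 ^ j)"
      using a Suc by (intro add_mono) auto
    also have "\<dots> = C / 2 ^ n * (2 - 2 / 2 ^ Suc j)" by (simp add: field_simps power_add)
    finally show ?case .
  qed simp
  have le: "norm (a m - a n) \<le> 2 * C / 2 ^ n" if nm: "n \<le> m" for m n
  proof -
    obtain j where j: "m = n + j" using le_Suc_ex[OF nm] by blast
    have "C / 2 ^ n * (2 - 2 / 2 ^ j) \<le> C / 2 ^ n * 2" using C by (intro mult_left_mono) auto
    then show ?thesis using *[of n j] j by (simp add: mult.commute)
  qed
  have lim0: "(\<lambda>n. 2 * C / 2 ^ n) \<longlonglongrightarrow> 0"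
  proof -
    have "(\<lambda>n. 2 * C * (1 / 2) ^ n) \<longlonglongrightarrow> 2 * C * 0"
      by (intro tendsto_intros LIMSEQ_power_zero) auto
    then show ?thesis by (simp add: power_one_over)
  qed
  have "Cauchy a"
  proof (rule CauchyI')
    fix e :: real assume "0 < e"
    then have "\<forall>\<^sub>F n in sequentially. 2 * C / 2 ^ n < e" using lim0 by (intro order_tendstoD) auto
    then obtain N where N: "\<And>n. n \<ge> N \<Longrightarrow> 2 * C / 2 ^ n < e" unfolding eventually_sequentially by auto
    show "\<exists>M. \<forall>m\<ge>M. \<forall>n>m. dist (a m) (a n) < e"
    proof (intro exI[of _ N] allI impI)
      fix m n assume "N \<le> m" "m < n"
      then show "dist (a m) (a n) < e"
        using le[of m n] N[of m] by (simp add: dist_norm norm_minus_commute)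
    qed
  qed
  then show l: "a \<longlonglongrightarrow> lim a" by (simp add: Cauchy_convergent_iff convergent_LIMSEQ_iff)
  have "(\<lambda>m. norm (a n - a m)) \<longlonglongrightarrow> norm (a n - lim a)" by (intro tendsto_intros l)
  then show "norm (a n - lim a) \<le> 2 * C / 2 ^ n"
    by (rule LIMSEQ_le_const2) (metis le norm_minus_commute)
qed

lemma bounded_functional_limit:
  assumes L: "bounded_functional b L" and "\<And>n. continuous_on {0..b} (F n)" "continuous_on {0..b} G"
    and r: "r \<longlonglongrightarrow> (0::real)" "\<And>n x. x \<in> {0..b} \<Longrightarrow> norm (F n x - G x) \<le> r n"
  shows "(\<lambda>n. L (F n)) \<longlonglongrightarrow> L G"
proof -
  obtain K where K0: "0 \<le> K" and
    Kb: "\<forall>f M. continuous_on {0..b} f \<longrightarrow> (\<forall>x\<in>{0..b}. norm (f x) \<le> M) \<longrightarrow> norm (L f) \<le> K * M"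
    using bounded_functional_bound[OF L] by blast
  have "(\<lambda>n. L (F n) - L G) \<longlonglongrightarrow> 0"
  proof (rule Lim_null_comparison)
    show "\<forall>\<^sub>F n in sequentially. norm (L (F n) - L G) \<le> K * r n"
    proof (rule always_eventually, rule allI)
      fix n
      have "norm (L (\<lambda>x. F n x - G x)) \<le> K * r n"
        using assms by (intro Kb[rule_format] continuous_intros) auto
      then show "norm (L (F n) - L G) \<le> K * r n"
        using bounded_functionalD(3)[OF L assms(2,3)] by simp
    qed
    have "(\<lambda>n. K * r n) \<longlonglongrightarrow> K * 0" by (intro tendsto_intros r)
    then show "(\<lambda>n. K * r n) \<longlonglongrightarrow> 0" by simp
  qed
  then show ?thesis by (simp add: LIM_zero_iff)
qed

primrec picard :: "(complex \<Rightarrow> real \<Rightarrow> complex) \<Rightarrow> complex \<Rightarrow> complex \<Rightarrow> nat \<Rightarrow> complex \<Rightarrow> (real \<Rightarrow> complex) \<times> (real \<Rightarrow> complex)" where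
  "picard V y0 z0 0 \<mu> = (\<lambda>_. y0, \<lambda>_. z0)"
| "picard V y0 z0 (Suc n) \<mu> =
     (\<lambda>x. y0 + integral {0..x} (snd (picard V y0 z0 n \<mu>)),
      \<lambda>x. z0 + integral {0..x} (\<lambda>t. V \<mu> t * fst (picard V y0 z0 n \<mu>) t))"

lemma volterra_step_bound:
  fixes y z V :: "real \<Rightarrow> complex" and k w :: "real \<Rightarrow> real"
  assumes y: "continuous_on {0..b} y" and z: "continuous_on {0..b} z"
    and V: "V absolutely_integrable_on {0..b}" and k: "k absolutely_integrable_on {0..b}"
    and kV: "\<And>t. t \<in> {0..b} \<Longrightarrow> 1 \<le> k t \<and> norm (V t) \<le> k t"
    and w: "continuous_on {0..b} w" "\<And>t. t \<in> {0..b} \<Longrightarrow> norm (y t) + norm (z t) \<le> w t"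
    and x: "0 \<le> x" "x \<le> b"
  shows "norm (integral {0..x} z) + norm (integral {0..x} (\<lambda>t. V t * y t)) \<le> integral {0..x} (\<lambda>t. k t * w t)"
proof -
  have sub: "{0..x} \<subseteq> {0..b}" using x by auto
  have ii: "f integrable_on {0..x}" if "f absolutely_integrable_on {0..b}" for f :: "real \<Rightarrow> 'a::euclidean_space"
    using that absolutely_integrable_integrable absolutely_integrable_on_subinterval[OF _ sub] by blast
  have zi: "z integrable_on {0..x}" "(\<lambda>t. norm (z t)) integrable_on {0..x}"
    using z by (auto intro!: ii absolutely_integrable_continuous_real continuous_intros)
  have Vy: "(\<lambda>t. V t * y t) integrable_on {0..x}"
    using absolutely_integrable_continuous_mult[OF y V] by (intro ii) (simp add: mult.commute)
  have Vy': "(\<lambda>t. norm (V t) * norm (y t)) integrable_on {0..x}"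
    by (intro ii absolutely_integrable_mult_continuous_real absolutely_integrable_norm'[OF V] continuous_intros y)
  have kw: "(\<lambda>t. k t * w t) integrable_on {0..x}"
    by (intro ii absolutely_integrable_mult_continuous_real k w)
  have "norm (integral {0..x} z) \<le> integral {0..x} (\<lambda>t. norm (z t))"
    by (rule integral_norm_bound_integral[OF zi]) simp
  moreover have "norm (integral {0..x} (\<lambda>t. V t * y t)) \<le> integral {0..x} (\<lambda>t. norm (V t) * norm (y t))"
    by (rule integral_norm_bound_integral[OF Vy Vy']) (simp add: norm_mult)
  ultimately have "norm (integral {0..x} z) + norm (integral {0..x} (\<lambda>t. V t * y t))
      \<le> integral {0..x} (\<lambda>t. norm (z t) + norm (V t) * norm (y t))"
    using zi(2) Vy' by (simp add: Henstock_Kurzweil_Integration.integral_add)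
  also have "\<dots> \<le> integral {0..x} (\<lambda>t. k t * w t)"
  proof (rule integral_le[OF integrable_add[OF zi(2) Vy'] kw])
    fix t assume "t \<in> {0..x}"
    then have t: "t \<in> {0..b}" using sub by auto
    have "norm (z t) + norm (V t) * norm (y t) \<le> k t * norm (z t) + k t * norm (y t)"
      using kV[OF t] mult_right_mono[of 1 "k t" "norm (z t)"] by (intro add_mono mult_right_mono) auto
    also have "\<dots> = k t * (norm (y t) + norm (z t))" by (simp add: algebra_simps)
    also have "\<dots> \<le> k t * w t" using kV[OF t] w(2)[OF t] by (intro mult_left_mono) auto
    finally show "norm (z t) + norm (V t) * norm (y t) \<le> k t * w t" .
  qed
  finally show ?thesis .
qed

lemma picard_weakly_entire:
  assumes co: "pencil_coeffs b p q"
  defines "V \<equiv> \<lambda>\<mu> x. q x + 2 * \<mu> * p x - \<mu>\<^sup>2"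
  shows "weakly_entire b (\<lambda>\<mu>. fst (picard V y0 z0 n \<mu>)) \<and> weakly_entire b (\<lambda>\<mu>. snd (picard V y0 z0 n \<mu>))"
proof (induction n)
  case 0
  show ?case by (auto intro!: weakly_entire_const)
next
  case (Suc n)
  define Y where "Y \<mu> = fst (picard V y0 z0 n \<mu>)" for \<mu>
  define Z where "Z \<mu> = snd (picard V y0 z0 n \<mu>)" for \<mu>
  have Y: "weakly_entire b Y" and Z: "weakly_entire b Z" using Suc by (simp_all add: Y_def[abs_def] Z_def[abs_def])
  have one: "(\<lambda>x. 1::complex) absolutely_integrable_on {0..b}"
    by (intro absolutely_integrable_continuous_real continuous_intros)
  have "weakly_entire b (\<lambda>\<mu> x. y0 + integral {0..x} (\<lambda>t. 1 * Z \<mu> t))"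
    by (intro weakly_entire_add weakly_entire_const weakly_entire_indefinite_integral[OF Z one] continuous_intros)
  moreover have "weakly_entire b (\<lambda>\<mu> x. z0 + integral {0..x} (\<lambda>t. V \<mu> t * Y \<mu> t))"
  proof (rule weakly_entire_cong)
    show "weakly_entire b (\<lambda>\<mu> x. z0 + (integral {0..x} (\<lambda>t. q t * Y \<mu> t) +
        (2 * \<mu> * integral {0..x} (\<lambda>t. p t * Y \<mu> t) + (- \<mu>\<^sup>2) * integral {0..x} (\<lambda>t. 1 * Y \<mu> t))))"
      by (intro weakly_entire_add weakly_entire_cmult weakly_entire_const holomorphic_intros
          weakly_entire_indefinite_integral[OF Y] one pencil_coeffs_D[OF co] continuous_intros)
    fix \<mu> x assume x: "x \<in> {0..b}"
    have i: "(\<lambda>t. g t * Y \<mu> t) integrable_on {0..x}" if "g absolutely_integrable_on {0..b}" for g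
    proof -
      have "(\<lambda>t. Y \<mu> t * g t) absolutely_integrable_on {0..b}"
        using Y that by (intro absolutely_integrable_continuous_mult) (auto simp: weakly_entire_def)
      then have "(\<lambda>t. Y \<mu> t * g t) absolutely_integrable_on {0..x}"
        using x by (auto intro: absolutely_integrable_on_subinterval)
      then show ?thesis by (simp add: mult.commute absolutely_integrable_integrable)
    qed
    have "((\<lambda>t. q t * Y \<mu> t + (2 * \<mu> * (p t * Y \<mu> t) + (- \<mu>\<^sup>2) * (1 * Y \<mu> t))) has_integral
       (integral {0..x} (\<lambda>t. q t * Y \<mu> t) +
        (2 * \<mu> * integral {0..x} (\<lambda>t. p t * Y \<mu> t) + (- \<mu>\<^sup>2) * integral {0..x} (\<lambda>t. 1 * Y \<mu> t)))) {0..x}"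
      by (intro has_integral_add has_integral_mult_right integrable_integral i one pencil_coeffs_D[OF co])
    moreover have "(\<lambda>t. q t * Y \<mu> t + (2 * \<mu> * (p t * Y \<mu> t) + (- \<mu>\<^sup>2) * (1 * Y \<mu> t))) = (\<lambda>t. V \<mu> t * Y \<mu> t)"
      by (simp add: V_def algebra_simps)
    ultimately have "integral {0..x} (\<lambda>t. V \<mu> t * Y \<mu> t) = integral {0..x} (\<lambda>t. q t * Y \<mu> t) +
        (2 * \<mu> * integral {0..x} (\<lambda>t. p t * Y \<mu> t) + (- \<mu>\<^sup>2) * integral {0..x} (\<lambda>t. 1 * Y \<mu> t))"
      by (intro integral_unique) (simp only:)
    then show "z0 + (integral {0..x} (\<lambda>t. q t * Y \<mu> t) +
        (2 * \<mu> * integral {0..x} (\<lambda>t. p t * Y \<mu> t) + (- \<mu>\<^sup>2) * integral {0..x} (\<lambda>t. 1 * Y \<mu> t)))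
        = z0 + integral {0..x} (\<lambda>t. V \<mu> t * Y \<mu> t)"
      by (simp only:)
  qed
  ultimately show ?case by (simp add: Y_def[abs_def] Z_def[abs_def])
qed

text \<open>
  In the norm weighted by \<open>exp (2 \<kappa>)\<close>, where \<open>\<kappa>\<close> is the
  integral of a kernel that dominates the potential for all spectral parameters in a disc, the
  Picard operator halves distances.
\<close>
lemma picard_contraction:
  assumes co: "pencil_coeffs b p q"
  defines "V \<equiv> \<lambda>\<mu> x. q x + 2 * \<mu> * p x - \<mu>\<^sup>2"
  shows "\<exists>C. \<forall>n \<mu> x. norm \<mu> \<le> R \<longrightarrow> x \<in> {0..b} \<longrightarrow>
     norm (fst (picard V y0 z0 (Suc n) \<mu>) x - fst (picard V y0 z0 n \<mu>) x)
   + norm (snd (picard V y0 z0 (Suc n) \<mu>) x - snd (picard V y0 z0 n \<mu>) x) \<le> C / 2 ^ n"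
proof -
  \<comment> \<open>The summand \<open>1\<close> dominates the coefficient of \<open>z\<close> in \<open>y' = z\<close>.\<close>
  define k where "k x = 1 + norm (q x) + 2 * \<bar>R\<bar> * norm (p x) + R\<^sup>2" for x
  define \<kappa> where "\<kappa> x = integral {0..x} k" for x
  note D = pencil_coeffs_D[OF co]
  have k: "k absolutely_integrable_on {0..b}"
    unfolding k_def using D(2)
    by (intro set_integral_add(1) D(6) absolutely_integrable_continuous_real continuous_intros)
  have \<kappa>: "continuous_on {0..b} \<kappa>"
    unfolding \<kappa>_def by (intro indefinite_integral_continuous_1 absolutely_integrable_integrable k)
  have k1: "1 \<le> k x" for x unfolding k_def by simp
  have kx: "k integrable_on {0..x}" if "0 \<le> x" "x \<le> b" for x
    using that by (intro absolutely_integrable_integrable absolutely_integrable_on_subinterval[OF k]) auto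
  have \<kappa>0: "0 \<le> \<kappa> x" "\<kappa> x \<le> \<kappa> b" if "0 \<le> x" "x \<le> b" for x
    using that kx[OF that] kx[of b] k1 unfolding \<kappa>_def
    by (auto intro!: integral_nonneg integral_subset_le order_trans[OF zero_le_one k1])
  define M where "M = norm y0 + norm z0"
  have I: "integral {0..x} (\<lambda>t. k t * exp (2 * \<kappa> t)) = (exp (2 * \<kappa> x) - 1) / 2" if "0 \<le> x" "x \<le> b" for x
  proof -
    have "((\<lambda>t. k t * exp (2 * \<kappa> t) * 2) has_integral exp (2 * \<kappa> x) - 1) {0..x}"
      using integral_exp_indefinite_integral[OF k that, of 2] by (simp add: \<kappa>_def)
    from has_integral_mult_left[OF this, of "1/2"] show ?thesis by (intro integral_unique) simp
  qed
  have main: "norm (fst (picard V y0 z0 (Suc n) \<mu>) x - fst (picard V y0 z0 n \<mu>) x)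
     + norm (snd (picard V y0 z0 (Suc n) \<mu>) x - snd (picard V y0 z0 n \<mu>) x) \<le> M * exp (2 * \<kappa> x) / 2 ^ n"
    if \<mu>: "norm \<mu> \<le> R" and x: "0 \<le> x" "x \<le> b" for n \<mu> x
  proof -
    have V: "V \<mu> absolutely_integrable_on {0..b}"
      unfolding V_def by (rule potential_absolutely_integrable[OF co])
    have kV: "1 \<le> k t \<and> norm (V \<mu> t) \<le> k t" for t
    proof -
      have R: "\<bar>R\<bar> = R" using order_trans[OF norm_ge_zero \<mu>] by simp
      have "norm (V \<mu> t) \<le> norm (q t) + norm (2 * \<mu> * p t) + norm (\<mu>\<^sup>2)"
        unfolding V_def by (intro order_trans[OF norm_triangle_ineq4] add_mono norm_triangle_ineq order_refl)
      also have "\<dots> \<le> k t"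
        using \<mu> mult_right_mono[OF \<mu>, of "norm (p t)"] power_mono[OF \<mu>, of 2]
        unfolding k_def R by (simp add: norm_mult norm_power)
      finally show ?thesis using k1 by blast
    qed
    have cont: "continuous_on {0..b} (fst (picard V y0 z0 n \<mu>))" "continuous_on {0..b} (snd (picard V y0 z0 n \<mu>))" for n
      using picard_weakly_entire[OF co, of y0 z0 n] unfolding weakly_entire_def V_def by auto
    show ?thesis using x
    proof (induction n arbitrary: x)
      case 0
      have "norm (integral {0..x} (\<lambda>t. z0)) + norm (integral {0..x} (\<lambda>t. V \<mu> t * y0)) \<le> integral {0..x} (\<lambda>t. k t * M)"
        using 0 kV by (intro volterra_step_bound[OF _ _ V k, where y="\<lambda>_. y0" and z="\<lambda>_. z0"]) (auto simp: M_def)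
      also have "\<dots> = M * \<kappa> x" by (simp add: \<kappa>_def)
      also have "\<dots> \<le> M * exp (2 * \<kappa> x)"
      proof (rule mult_left_mono)
        have "\<kappa> x \<le> 1 + 2 * \<kappa> x" using \<kappa>0[OF 0] by simp
        also have "\<dots> \<le> exp (2 * \<kappa> x)" by (rule exp_ge_add_one_self)
        finally show "\<kappa> x \<le> exp (2 * \<kappa> x)" .
      qed (simp add: M_def)
      finally show ?case by simp
    next
      case (Suc n)
      define dY where "dY t = fst (picard V y0 z0 (Suc n) \<mu>) t - fst (picard V y0 z0 n \<mu>) t" for t
      define dZ where "dZ t = snd (picard V y0 z0 (Suc n) \<mu>) t - snd (picard V y0 z0 n \<mu>) t" for t
      have dc: "continuous_on {0..b} dY" "continuous_on {0..b} dZ"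
        unfolding dY_def dZ_def by (intro continuous_intros cont)+
      have xb: "x \<in> {0..b}" "{0..x} \<subseteq> {0..b}" using Suc.prems by auto
      have zi: "snd (picard V y0 z0 m \<mu>) integrable_on {0..x}" for m
        using continuous_on_subset[OF cont(2) xb(2)] by (rule integrable_continuous_real)
      have yi: "(\<lambda>t. V \<mu> t * fst (picard V y0 z0 m \<mu>) t) integrable_on {0..x}" for m
        using absolutely_integrable_on_subinterval[OF absolutely_integrable_continuous_mult[OF cont(1) V] xb(2)]
        by (simp add: mult.commute absolutely_integrable_integrable)
      have 1: "fst (picard V y0 z0 (Suc (Suc n)) \<mu>) x - fst (picard V y0 z0 (Suc n) \<mu>) x = integral {0..x} dZ"
        using Henstock_Kurzweil_Integration.integral_diff[OF zi[of "Suc n"] zi[of n]]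
        unfolding dZ_def picard.simps(2)[of V y0 z0 "Suc n"] picard.simps(2)[of V y0 z0 "n"] by simp
      have 2: "snd (picard V y0 z0 (Suc (Suc n)) \<mu>) x - snd (picard V y0 z0 (Suc n) \<mu>) x = integral {0..x} (\<lambda>t. V \<mu> t * dY t)"
        using Henstock_Kurzweil_Integration.integral_diff[OF yi[of "Suc n"] yi[of n]]
        unfolding dY_def picard.simps(2)[of V y0 z0 "Suc n"] picard.simps(2)[of V y0 z0 "n"] by (simp add: algebra_simps)
      have "norm (integral {0..x} dZ) + norm (integral {0..x} (\<lambda>t. V \<mu> t * dY t))
          \<le> integral {0..x} (\<lambda>t. k t * (M * exp (2 * \<kappa> t) / 2 ^ n))"
      proof (rule volterra_step_bound[OF dc V k kV _ _ Suc.prems])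
        show "continuous_on {0..b} (\<lambda>t. M * exp (2 * \<kappa> t) / 2 ^ n)" by (intro continuous_intros \<kappa>) auto
        show "norm (dY t) + norm (dZ t) \<le> M * exp (2 * \<kappa> t) / 2 ^ n" if "t \<in> {0..b}" for t
          using Suc.IH[of t] that unfolding dY_def dZ_def by auto
      qed
      also have "\<dots> = integral {0..x} (\<lambda>t. (M / 2 ^ n) * (k t * exp (2 * \<kappa> t)))"
        by (simp add: mult_ac)
      also have "\<dots> = (M / 2 ^ n) * ((exp (2 * \<kappa> x) - 1) / 2)"
        unfolding I[OF Suc.prems, symmetric] by (rule integral_mult_right)
      also have "\<dots> \<le> M * exp (2 * \<kappa> x) / 2 ^ Suc n"
        by (simp add: M_def field_simps)
      finally show ?case unfolding 1 2 .
    qed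
  qed
  have "M * exp (2 * \<kappa> x) / 2 ^ n \<le> M * exp (2 * \<kappa> b) / 2 ^ n" if "x \<in> {0..b}" for x n
    using \<kappa>0(2)[of x] that by (intro divide_right_mono mult_left_mono) (auto simp: M_def)
  with main show ?thesis by (intro exI[of _ "M * exp (2 * \<kappa> b)"]) (meson atLeastAtMost_iff order_trans)
qed

text \<open>
  The Picard iterates are weakly entire and converge geometrically, uniformly for spectral
  parameters in a disc. Evaluating an integral is a bounded functional, so the integral equations
  pass to the limit.
\<close>
lemma pencil_pair_exists:
  assumes co: "pencil_coeffs b p q"
  shows "\<exists>y z. (\<forall>\<mu>. pencil_pair b p q \<mu> (y \<mu>) (z \<mu>) \<and> y \<mu> 0 = y0 \<and> z \<mu> 0 = z0)
     \<and> weakly_entire b y \<and> weakly_entire b z"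
proof -
  define V where "V = (\<lambda>\<mu> x. q x + 2 * \<mu> * p x - \<mu>\<^sup>2)"
  define Y where "Y n \<mu> = fst (picard V y0 z0 n \<mu>)" for n \<mu>
  define Z where "Z n \<mu> = snd (picard V y0 z0 n \<mu>)" for n \<mu>
  have WE: "weakly_entire b (Y n)" "weakly_entire b (Z n)" for n
    using picard_weakly_entire[OF co, of y0 z0 n] by (simp_all add: Y_def[abs_def] Z_def[abs_def] V_def)
  have step: "\<exists>C. \<forall>n \<mu> x. norm \<mu> \<le> R \<longrightarrow> x \<in> {0..b} \<longrightarrow>
     norm (Y (Suc n) \<mu> x - Y n \<mu> x) + norm (Z (Suc n) \<mu> x - Z n \<mu> x) \<le> C / 2 ^ n" for R
    using picard_contraction[OF co, of R y0 z0] unfolding Y_def Z_def V_def .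
  define y where "y \<mu> x = lim (\<lambda>n. Y n \<mu> x)" for \<mu> x
  define z where "z \<mu> x = lim (\<lambda>n. Z n \<mu> x)" for \<mu> x
  have close: "\<exists>C. \<forall>n \<mu> x. norm \<mu> \<le> R \<longrightarrow> x \<in> {0..b} \<longrightarrow>
     norm (Y n \<mu> x - y \<mu> x) \<le> 2 * C / 2 ^ n \<and> norm (Z n \<mu> x - z \<mu> x) \<le> 2 * C / 2 ^ n" for R
  proof -
    obtain C where C: "\<forall>n \<mu> x. norm \<mu> \<le> R \<longrightarrow> x \<in> {0..b} \<longrightarrow>
       norm (Y (Suc n) \<mu> x - Y n \<mu> x) + norm (Z (Suc n) \<mu> x - Z n \<mu> x) \<le> C / 2 ^ n"
      using step[of R] by blast
    have "norm (Y n \<mu> x - y \<mu> x) \<le> 2 * C / 2 ^ n" "norm (Z n \<mu> x - z \<mu> x) \<le> 2 * C / 2 ^ n"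
      if "norm \<mu> \<le> R" "x \<in> {0..b}" for n \<mu> x
    proof -
      have "norm (Y (Suc n) \<mu> x - Y n \<mu> x) \<le> C / 2 ^ n" "norm (Z (Suc n) \<mu> x - Z n \<mu> x) \<le> C / 2 ^ n" for n
        using C[rule_format, OF that, of n] norm_ge_zero[of "Y (Suc n) \<mu> x - Y n \<mu> x"]
          norm_ge_zero[of "Z (Suc n) \<mu> x - Z n \<mu> x"] by linarith+
      then show "norm (Y n \<mu> x - y \<mu> x) \<le> 2 * C / 2 ^ n" "norm (Z n \<mu> x - z \<mu> x) \<le> 2 * C / 2 ^ n"
        unfolding y_def z_def by (intro geometric_steps_limit(1); simp)+
    qed
    then show ?thesis by blast
  qed
  have r0: "(\<lambda>n. C / 2 ^ n) \<longlonglongrightarrow> 0" for C :: real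
  proof -
    have "(\<lambda>n. C * (1 / 2) ^ n) \<longlonglongrightarrow> C * 0" by (intro tendsto_intros LIMSEQ_power_zero) auto
    then show ?thesis by (simp add: power_one_over)
  qed
  have "\<exists>C r. r \<longlonglongrightarrow> (0::real) \<and> (\<forall>n \<mu> x. norm \<mu> \<le> R \<longrightarrow> x \<in> {0..b} \<longrightarrow> norm (Y n \<mu> x - y \<mu> x) \<le> C * r n)" for R
  proof -
    obtain C where "\<forall>n \<mu> x. norm \<mu> \<le> R \<longrightarrow> x \<in> {0..b} \<longrightarrow> norm (Y n \<mu> x - y \<mu> x) \<le> 2 * C / 2 ^ n"
      using close[of R] by blast
    then show ?thesis using r0[of "2 * C"] by (intro exI[of _ 1] exI[of _ "\<lambda>n. 2 * C / 2 ^ n"]) auto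
  qed
  then have Wy: "weakly_entire b y" by (intro weakly_entire_uniform_limit[OF WE(1)])
  have "\<exists>C r. r \<longlonglongrightarrow> (0::real) \<and> (\<forall>n \<mu> x. norm \<mu> \<le> R \<longrightarrow> x \<in> {0..b} \<longrightarrow> norm (Z n \<mu> x - z \<mu> x) \<le> C * r n)" for R
  proof -
    obtain C where "\<forall>n \<mu> x. norm \<mu> \<le> R \<longrightarrow> x \<in> {0..b} \<longrightarrow> norm (Z n \<mu> x - z \<mu> x) \<le> 2 * C / 2 ^ n"
      using close[of R] by blast
    then show ?thesis using r0[of "2 * C"] by (intro exI[of _ 1] exI[of _ "\<lambda>n. 2 * C / 2 ^ n"]) auto
  qed
  then have Wz: "weakly_entire b z" by (intro weakly_entire_uniform_limit[OF WE(2)])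
  have "pencil_pair b p q \<mu> (y \<mu>) (z \<mu>) \<and> y \<mu> 0 = y0 \<and> z \<mu> 0 = z0" for \<mu>
  proof -
    have cont: "continuous_on {0..b} (Y n \<mu>)" "continuous_on {0..b} (Z n \<mu>)" "continuous_on {0..b} (y \<mu>)" "continuous_on {0..b} (z \<mu>)" for n
      using WE Wy Wz by (auto simp: weakly_entire_def)
    have V: "V \<mu> absolutely_integrable_on {0..b}"
      unfolding V_def by (rule potential_absolutely_integrable[OF co])
    have one: "(\<lambda>x. 1::complex) absolutely_integrable_on {0..b}"
      by (intro absolutely_integrable_continuous_real continuous_intros)
    obtain C where C: "\<forall>n x. x \<in> {0..b} \<longrightarrow>
       norm (Y n \<mu> x - y \<mu> x) \<le> 2 * C / 2 ^ n \<and> norm (Z n \<mu> x - z \<mu> x) \<le> 2 * C / 2 ^ n"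
      using close[of "norm \<mu>"] by auto
    have LY: "(\<lambda>n. L (Y n \<mu>)) \<longlonglongrightarrow> L (y \<mu>)" and LZ: "(\<lambda>n. L (Z n \<mu>)) \<longlonglongrightarrow> L (z \<mu>)" if L: "bounded_functional b L" for L
      using C cont by (auto intro!: bounded_functional_limit[OF L _ _ r0[of "2 * C"]])
    have yx: "y \<mu> x = y0 + integral {0..x} (z \<mu>)" and zx: "z \<mu> x = z0 + integral {0..x} (\<lambda>t. V \<mu> t * y \<mu> t)" if x: "x \<in> {0..b}" for x
    proof -
      have 1: "(\<lambda>n. y0 + integral {0..x} (\<lambda>t. 1 * Z n \<mu> t)) \<longlonglongrightarrow> y0 + integral {0..x} (\<lambda>t. 1 * z \<mu> t)"
        using LZ[OF bounded_functional_indefinite_integral[OF bounded_functional_eval[OF x] one]] by (intro tendsto_intros)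
      have 2: "(\<lambda>n. Y (Suc n) \<mu> x) \<longlonglongrightarrow> y \<mu> x"
        using LY[OF bounded_functional_eval[OF x]] by (rule LIMSEQ_Suc)
      show "y \<mu> x = y0 + integral {0..x} (z \<mu>)"
        using LIMSEQ_unique[OF 2] 1 by (simp add: Y_def Z_def)
      have 3: "(\<lambda>n. z0 + integral {0..x} (\<lambda>t. V \<mu> t * Y n \<mu> t)) \<longlonglongrightarrow> z0 + integral {0..x} (\<lambda>t. V \<mu> t * y \<mu> t)"
        using LY[OF bounded_functional_indefinite_integral[OF bounded_functional_eval[OF x] V]] by (intro tendsto_intros)
      have 4: "(\<lambda>n. Z (Suc n) \<mu> x) \<longlonglongrightarrow> z \<mu> x"
        using LZ[OF bounded_functional_eval[OF x]] by (rule LIMSEQ_Suc)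
      show "z \<mu> x = z0 + integral {0..x} (\<lambda>t. V \<mu> t * y \<mu> t)"
        using LIMSEQ_unique[OF 4] 3 by (simp add: Y_def Z_def)
    qed
    have "0 \<in> {0..b}" using pencil_coeffs_D(1)[OF co] by simp
    then have 0: "y \<mu> 0 = y0" "z \<mu> 0 = z0" using yx[of 0] zx[of 0] by simp_all
    have "has_ac_density b (y \<mu>) (z \<mu>)"
      unfolding has_ac_density_def using yx 0 cont by (auto intro: absolutely_integrable_continuous_real)
    moreover have "has_ac_density b (z \<mu>) (\<lambda>x. V \<mu> x * y \<mu> x)"
      unfolding has_ac_density_def using zx 0 absolutely_integrable_continuous_mult[OF cont(3) V]
      by (auto simp: mult.commute)
    ultimately show ?thesis using 0 unfolding pencil_pair_def V_def by simp
  qed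
  with Wy Wz show ?thesis by blast
qed

text \<open>
  By uniqueness every family with fixed initial data consists of the limits of the Picard iterates.
\<close>
lemma pencil_pair_family_weakly_entire:
  assumes co: "pencil_coeffs b p q"
    and yz: "\<And>\<mu>. pencil_pair b p q \<mu> (y \<mu>) (z \<mu>)" "\<And>\<mu>. y \<mu> 0 = y0" "\<And>\<mu>. z \<mu> 0 = z0"
  shows "weakly_entire b y" "weakly_entire b z"
proof -
  obtain y' z' where *: "\<forall>\<mu>. pencil_pair b p q \<mu> (y' \<mu>) (z' \<mu>) \<and> y' \<mu> 0 = y0 \<and> z' \<mu> 0 = z0"
     "weakly_entire b y'" "weakly_entire b z'"
    using pencil_pair_exists[OF co, of y0 z0] by blast
  have "y' \<mu> x = y \<mu> x" "z' \<mu> x = z \<mu> x" if x: "x \<in> {0..b}" for \<mu> x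
  proof -
    have "pencil_pair b p q \<mu> (y' \<mu>) (z' \<mu>)" "y' \<mu> 0 = y \<mu> 0" "z' \<mu> 0 = z \<mu> 0" using *(1) yz(2,3) by auto
    from pencil_pair_unique[OF co this(1) yz(1) this(2,3) x]
    show "y' \<mu> x = y \<mu> x" "z' \<mu> x = z \<mu> x" .
  qed
  then show "weakly_entire b y" "weakly_entire b z"
    by - (rule weakly_entire_cong[OF *(2)], assumption, rule weakly_entire_cong[OF *(3)], assumption)
qed

section \<open>Growth and asymptotics of solutions\<close>

lemma ac_density_integrating_factor:
  assumes A: "has_ac_density b A a" and u: "has_ac_density b u (\<lambda>s. a s * u s + f s)"
  shows "has_ac_density b (\<lambda>s. exp (- A s) * u s) (\<lambda>s. exp (- A s) * f s)"
proof -
  have "has_ac_density b (\<lambda>s. exp (- A s)) (\<lambda>s. exp (- A s) * (- a s))"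
    using ac_density_exp[OF ac_density_cmult[OF A, of "-1"]] by simp
  from ac_density_mult[OF this u]
  have "has_ac_density b (\<lambda>s. exp (- A s) * u s) (\<lambda>s. exp (- A s) * (a s * u s + f s) + u s * (exp (- A s) * - a s))" .
  moreover have "(\<lambda>s. exp (- A s) * (a s * u s + f s) + u s * (exp (- A s) * - a s)) = (\<lambda>s. exp (- A s) * f s)"
    by (simp add: algebra_simps)
  ultimately show ?thesis by simp
qed

lemma ac_density_linear: "has_ac_density b (\<lambda>s. c * of_real s) (\<lambda>s. c)"
proof (rule ac_density_C1)
  fix x show "((\<lambda>s. c * of_real s) has_vector_derivative c) (at x within {0..b})"
    by (rule has_vector_derivative_real_field) (auto intro!: derivative_eq_intros)
qed auto

text \<open>
  Variation of constants. The majorant \<open>g\<close> may depend on the end point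
  \<open>x\<close>, so that the exponential damping can be exploited under the integral.
\<close>
lemma duhamel_bound:
  assumes u: "has_ac_density b u (\<lambda>s. a * u s + F s)" and x: "0 \<le> x" "x \<le> b"
    and g: "g integrable_on {0..x}" "\<And>r. r \<in> {0..x} \<Longrightarrow> exp (Re a * (x - r)) * norm (F r) \<le> g r"
  shows "norm (u x) \<le> exp (Re a * x) * norm (u 0) + integral {0..x} g"
proof -
  have H: "has_ac_density b (\<lambda>s. exp (a * x) * (exp (- (a * s)) * u s)) (\<lambda>s. exp (a * x) * (exp (- (a * s)) * F s))"
    by (intro ac_density_cmult ac_density_integrating_factor[OF ac_density_linear u])
  have "norm (exp (a * x) * (exp (- (a * x)) * u x) - exp (a * x) * (exp (- (a * of_real 0)) * u 0)) \<le> integral {0..x} g"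
  proof (rule ac_density_increment_bound[OF H _ _ x(2) g(1)])
    fix r assume r: "r \<in> {0..x}"
    have "norm (exp (a * x) * (exp (- (a * r)) * F r)) = exp (Re a * (x - r)) * norm (F r)"
      by (simp add: norm_mult algebra_simps flip: exp_add)
    then show "norm (exp (a * x) * (exp (- (a * r)) * F r)) \<le> g r" using g(2)[OF r] by simp
  qed (use x in auto)
  moreover have "exp (a * x) * (exp (- (a * x)) * u x) = u x" by (simp add: exp_minus)
  ultimately have "norm (u x - exp (a * x) * u 0) \<le> integral {0..x} g" by simp
  moreover have "norm (exp (a * x) * u 0) = exp (Re a * x) * norm (u 0)" by (simp add: norm_mult)
  ultimately show ?thesis using norm_triangle_ineq2[of "u x" "exp (a * x) * u 0"] by simp
qed

text \<open>
  The combinations \<open>z + \<i> \<mu> y\<close> and \<open>z - \<i> \<mu> y\<close> diagonalize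
  the principal part of the pencil.
\<close>
lemma pencil_pair_diagonalize:
  assumes "pencil_pair b p q \<mu> y z"
  shows "has_ac_density b (\<lambda>s. z s + \<i> * \<mu> * y s) (\<lambda>s. \<i> * \<mu> * (z s + \<i> * \<mu> * y s) + (q s + 2 * \<mu> * p s) * y s)"
    "has_ac_density b (\<lambda>s. z s - \<i> * \<mu> * y s) (\<lambda>s. - \<i> * \<mu> * (z s - \<i> * \<mu> * y s) + (q s + 2 * \<mu> * p s) * y s)"
proof -
  have yz: "has_ac_density b y z" "has_ac_density b z (\<lambda>x. (q x + 2 * \<mu> * p x - \<mu>\<^sup>2) * y x)"
    using assms unfolding pencil_pair_def by auto
  have "has_ac_density b (\<lambda>s. z s + \<i> * \<mu> * y s) (\<lambda>s. (q s + 2 * \<mu> * p s - \<mu>\<^sup>2) * y s + \<i> * \<mu> * z s)"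
    by (intro ac_density_add ac_density_cmult yz)
  moreover have "(\<lambda>s. (q s + 2 * \<mu> * p s - \<mu>\<^sup>2) * y s + \<i> * \<mu> * z s) =
     (\<lambda>s. \<i> * \<mu> * (z s + \<i> * \<mu> * y s) + (q s + 2 * \<mu> * p s) * y s)"
    by (simp add: fun_eq_iff algebra_simps power2_eq_square)
  ultimately show "has_ac_density b (\<lambda>s. z s + \<i> * \<mu> * y s) (\<lambda>s. \<i> * \<mu> * (z s + \<i> * \<mu> * y s) + (q s + 2 * \<mu> * p s) * y s)"
    by simp
  have "has_ac_density b (\<lambda>s. z s - \<i> * \<mu> * y s) (\<lambda>s. (q s + 2 * \<mu> * p s - \<mu>\<^sup>2) * y s - \<i> * \<mu> * z s)"
    by (intro ac_density_diff ac_density_cmult yz)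
  moreover have "(\<lambda>s. (q s + 2 * \<mu> * p s - \<mu>\<^sup>2) * y s - \<i> * \<mu> * z s) =
     (\<lambda>s. - \<i> * \<mu> * (z s - \<i> * \<mu> * y s) + (q s + 2 * \<mu> * p s) * y s)"
    by (simp add: fun_eq_iff algebra_simps power2_eq_square)
  ultimately show "has_ac_density b (\<lambda>s. z s - \<i> * \<mu> * y s) (\<lambda>s. - \<i> * \<mu> * (z s - \<i> * \<mu> * y s) + (q s + 2 * \<mu> * p s) * y s)"
    by simp
qed

lemma norm_solution_le_diagonal:
  fixes \<mu> y z :: complex
  assumes "\<mu> \<noteq> 0"
  shows "2 * norm \<mu> * norm y \<le> norm (z + \<i> * \<mu> * y) + norm (z - \<i> * \<mu> * y)"
    "norm y \<le> (norm (z + \<i> * \<mu> * y) + norm (z - \<i> * \<mu> * y)) / (2 * norm \<mu>)"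
proof -
  have "2 * \<i> * \<mu> * y = (z + \<i> * \<mu> * y) - (z - \<i> * \<mu> * y)" by simp
  then have "norm (2 * \<i> * \<mu> * y) \<le> norm (z + \<i> * \<mu> * y) + norm (z - \<i> * \<mu> * y)"
    by (metis norm_triangle_ineq4)
  then show *: "2 * norm \<mu> * norm y \<le> norm (z + \<i> * \<mu> * y) + norm (z - \<i> * \<mu> * y)"
    by (simp add: norm_mult)
  then show "norm y \<le> (norm (z + \<i> * \<mu> * y) + norm (z - \<i> * \<mu> * y)) / (2 * norm \<mu>)"
    using assms by (simp add: pos_le_divide_eq mult.commute)
qed

text \<open>The factor that Gronwall's inequality yields, uniformly in the spectral parameter.\<close>
definition growth_const :: "real \<Rightarrow> (real \<Rightarrow> complex) \<Rightarrow> (real \<Rightarrow> complex) \<Rightarrow> real" where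
  "growth_const b p q = exp (integral {0..b} (\<lambda>r. 2 * (norm (p r) + norm (q r))))"

lemma growth_kernel_integrable:
  assumes co: "pencil_coeffs b p q"
  shows "(\<lambda>r. 2 * (norm (p r) + norm (q r))) absolutely_integrable_on {0..b}"
  by (intro set_integrable_mult_right set_integral_add(1) pencil_coeffs_D(5,6)[OF co])

lemma growth_const_ge_1:
  "pencil_coeffs b p q \<Longrightarrow> 1 \<le> growth_const b p q"
  unfolding growth_const_def one_le_exp_iff
  by (rule integral_nonneg[OF absolutely_integrable_integrable[OF growth_kernel_integrable]]) auto

text \<open>
  Divided by \<open>exp (\<bar>Im \<mu>\<bar> x)\<close>, the diagonal components obey an integral
  inequality whose kernel is independent of \<open>\<mu>\<close>: the factor \<open>\<mu>\<close> at
  \<open>p\<close> is compensated by the factor \<open>1 / \<mu>\<close> that appears when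
  \<open>y\<close> is expressed by these components.
\<close>
lemma pencil_growth_diagonal:
  assumes co: "pencil_coeffs b p q" and yz: "pencil_pair b p q \<mu> y z" and \<mu>: "1 \<le> norm \<mu>"
    and x: "0 \<le> x" "x \<le> b"
  defines "N \<equiv> \<lambda>s. norm (z s + \<i> * \<mu> * y s) + norm (z s - \<i> * \<mu> * y s)"
  shows "N x \<le> growth_const b p q * exp (\<bar>Im \<mu>\<bar> * x) * N 0"
proof -
  define k where "k r = norm (p r) + norm (q r)" for r
  define n where "n r = exp (- \<bar>Im \<mu>\<bar> * r) * N r" for r
  note D = pencil_coeffs_D[OF co] and c = pencil_pair_continuous[OF yz]
  have k: "k absolutely_integrable_on {0..b}" "(\<lambda>r. 2 * k r) absolutely_integrable_on {0..b}"
    unfolding k_def using D(5,6) growth_kernel_integrable[OF co] by (auto intro: set_integral_add(1))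
  have cn: "continuous_on {0..b} n" unfolding n_def N_def by (intro continuous_intros c)
  have F: "norm ((q r + 2 * \<mu> * p r) * y r) \<le> k r * N r" for r
  proof -
    have "norm ((q r + 2 * \<mu> * p r) * y r) \<le> (norm (q r) + 2 * norm \<mu> * norm (p r)) * (N r / (2 * norm \<mu>))"
      unfolding norm_mult N_def using \<mu>
      by (intro mult_mono norm_solution_le_diagonal(2) order_trans[OF norm_triangle_ineq]) (auto simp: norm_mult)
    also have "\<dots> = (norm (q r) / (2 * norm \<mu>) + norm (p r)) * N r"
    proof -
      have "norm \<mu> \<noteq> 0" using \<mu> by linarith
      then show ?thesis by (simp add: field_simps)
    qed
    also have "\<dots> \<le> k r * N r"
    proof (rule mult_right_mono)
      have "norm (q r) / (2 * norm \<mu>) \<le> norm (q r) / 1" using \<mu> by (intro divide_left_mono) auto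
      then show "norm (q r) / (2 * norm \<mu>) + norm (p r) \<le> k r" by (simp add: k_def)
    qed (simp add: N_def)
    finally show ?thesis .
  qed
  have nx: "n x \<le> N 0 + integral {0..x} (\<lambda>t. 2 * k t * n t)" if x: "0 \<le> x" "x \<le> b" for x
  proof -
    define g where "g r = exp (\<bar>Im \<mu>\<bar> * x) * (k r * n r)" for r
    have kn: "(\<lambda>r. k r * n r) integrable_on {0..x}"
      using x absolutely_integrable_on_subinterval[OF absolutely_integrable_mult_continuous_real[OF cn k(1)], of 0 x]
      by (auto intro: absolutely_integrable_integrable)
    then have gi: "g integrable_on {0..x}" unfolding g_def by (rule integrable_on_mult_right)
    have gr: "exp (a * (x - r)) * norm ((q r + 2 * \<mu> * p r) * y r) \<le> g r"
      if "\<bar>a\<bar> \<le> \<bar>Im \<mu>\<bar>" "r \<in> {0..x}" for a r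
    proof -
      have "a * (x - r) \<le> \<bar>Im \<mu>\<bar> * (x - r)" using that by (intro mult_right_mono) auto
      then have "exp (a * (x - r)) * norm ((q r + 2 * \<mu> * p r) * y r) \<le> exp (\<bar>Im \<mu>\<bar> * (x - r)) * (k r * N r)"
        by (intro mult_mono F) auto
      also have "\<dots> = g r" by (simp add: g_def n_def algebra_simps flip: exp_add)
      finally show ?thesis .
    qed
    have a1: "norm (z x + \<i> * \<mu> * y x) \<le> exp (Re (\<i> * \<mu>) * x) * norm (z 0 + \<i> * \<mu> * y 0) + integral {0..x} g"
      by (rule duhamel_bound[OF pencil_pair_diagonalize(1)[OF yz] x gi gr]) auto
    have a2: "norm (z x - \<i> * \<mu> * y x) \<le> exp (Re (- \<i> * \<mu>) * x) * norm (z 0 - \<i> * \<mu> * y 0) + integral {0..x} g"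
      by (rule duhamel_bound[OF pencil_pair_diagonalize(2)[OF yz] x gi gr]) auto
    have e: "exp (Re (\<i> * \<mu>) * x) \<le> exp (\<bar>Im \<mu>\<bar> * x)" "exp (Re (- \<i> * \<mu>) * x) \<le> exp (\<bar>Im \<mu>\<bar> * x)"
      unfolding exp_le_cancel_iff using x by (intro mult_right_mono; simp)+
    have "N x \<le> exp (\<bar>Im \<mu>\<bar> * x) * norm (z 0 + \<i> * \<mu> * y 0) + exp (\<bar>Im \<mu>\<bar> * x) * norm (z 0 - \<i> * \<mu> * y 0) + 2 * integral {0..x} g"
      unfolding N_def using a1 a2 mult_right_mono[OF e(1), of "norm (z 0 + \<i> * \<mu> * y 0)"]
        mult_right_mono[OF e(2), of "norm (z 0 - \<i> * \<mu> * y 0)"] by simp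
    also have "integral {0..x} g = exp (\<bar>Im \<mu>\<bar> * x) * integral {0..x} (\<lambda>r. k r * n r)" unfolding g_def by simp
    finally have "N x \<le> exp (\<bar>Im \<mu>\<bar> * x) * (N 0 + 2 * integral {0..x} (\<lambda>r. k r * n r))"
      by (simp add: N_def algebra_simps)
    then have "exp (- \<bar>Im \<mu>\<bar> * x) * N x \<le> exp (- \<bar>Im \<mu>\<bar> * x) * (exp (\<bar>Im \<mu>\<bar> * x) * (N 0 + 2 * integral {0..x} (\<lambda>r. k r * n r)))"
      by (rule mult_left_mono) simp
    also have "\<dots> = N 0 + 2 * integral {0..x} (\<lambda>r. k r * n r)" by (simp add: exp_minus)
    finally show ?thesis unfolding n_def[of x] by (simp add: mult.assoc)
  qed
  have "n x \<le> N 0 * exp (integral {0..x} (\<lambda>r. 2 * k r))"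
    by (rule gronwall_integrable_kernel[OF cn k(2) _ nx x]) (simp add: k_def)
  also have "\<dots> \<le> N 0 * growth_const b p q"
  proof (rule mult_left_mono)
    show "exp (integral {0..x} (\<lambda>r. 2 * k r)) \<le> growth_const b p q"
      unfolding growth_const_def k_def exp_le_cancel_iff
      using x growth_kernel_integrable[OF co]
      by (intro integral_subset_le absolutely_integrable_integrable) (auto intro: absolutely_integrable_on_subinterval)
  qed (simp add: N_def)
  finally have "exp (\<bar>Im \<mu>\<bar> * x) * n x \<le> exp (\<bar>Im \<mu>\<bar> * x) * (N 0 * growth_const b p q)" by (rule mult_left_mono) simp
  moreover have "exp (\<bar>Im \<mu>\<bar> * x) * n x = N x" by (simp add: n_def exp_minus)
  ultimately show ?thesis by (simp only: mult_ac)
qed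

lemma pencil_growth_from_0:
  assumes co: "pencil_coeffs b p q" and yz: "pencil_pair b p q \<mu> y z" and \<mu>: "1 \<le> norm \<mu>"
    and x: "0 \<le> x" "x \<le> b"
  shows "norm \<mu> * norm (y x) + norm (z x) \<le> 2 * growth_const b p q * exp (\<bar>Im \<mu>\<bar> * x) * (norm \<mu> * norm (y 0) + norm (z 0))"
proof -
  define N where "N s = norm (z s + \<i> * \<mu> * y s) + norm (z s - \<i> * \<mu> * y s)" for s
  have \<mu>0: "norm \<mu> \<noteq> 0" "\<mu> \<noteq> 0" using \<mu> by auto
  have "norm \<mu> * norm (y x) \<le> N x / 2"
    using norm_solution_le_diagonal(1)[OF \<mu>0(2), of "y x" "z x"] by (simp add: N_def)
  moreover have "norm (z x) \<le> N x / 2"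
  proof -
    have "2 * z x = (z x + \<i> * \<mu> * y x) + (z x - \<i> * \<mu> * y x)" by simp
    then have "norm (2 * z x) \<le> N x" unfolding N_def by (metis norm_triangle_ineq)
    then show ?thesis by (simp add: norm_mult)
  qed
  ultimately have "norm \<mu> * norm (y x) + norm (z x) \<le> N x" by simp
  also have "N x \<le> growth_const b p q * exp (\<bar>Im \<mu>\<bar> * x) * N 0"
    using pencil_growth_diagonal[OF co yz \<mu> x] unfolding N_def .
  also have "N 0 \<le> 2 * (norm \<mu> * norm (y 0) + norm (z 0))"
    using norm_triangle_ineq[of "z 0" "\<i> * \<mu> * y 0"] norm_triangle_ineq4[of "z 0" "\<i> * \<mu> * y 0"]
    by (simp add: N_def norm_mult)
  then have "growth_const b p q * exp (\<bar>Im \<mu>\<bar> * x) * N 0 \<le>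
     growth_const b p q * exp (\<bar>Im \<mu>\<bar> * x) * (2 * (norm \<mu> * norm (y 0) + norm (z 0)))"
    by (rule mult_left_mono) (simp add: growth_const_def)
  finally show ?thesis by (simp only: mult_ac)
qed

lemma pencil_coeffs_shift:
  assumes "pencil_coeffs b p q" "0 \<le> c" "c < b"
  shows "pencil_coeffs (b - c) (\<lambda>s. p (c + s)) (\<lambda>s. q (c + s))"
  unfolding pencil_coeffs_def
proof (intro conjI)
  note D = pencil_coeffs_D[OF assms(1)]
  show "continuous_on {0..b - c} (\<lambda>s. p (c + s))"
    by (rule continuous_on_compose2[OF D(2)]) (use assms in \<open>auto intro!: continuous_intros\<close>)
  have "q absolutely_integrable_on {c..b}"
    using assms by (intro absolutely_integrable_on_subinterval[OF D(3)]) auto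
  from absolutely_integrable_shift_real[OF this, of c]
  show "(\<lambda>s. q (c + s)) absolutely_integrable_on {0..b - c}" by simp
qed (use assms in auto)

lemma pencil_coeffs_reflect:
  assumes "pencil_coeffs b p q"
  shows "pencil_coeffs b (\<lambda>s. p (b - s)) (\<lambda>s. q (b - s))"
  unfolding pencil_coeffs_def
proof (intro conjI)
  note D = pencil_coeffs_D[OF assms(1)]
  show "continuous_on {0..b} (\<lambda>s. p (b - s))"
    by (rule continuous_on_compose2[OF D(2)]) (auto intro!: continuous_intros)
  show "(\<lambda>s. q (b - s)) absolutely_integrable_on {0..b}"
    using absolutely_integrable_reflect_shift_real[OF D(3), of b] by simp
qed (use pencil_coeffs_D[OF assms(1)] in auto)

lemma pencil_coeffs_restrict:
  assumes "pencil_coeffs b p q" "0 < c" "c \<le> b"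
  shows "pencil_coeffs c p q"
  using pencil_coeffs_D(2,3)[OF assms(1)] assms(2,3) unfolding pencil_coeffs_def
  by (auto intro: continuous_on_subset absolutely_integrable_on_subinterval)

lemma growth_const_shift_le:
  assumes co: "pencil_coeffs b p q" and c: "0 \<le> c" "c < b"
  shows "growth_const (b - c) (\<lambda>s. p (c + s)) (\<lambda>s. q (c + s)) \<le> growth_const b p q"
proof -
  let ?k = "\<lambda>r. 2 * (norm (p r) + norm (q r))"
  have i: "?k integrable_on {0..b}" using growth_kernel_integrable[OF co] by (rule absolutely_integrable_integrable)
  then have i2: "?k integrable_on {c..b}" using c by (auto intro: integrable_on_subinterval)
  have "integral {0..b - c} (\<lambda>s. ?k (c + s)) = integral {c..b} ?k"
    using has_integral_shift_real[OF integrable_integral[OF i2], of c] by (simp add: integral_unique)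
  also have "\<dots> \<le> integral {0..b} ?k" using c i i2 by (intro integral_subset_le) auto
  finally show ?thesis unfolding growth_const_def by simp
qed

lemma growth_const_restrict_le:
  assumes co: "pencil_coeffs b p q" and c: "0 \<le> c" "c \<le> b"
  shows "growth_const c p q \<le> growth_const b p q"
proof -
  let ?k = "\<lambda>r. 2 * (norm (p r) + norm (q r))"
  have i: "?k integrable_on {0..b}" using growth_kernel_integrable[OF co] by (rule absolutely_integrable_integrable)
  then have i2: "?k integrable_on {0..c}" using c by (auto intro: integrable_on_subinterval)
  have "integral {0..c} ?k \<le> integral {0..b} ?k" using c i i2 by (intro integral_subset_le) auto
  then show ?thesis unfolding growth_const_def by simp
qed

lemma growth_const_reflect:
  assumes co: "pencil_coeffs b p q"
  shows "growth_const b (\<lambda>s. p (b - s)) (\<lambda>s. q (b - s)) = growth_const b p q"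
proof -
  let ?k = "\<lambda>r. 2 * (norm (p r) + norm (q r))"
  have i: "?k integrable_on {0..b}" using growth_kernel_integrable[OF co] by (rule absolutely_integrable_integrable)
  have "integral {0..b} (\<lambda>s. ?k (b - s)) = integral {0..b} ?k"
    using has_integral_reflect_shift_real[OF integrable_integral[OF i], of b] by (simp add: integral_unique)
  then show ?thesis unfolding growth_const_def by simp
qed

text \<open>
  For \<open>t < s\<close> the equation is translated, for \<open>s < t\<close> it is restricted to
  \<open>[0, t]\<close> and reflected; either way \<open>t\<close> becomes the initial point.
\<close>
lemma pencil_growth:
  assumes co: "pencil_coeffs b p q" and yz: "pencil_pair b p q \<mu> y z" and \<mu>: "1 \<le> norm \<mu>"
    and s: "s \<in> {0..b}" and t: "t \<in> {0..b}"
  shows "norm \<mu> * norm (y s) + norm (z s) \<le>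
     2 * growth_const b p q * exp (\<bar>Im \<mu>\<bar> * \<bar>s - t\<bar>) * (norm \<mu> * norm (y t) + norm (z t))"
proof -
  let ?E = "\<lambda>x. norm \<mu> * norm (y x) + norm (z x)"
  have E0: "0 \<le> exp (\<bar>Im \<mu>\<bar> * \<bar>s - t\<bar>) * ?E t" by simp
  have mono: "?E s \<le> 2 * growth_const b p q * exp (\<bar>Im \<mu>\<bar> * \<bar>s - t\<bar>) * ?E t"
    if "?E s \<le> 2 * G * exp (\<bar>Im \<mu>\<bar> * \<bar>s - t\<bar>) * ?E t" "G \<le> growth_const b p q" for G
  proof -
    have "2 * G * exp (\<bar>Im \<mu>\<bar> * \<bar>s - t\<bar>) * ?E t \<le> 2 * growth_const b p q * exp (\<bar>Im \<mu>\<bar> * \<bar>s - t\<bar>) * ?E t"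
      using that(2) by (intro mult_right_mono) auto
    then show ?thesis using that(1) by linarith
  qed
  consider "s = t" | "t < s" | "s < t" by linarith
  then show ?thesis
  proof cases
    case 1
    show ?thesis
      using 1 growth_const_ge_1[OF co] mult_right_mono[of 1 "2 * growth_const b p q" "?E t"] by simp
  next
    case 2
    then have tb: "0 \<le> t" "t < b" using s t by auto
    have "?E (t + (s - t)) \<le> 2 * growth_const (b - t) (\<lambda>s. p (t + s)) (\<lambda>s. q (t + s)) * exp (\<bar>Im \<mu>\<bar> * (s - t)) * ?E (t + 0)"
      using 2 s by (intro pencil_growth_from_0[OF pencil_coeffs_shift[OF co tb] pencil_pair_shift[OF yz tb(1)] \<mu>]) auto
    then show ?thesis using 2 by (intro mono[OF _ growth_const_shift_le[OF co tb]]) simp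
  next
    case 3
    then have tb: "0 < t" "t \<le> b" using s t by auto
    note co' = pencil_coeffs_restrict[OF co tb]
    have "?E (t - (t - s)) \<le> 2 * growth_const t (\<lambda>s. p (t - s)) (\<lambda>s. q (t - s)) * exp (\<bar>Im \<mu>\<bar> * (t - s)) * ?E (t - 0)"
      using pencil_growth_from_0[OF pencil_coeffs_reflect[OF co'] pencil_pair_reflect[OF pencil_pair_restrict[OF yz tb(2)]] \<mu>, of "t - s"] 3 s
      by simp
    then show ?thesis using 3 growth_const_restrict_le[OF co _ tb(2)] tb
      unfolding growth_const_reflect[OF co'] by (intro mono[of "growth_const t p q"]) auto
  qed
qed

lemma has_integral_exp_linear:
  assumes "c \<noteq> (0::real)" "0 \<le> x"
  shows "((\<lambda>r. exp (c * r)) has_integral (exp (c * x) - 1) / c) {0..x}"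
proof -
  have "((\<lambda>r. exp (c * r)) has_integral exp (c * x) / c - exp (c * 0) / c) {0..x}"
    using assms by (intro fundamental_theorem_of_calculus)
      (auto intro!: derivative_eq_intros simp: has_real_derivative_iff_has_vector_derivative[symmetric])
  then show ?thesis by (simp add: diff_divide_distrib)
qed

text \<open>
  For \<open>Im \<mu> > 0\<close> the component \<open>w = z - \<i> \<mu> y\<close> is dominant and
  the component \<open>u = z + \<i> \<mu> y\<close> is damped: besides its decaying initial value it
  has only a forcing term, which the damping reduces by a factor \<open>1 / Im \<mu>\<close>. The
  equation of \<open>w\<close> contains \<open>\<i> p w\<close>, which the integrating factor
  removes, and a multiple of \<open>u\<close>.
\<close>
lemma pencil_asymptotics_upper:
  assumes co: "pencil_coeffs b p q"
  shows "\<exists>K\<ge>0. \<forall>\<mu> y z x. 1 \<le> Im \<mu> \<longrightarrow> pencil_pair b p q \<mu> y z \<longrightarrow> y 0 = 0 \<longrightarrow> z 0 = 1 \<longrightarrow> x \<in> {0..b} \<longrightarrow>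
     norm (- 2 * \<i> * \<mu> * y x * exp (\<i> * \<mu> * x - \<i> * integral {0..x} p) - 1) \<le> K / Im \<mu> + K * exp (- 2 * Im \<mu> * x)"
proof -
  note D = pencil_coeffs_D[OF co]
  define Q where "Q x = integral {0..x} p" for x
  have Qd: "has_ac_density b Q p" unfolding has_ac_density_def Q_def using D(4) by auto
  obtain P where P: "0 < P" "\<forall>x\<in>{0..b}. norm (p x) \<le> P"
    using D(2) compact_continuous_image[OF D(2) compact_Icc] compact_imp_bounded bounded_pos[of "p ` {0..b}"] by auto
  obtain CQ where CQ: "0 < CQ" "\<forall>x\<in>{0..b}. norm (exp (- \<i> * Q x)) \<le> CQ"
  proof -
    have "continuous_on {0..b} (\<lambda>x. exp (- \<i> * Q x))"
      by (intro continuous_intros ac_density_continuous[OF Qd])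
    from compact_imp_bounded[OF compact_continuous_image[OF this compact_Icc]]
    obtain C where "0 < C" "\<forall>y\<in>(\<lambda>x. exp (- \<i> * Q x)) ` {0..b}. norm y \<le> C" unfolding bounded_pos by blast
    then show ?thesis by (intro that[of C]) auto
  qed
  define Kc where "Kc = growth_const b p q"
  have Kc: "1 \<le> Kc" unfolding Kc_def by (rule growth_const_ge_1[OF co])
  define B where "B = integral {0..b} (\<lambda>r. norm (q r))"
  have qi: "(\<lambda>r. norm (q r)) integrable_on {0..x}" if "0 \<le> x" "x \<le> b" for x
    using that by (intro absolutely_integrable_integrable absolutely_integrable_on_subinterval[OF D(6)]) auto
  have qB: "integral {0..x} (\<lambda>r. norm (q r)) \<le> B" if "0 \<le> x" "x \<le> b" for x
    unfolding B_def using that D(1) qi[of b] qi[OF that] by (intro integral_subset_le) auto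
  have B0: "0 \<le> B" unfolding B_def using qi[of b] D(1) by (intro integral_nonneg) auto
  define K2 where "K2 = Kc * (P + B)"
  have K2: "0 \<le> K2" using Kc P B0 by (simp add: K2_def)
  define K where "K = CQ * (P / 2 + P * K2 * b + B * Kc) + CQ * K2 + CQ"
  have K0: "0 \<le> K" unfolding K_def using CQ P K2 B0 Kc D(1) by (intro add_nonneg_nonneg mult_nonneg_nonneg) auto
  have "norm (- 2 * \<i> * \<mu> * y x * exp (\<i> * \<mu> * x - \<i> * Q x) - 1) \<le> K / Im \<mu> + K * exp (- 2 * Im \<mu> * x)"
    if \<mu>: "1 \<le> Im \<mu>" and yz: "pencil_pair b p q \<mu> y z" and 0: "y 0 = 0" "z 0 = 1" and x: "x \<in> {0..b}" for \<mu> y z x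
  proof -
    define \<tau> where "\<tau> = Im \<mu>"
    have \<tau>: "1 \<le> \<tau>" using \<mu> by (simp add: \<tau>_def)
    have \<mu>\<tau>: "\<tau> \<le> norm \<mu>" using abs_Im_le_cmod[of \<mu>] \<tau> by (simp add: \<tau>_def)
    then have \<mu>1: "1 \<le> norm \<mu>" using \<tau> by linarith
    then have \<mu>0: "norm \<mu> \<noteq> 0" "\<mu> \<noteq> 0" by auto
    define u where "u s = z s + \<i> * \<mu> * y s" for s
    define w where "w s = z s - \<i> * \<mu> * y s" for s
    have N: "norm (u r) + norm (w r) \<le> 2 * Kc * exp (\<tau> * r)" if "r \<in> {0..b}" for r
      using pencil_growth_diagonal[OF co yz \<mu>1, of r] that 0 \<tau> by (simp add: u_def w_def Kc_def \<tau>_def mult_ac)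
    have y: "norm (y r) \<le> Kc * exp (\<tau> * r) / \<tau>" if "r \<in> {0..b}" for r
    proof -
      have "norm (y r) \<le> (norm (u r) + norm (w r)) / (2 * norm \<mu>)"
        unfolding u_def w_def using \<mu>1 by (intro norm_solution_le_diagonal(2)) auto
      also have "\<dots> \<le> (2 * Kc * exp (\<tau> * r)) / (2 * \<tau>)"
        using N[OF that] \<mu>\<tau> \<tau> Kc by (intro frac_le) auto
      finally show ?thesis by simp
    qed
    have py: "norm (2 * \<mu> * p r * y r) \<le> 2 * Kc * P * exp (\<tau> * r)" if "r \<in> {0..b}" for r
    proof -
      have "norm (2 * \<mu> * y r) \<le> norm (u r) + norm (w r)"
        using norm_solution_le_diagonal(1)[OF \<mu>0(2), of "y r" "z r"] by (simp add: u_def w_def norm_mult)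
      then have "norm (p r) * norm (2 * \<mu> * y r) \<le> P * (2 * Kc * exp (\<tau> * r))"
        using P(2) that N[OF that] P(1) by (intro mult_mono) auto
      then show ?thesis by (simp add: norm_mult mult_ac)
    qed
    \<comment> \<open>The factor \<open>1 / \<tau>\<close> is the integral of \<open>exp (- \<tau> (x - r)) exp (\<tau> r)\<close> over \<open>[0, x]\<close>, relative to \<open>exp (\<tau> x)\<close>.\<close>
    have u: "norm (u x) \<le> exp (- \<tau> * x) + K2 / \<tau> * exp (\<tau> * x)" if x: "x \<in> {0..b}" for x
    proof -
      define g where "g r = 2 * Kc * P * exp (- \<tau> * x) * exp (2 * \<tau> * r) + Kc * exp (\<tau> * x) / \<tau> * norm (q r)" for r
      have x': "0 \<le> x" "x \<le> b" using x by auto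
      have gI: "(g has_integral 2 * Kc * P * exp (- \<tau> * x) * ((exp (2 * \<tau> * x) - 1) / (2 * \<tau>)) +
          Kc * exp (\<tau> * x) / \<tau> * integral {0..x} (\<lambda>r. norm (q r))) {0..x}"
        unfolding g_def using \<tau> x' by (intro has_integral_add has_integral_mult_right has_integral_exp_linear integrable_integral qi) auto
      have "norm (u x) \<le> exp (Re (\<i> * \<mu>) * x) * norm (u 0) + integral {0..x} g"
        unfolding u_def
      proof (rule duhamel_bound[OF pencil_pair_diagonalize(1)[OF yz] x'])
        show "g integrable_on {0..x}" using gI by blast
        fix r assume r: "r \<in> {0..x}"
        then have rb: "r \<in> {0..b}" using x by auto
        have "norm ((q r + 2 * \<mu> * p r) * y r) \<le> norm (q r) * norm (y r) + norm (2 * \<mu> * p r * y r)"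
          unfolding distrib_right by (rule order_trans[OF norm_triangle_ineq]) (simp add: norm_mult)
        also have "\<dots> \<le> norm (q r) * (Kc * exp (\<tau> * r) / \<tau>) + 2 * Kc * P * exp (\<tau> * r)"
          by (intro add_mono mult_left_mono y py rb) auto
        finally have F: "norm ((q r + 2 * \<mu> * p r) * y r) \<le> norm (q r) * (Kc * exp (\<tau> * r) / \<tau>) + 2 * Kc * P * exp (\<tau> * r)" .
        have "exp (Re (\<i> * \<mu>) * (x - r)) * norm ((q r + 2 * \<mu> * p r) * y r) \<le>
           exp (- \<tau> * (x - r)) * (norm (q r) * (Kc * exp (\<tau> * r) / \<tau>) + 2 * Kc * P * exp (\<tau> * r))"
          using F by (auto simp: \<tau>_def intro!: mult_left_mono)
        also have "\<dots> = norm (q r) * Kc / \<tau> * exp (- \<tau> * (x - r) + \<tau> * r) + 2 * Kc * P * exp (- \<tau> * (x - r) + \<tau> * r)"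
        proof -
          have "A * (norm (q r) * (Kc * B / \<tau>) + 2 * Kc * P * B) = norm (q r) * Kc / \<tau> * (A * B) + 2 * Kc * P * (A * B)" for A B
            by (simp add: algebra_simps)
          then show ?thesis unfolding exp_add .
        qed
        also have "\<dots> \<le> norm (q r) * Kc / \<tau> * exp (\<tau> * x) + 2 * Kc * P * exp (- \<tau> * x + 2 * \<tau> * r)"
        proof (intro add_mono mult_left_mono)
          have "\<tau> * r \<le> \<tau> * x" using r \<tau> by (intro mult_left_mono) auto
          then show "exp (- \<tau> * (x - r) + \<tau> * r) \<le> exp (\<tau> * x)" by (simp add: algebra_simps)
        qed (use Kc \<tau> P in \<open>auto simp: algebra_simps\<close>)
        also have "\<dots> = g r"
        proof -
          have "n * Kc / \<tau> * C + 2 * Kc * P * (A * B) = 2 * Kc * P * A * B + Kc * C / \<tau> * n" for A B C n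
            by (simp add: algebra_simps)
          then show ?thesis unfolding g_def exp_add .
        qed
        finally show "exp (Re (\<i> * \<mu>) * (x - r)) * norm ((q r + 2 * \<mu> * p r) * y r) \<le> g r" .
      qed
      also have "integral {0..x} g = 2 * Kc * P * exp (- \<tau> * x) * ((exp (2 * \<tau> * x) - 1) / (2 * \<tau>)) +
          Kc * exp (\<tau> * x) / \<tau> * integral {0..x} (\<lambda>r. norm (q r))"
        using gI by (rule integral_unique)
      also have "\<dots> \<le> Kc * P / \<tau> * exp (\<tau> * x) + Kc * exp (\<tau> * x) / \<tau> * B"
      proof (intro add_mono mult_left_mono qB x')
        have "2 * Kc * P * exp (- \<tau> * x) * ((exp (2 * \<tau> * x) - 1) / (2 * \<tau>)) = Kc * P / \<tau> * (exp (- \<tau> * x) * (exp (2 * \<tau> * x) - 1))"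
          using \<tau> by (simp add: field_simps)
        also have "exp (- \<tau> * x) * (exp (2 * \<tau> * x) - 1) = exp (\<tau> * x) - exp (- \<tau> * x)"
          by (simp add: right_diff_distrib flip: exp_add)
        also have "Kc * P / \<tau> * (exp (\<tau> * x) - exp (- \<tau> * x)) \<le> Kc * P / \<tau> * exp (\<tau> * x)"
          using Kc P \<tau> by (intro mult_left_mono) auto
        finally show "2 * Kc * P * exp (- \<tau> * x) * ((exp (2 * \<tau> * x) - 1) / (2 * \<tau>)) \<le> Kc * P / \<tau> * exp (\<tau> * x)" .
      qed (use Kc \<tau> in auto)
      also have "\<dots> = K2 / \<tau> * exp (\<tau> * x)" by (simp add: K2_def algebra_simps add_divide_distrib)
      finally show ?thesis using 0 by (simp add: u_def \<tau>_def)
    qed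
    define A where "A s = - \<i> * \<mu> * of_real s + \<i> * Q s" for s
    have A: "has_ac_density b A (\<lambda>s. - \<i> * \<mu> + \<i> * p s)"
      unfolding A_def by (intro ac_density_add ac_density_linear ac_density_cmult Qd)
    have eA: "norm (exp (- A r)) \<le> CQ * exp (- \<tau> * r)" if "r \<in> {0..b}" for r
    proof -
      have "exp (- A r) = exp (- \<i> * Q r) * exp (\<i> * \<mu> * r)" unfolding A_def by (simp flip: exp_add)
      moreover have "norm (exp (\<i> * \<mu> * r)) = exp (- \<tau> * r)" by (simp add: \<tau>_def)
      ultimately have "norm (exp (- A r)) = norm (exp (- \<i> * Q r)) * exp (- \<tau> * r)"
        by (metis norm_mult)
      then show ?thesis using mult_right_mono[OF CQ(2)[rule_format, OF that], of "exp (- \<tau> * r)"] by simp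
    qed
    have e1: "exp (- \<tau> * r) * exp (- \<tau> * r) = exp (- 2 * \<tau> * r)" and e2: "exp (- \<tau> * r) * exp (\<tau> * r) = 1" for r
      by (simp_all flip: exp_add)
    define f2 where "f2 s = - \<i> * p s * u s + q s * y s" for s
    have weq: "has_ac_density b w (\<lambda>s. (- \<i> * \<mu> + \<i> * p s) * w s + f2 s)"
    proof -
      have "(\<lambda>s. (- \<i> * \<mu> + \<i> * p s) * w s + f2 s) = (\<lambda>s. - \<i> * \<mu> * (z s - \<i> * \<mu> * y s) + (q s + 2 * \<mu> * p s) * y s)"
        by (simp add: fun_eq_iff w_def u_def f2_def algebra_simps)
      then show ?thesis using pencil_pair_diagonalize(2)[OF yz] unfolding w_def[abs_def] by simp
    qed
    have x': "0 \<le> x" "x \<le> b" using x by auto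
    have wx: "norm (exp (- A x) * w x - 1) \<le> CQ * (P / 2 + P * K2 * b + B * Kc) / \<tau>"
    proof -
      define g where "g r = CQ * (P * exp (- 2 * \<tau> * r) + P * K2 / \<tau> + Kc / \<tau> * norm (q r))" for r
      have "(g has_integral CQ * (P * ((exp (- 2 * \<tau> * x) - 1) / (- 2 * \<tau>)) + measure lborel {0..x} *\<^sub>R (P * K2 / \<tau>) +
          Kc / \<tau> * integral {0..x} (\<lambda>r. norm (q r)))) {0..x}"
        unfolding g_def using \<tau> x'
        by (intro has_integral_mult_right has_integral_add has_integral_exp_linear integrable_integral qi has_integral_const_real) auto
      then have gI: "(g has_integral CQ * (P * ((exp (- 2 * \<tau> * x) - 1) / (- 2 * \<tau>)) + x * (P * K2 / \<tau>) +
          Kc / \<tau> * integral {0..x} (\<lambda>r. norm (q r)))) {0..x}"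
        using x' by simp
      have "norm (exp (- A x) * w x - exp (- A 0) * w 0) \<le> integral {0..x} g"
      proof (rule ac_density_increment_bound[OF ac_density_integrating_factor[OF A weq] _ x'])
        show "g integrable_on {0..x}" using gI by blast
        fix r assume "r \<in> {0..x}"
        then have r: "r \<in> {0..b}" using x by auto
        have "norm (f2 r) \<le> norm (p r) * norm (u r) + norm (q r) * norm (y r)"
          unfolding f2_def by (rule order_trans[OF norm_triangle_ineq]) (simp add: norm_mult)
        also have "\<dots> \<le> P * (exp (- \<tau> * r) + K2 / \<tau> * exp (\<tau> * r)) + norm (q r) * (Kc * exp (\<tau> * r) / \<tau>)"
          using P r by (intro add_mono mult_mono u[OF r] y[OF r] order_refl) auto
        finally have "norm (f2 r) \<le> P * (exp (- \<tau> * r) + K2 / \<tau> * exp (\<tau> * r)) + norm (q r) * (Kc * exp (\<tau> * r) / \<tau>)" .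
        then have "norm (exp (- A r) * f2 r) \<le> (CQ * exp (- \<tau> * r)) *
            (P * (exp (- \<tau> * r) + K2 / \<tau> * exp (\<tau> * r)) + norm (q r) * (Kc * exp (\<tau> * r) / \<tau>))"
          unfolding norm_mult using eA[OF r] CQ by (intro mult_mono) auto
        also have "\<dots> = g r"
        proof -
          have "CQ * A * (P * (A + K2 / \<tau> * B) + n * (Kc * B / \<tau>)) = CQ * (P * (A * A) + P * K2 / \<tau> * (A * B) + Kc / \<tau> * n * (A * B))" for A B n
            by (simp add: algebra_simps)
          from this[of "exp (- \<tau> * r)" "exp (\<tau> * r)" "norm (q r)"] show ?thesis
            unfolding g_def e1 e2 by (simp only: mult_1_right)
        qed
        finally show "norm (exp (- A r) * f2 r) \<le> g r" .
      qed auto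
      also have "\<dots> = CQ * (P * ((exp (- 2 * \<tau> * x) - 1) / (- 2 * \<tau>)) + x * (P * K2 / \<tau>) +
          Kc / \<tau> * integral {0..x} (\<lambda>r. norm (q r)))" using gI by (rule integral_unique)
      also have "\<dots> \<le> CQ * (P * (1 / (2 * \<tau>)) + b * (P * K2 / \<tau>) + Kc / \<tau> * B)"
      proof -
        have "(exp (- 2 * \<tau> * x) - 1) / (- 2 * \<tau>) = (1 - exp (- 2 * \<tau> * x)) / (2 * \<tau>)"
          using \<tau> by (simp add: field_simps)
        also have "\<dots> \<le> 1 / (2 * \<tau>)" using \<tau> by (intro divide_right_mono) auto
        finally have *: "(exp (- 2 * \<tau> * x) - 1) / (- 2 * \<tau>) \<le> 1 / (2 * \<tau>)" .
        have "x * (P * K2 / \<tau>) \<le> b * (P * K2 / \<tau>)"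
          using P K2 \<tau> x' by (intro mult_right_mono) auto
        then show ?thesis
          using CQ P Kc \<tau> by (intro mult_left_mono add_mono * qB[OF x']) auto
      qed
      also have "\<dots> = CQ * (P / 2 + P * K2 * b + B * Kc) / \<tau>" using \<tau> by (simp add: field_simps)
      finally show ?thesis using 0 by (simp add: w_def A_def Q_def)
    qed
    have ux: "norm (exp (- A x) * u x) \<le> CQ * exp (- 2 * \<tau> * x) + CQ * K2 / \<tau>"
    proof -
      have "norm (exp (- A x) * u x) \<le> (CQ * exp (- \<tau> * x)) * (exp (- \<tau> * x) + K2 / \<tau> * exp (\<tau> * x))"
        unfolding norm_mult using eA[OF x] u[OF x] CQ by (intro mult_mono) auto
      also have "\<dots> = CQ * exp (- 2 * \<tau> * x) + CQ * K2 / \<tau>"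
      proof -
        have "CQ * A * (A + K2 / \<tau> * B) = CQ * (A * A) + CQ * K2 / \<tau> * (A * B)" for A B
          by (simp add: algebra_simps)
        from this[of "exp (- \<tau> * x)" "exp (\<tau> * x)"] show ?thesis
          unfolding e1 e2 by (simp only: mult_1_right)
      qed
      finally show ?thesis .
    qed
    have "exp (\<i> * \<mu> * x - \<i> * Q x) = exp (- A x)" by (simp add: A_def)
    then have "- 2 * \<i> * \<mu> * y x * exp (\<i> * \<mu> * x - \<i> * Q x) - 1 = (exp (- A x) * w x - 1) - exp (- A x) * u x"
      by (simp add: u_def w_def algebra_simps)
    also have "norm \<dots> \<le> CQ * (P / 2 + P * K2 * b + B * Kc) / \<tau> + (CQ * exp (- 2 * \<tau> * x) + CQ * K2 / \<tau>)"
      by (rule order_trans[OF norm_triangle_ineq4 add_mono[OF wx ux]])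
    also have "\<dots> \<le> K / \<tau> + K * exp (- 2 * \<tau> * x)"
    proof -
      have "CQ * (P / 2 + P * K2 * b + B * Kc) / \<tau> + CQ * K2 / \<tau> \<le> K / \<tau>"
        using \<tau> CQ by (simp add: K_def add_divide_distrib)
      moreover have "CQ * exp (- 2 * \<tau> * x) \<le> K * exp (- 2 * \<tau> * x)"
        unfolding K_def using CQ P K2 B0 Kc D(1) by (intro mult_right_mono) (auto intro!: add_nonneg_nonneg mult_nonneg_nonneg)
      ultimately show ?thesis by linarith
    qed
    finally show ?thesis by (simp add: \<tau>_def)
  qed
  then show ?thesis unfolding Q_def using K0 by blast
qed

text \<open>
  The equation is invariant under a simultaneous change of sign of \<open>p\<close> and
  \<open>\<mu>\<close>.
\<close>
lemma pencil_asymptotics_lower: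
  assumes co: "pencil_coeffs b p q"
  shows "\<exists>K\<ge>0. \<forall>\<mu> y z x. Im \<mu> \<le> - 1 \<longrightarrow> pencil_pair b p q \<mu> y z \<longrightarrow> y 0 = 0 \<longrightarrow> z 0 = 1 \<longrightarrow> x \<in> {0..b} \<longrightarrow>
     norm (2 * \<i> * \<mu> * y x * exp (- \<i> * \<mu> * x + \<i> * integral {0..x} p) - 1) \<le> K / \<bar>Im \<mu>\<bar> + K * exp (- 2 * \<bar>Im \<mu>\<bar> * x)"
proof -
  have "pencil_coeffs b (\<lambda>x. - p x) q"
    using co unfolding pencil_coeffs_def by (auto intro: continuous_intros)
  from pencil_asymptotics_upper[OF this]
  obtain K where K: "0 \<le> K" "\<forall>\<mu> y z x. 1 \<le> Im \<mu> \<longrightarrow> pencil_pair b (\<lambda>x. - p x) q \<mu> y z \<longrightarrow> y 0 = 0 \<longrightarrow> z 0 = 1 \<longrightarrow> x \<in> {0..b} \<longrightarrow>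
     norm (- 2 * \<i> * \<mu> * y x * exp (\<i> * \<mu> * x - \<i> * integral {0..x} (\<lambda>x. - p x)) - 1) \<le> K / Im \<mu> + K * exp (- 2 * Im \<mu> * x)"
    by blast
  show ?thesis
  proof (intro exI[of _ K] conjI allI impI K(1))
    fix \<mu> y z x assume *: "Im \<mu> \<le> - 1" "pencil_pair b p q \<mu> y z" "y 0 = 0" "z 0 = 1" "x \<in> {0..b}"
    have "pencil_pair b (\<lambda>x. - p x) q (- \<mu>) y z" using *(2) pencil_pair_neg by blast
    from K(2)[rule_format, OF _ this *(3-5)] *(1)
    show "norm (2 * \<i> * \<mu> * y x * exp (- \<i> * \<mu> * x + \<i> * integral {0..x} p) - 1) \<le> K / \<bar>Im \<mu>\<bar> + K * exp (- 2 * \<bar>Im \<mu>\<bar> * x)"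
      by simp
  qed
qed

section \<open>Quotients of entire functions that are bounded off a strip\<close>

text \<open>
  Otherwise Montel's theorem provides a limit that vanishes somewhere on every circle of the annulus
  but equals \<open>1\<close> at the centre, and such a function would have infinitely many zeros in
  a compact disc.
\<close>
lemma uniform_minimum_modulus_on_some_circle:
  fixes B r :: real
  assumes r: "0 < r"
  shows "\<exists>c>0. \<forall>D. D holomorphic_on ball 0 (4 * r) \<longrightarrow> (\<forall>z\<in>ball 0 (4 * r). norm (D z) \<le> B) \<longrightarrow> D 0 = 1 \<longrightarrow>
     (\<exists>\<rho>\<in>{2 * r..3 * r}. \<forall>z\<in>sphere 0 \<rho>. c \<le> norm (D z :: complex))"
proof (rule ccontr)
  assume neg: "\<not> ?thesis"
  define Good where "Good = {D. D holomorphic_on ball 0 (4 * r) \<and> (\<forall>z\<in>ball 0 (4 * r). norm (D z :: complex) \<le> B) \<and> D 0 = 1}"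
  have "\<exists>D\<in>Good. \<forall>\<rho>\<in>{2 * r..3 * r}. \<exists>z\<in>sphere 0 \<rho>. norm (D z) < inverse (real (Suc n))" for n
    using neg[simplified, rule_format, of "inverse (real (Suc n))"] unfolding Good_def by (force simp: not_le)
  then obtain \<F> where F: "\<And>n. \<F> n \<in> Good"
    "\<And>n \<rho>. \<rho> \<in> {2 * r..3 * r} \<Longrightarrow> \<exists>z\<in>sphere 0 \<rho>. norm (\<F> n z) < inverse (real (Suc n))"
    by metis
  have hol: "\<And>h. h \<in> Good \<Longrightarrow> h holomorphic_on ball 0 (4 * r)" by (simp add: Good_def)
  have bd: "\<And>K. \<lbrakk>compact K; K \<subseteq> ball 0 (4 * r)\<rbrakk> \<Longrightarrow> \<exists>C. \<forall>h\<in>Good. \<forall>z\<in>K. norm (h z) \<le> C"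
    by (intro exI[of _ B]) (auto simp: Good_def)
  have rng: "range \<F> \<subseteq> Good" using F(1) by auto
  obtain g s where g: "g holomorphic_on ball 0 (4 * r)" "strict_mono s"
    "\<And>x. x \<in> ball 0 (4 * r) \<Longrightarrow> ((\<lambda>n. \<F> (s n) x) \<longlongrightarrow> g x) sequentially"
    "\<And>K. \<lbrakk>compact K; K \<subseteq> ball 0 (4 * r)\<rbrakk> \<Longrightarrow> uniform_limit K (\<F> \<circ> s) g sequentially"
    using Montel[OF open_ball hol bd rng] by blast
  have "((\<lambda>n. \<F> (s n) 0) \<longlongrightarrow> g 0) sequentially" using g(3)[of 0] r by simp
  moreover have "(\<lambda>n. \<F> (s n) 0) = (\<lambda>n. 1)" using F(1) by (auto simp: Good_def)
  ultimately have g0: "g 0 = 1" by (simp add: LIMSEQ_const_iff)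
  \<comment> \<open>By uniform convergence a limit without zeros on the circle would bound the family from below there.\<close>
  have zero: "\<exists>z\<in>sphere 0 \<rho>. g z = 0" if \<rho>: "\<rho> \<in> {2 * r..3 * r}" for \<rho>
  proof (rule ccontr)
    assume "\<not> (\<exists>z\<in>sphere 0 \<rho>. g z = 0)"
    then have nz: "\<And>z. z \<in> sphere 0 \<rho> \<Longrightarrow> norm (g z) \<noteq> 0" by auto
    have sub: "sphere 0 \<rho> \<subseteq> ball (0::complex) (4 * r)" using \<rho> r by (auto simp: dist_norm)
    have ne: "sphere (0::complex) \<rho> \<noteq> {}" using \<rho> r by auto
    have "continuous_on (sphere 0 \<rho>) (\<lambda>z. norm (g z))"
      by (intro continuous_intros continuous_on_subset[OF holomorphic_on_imp_continuous_on[OF g(1)] sub])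
    then obtain z0 where z0: "z0 \<in> sphere 0 \<rho>" "\<And>z. z \<in> sphere 0 \<rho> \<Longrightarrow> norm (g z0) \<le> norm (g z)"
      using continuous_attains_inf[OF compact_sphere ne, of "\<lambda>z. norm (g z)"] by blast
    define m where "m = norm (g z0)"
    have m: "0 < m" using nz[OF z0(1)] by (simp add: m_def)
    have "uniform_limit (sphere 0 \<rho>) (\<F> \<circ> s) g sequentially" by (intro g(4) sub) auto
    then have "\<forall>\<^sub>F n in sequentially. \<forall>z\<in>sphere 0 \<rho>. dist ((\<F> \<circ> s) n z) (g z) < m / 2"
      using uniform_limitD[OF _ half_gt_zero[OF m]] by blast
    moreover have "\<forall>\<^sub>F n in sequentially. inverse (real (Suc n)) < m / 2"
      using m LIMSEQ_inverse_real_of_nat by (intro order_tendstoD(2)) auto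
    ultimately have "\<forall>\<^sub>F n in sequentially. False"
    proof eventually_elim
      case (elim n)
      obtain z where z: "z \<in> sphere 0 \<rho>" "norm (\<F> (s n) z) < inverse (real (Suc (s n)))"
        using F(2)[OF \<rho>, of "s n"] by blast
      have "inverse (real (Suc (s n))) \<le> inverse (real (Suc n))"
        using seq_suble[OF g(2), of n] by (intro le_imp_inverse_le) auto
      then have "norm (\<F> (s n) z) < m / 2" using z(2) elim(2) by linarith
      moreover have "norm (\<F> (s n) z - g z) < m / 2" using elim(1) z(1) by (simp add: dist_norm)
      moreover have "m \<le> norm (g z)" using z0(2)[OF z(1)] by (simp add: m_def)
      moreover have "norm (g z) \<le> norm (\<F> (s n) z) + norm (\<F> (s n) z - g z)"
        using norm_triangle_ineq4[of "\<F> (s n) z" "\<F> (s n) z - g z"] by simp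
      ultimately show False by linarith
    qed
    then show False by simp
  qed
  define Zs where "Zs = {z \<in> cball 0 (3 * r). g z = 0}"
  have "finite Zs"
    unfolding Zs_def
  proof (rule holomorphic_compact_finite_zeros[OF g(1)])
    show "cball 0 (3 * r) \<subseteq> ball (0::complex) (4 * r)" using r by auto
    obtain z where z: "z \<in> sphere 0 (2 * r)" "g z = 0" using zero[of "2 * r"] r by auto
    then have "z \<in> ball 0 (4 * r)" "0 \<in> ball (0::complex) (4 * r)" using r by auto
    then show "\<not> g constant_on ball 0 (4 * r)"
      using g0 z(2) unfolding constant_on_def by (metis zero_neq_one)
  qed auto
  moreover have "{2 * r..3 * r} \<subseteq> norm ` Zs"
  proof
    fix \<rho> assume \<rho>: "\<rho> \<in> {2 * r..3 * r}"
    obtain z where "z \<in> sphere 0 \<rho>" "g z = 0" using zero[OF \<rho>] by blast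
    then show "\<rho> \<in> norm ` Zs" using \<rho> by (intro image_eqI[of _ _ z]) (auto simp: Zs_def)
  qed
  ultimately have "finite {2 * r..3 * r}" by (meson finite_imageI finite_subset)
  moreover have "infinite {2 * r..3 * r}" using r by (intro infinite_Icc) auto
  ultimately show False by simp
qed

text \<open>
  The maximum principle on the circle on which \<open>D\<close> is known to stay away from zero.
\<close>
lemma entire_bounded_by_values_on_circle:
  assumes f: "f holomorphic_on UNIV" and D: "D holomorphic_on UNIV" and r: "0 < r"
    and c: "0 < c" "\<forall>D. D holomorphic_on ball 0 (4 * r) \<longrightarrow> (\<forall>z\<in>ball 0 (4 * r). norm (D z) \<le> B) \<longrightarrow> D 0 = 1 \<longrightarrow>
     (\<exists>\<rho>\<in>{2 * r..3 * r}. \<forall>z\<in>sphere 0 \<rho>. c \<le> norm (D z :: complex))"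
    and z0: "D z0 \<noteq> 0" "\<And>z. norm (z - z0) < 4 * r \<Longrightarrow> norm (D z) \<le> B * norm (D z0)"
    and fD: "\<And>z. norm (z - z0) < 4 * r \<Longrightarrow> norm (f z * D z) \<le> B * norm (D z0)"
    and w: "norm (w - z0) \<le> 2 * r"
  shows "norm (f w) \<le> B / c"
proof -
  define E where "E z = D (z0 + z) / D z0" for z
  have comp: "(\<lambda>z. h (z0 + z)) holomorphic_on S" if "h holomorphic_on UNIV" for h S
  proof -
    have "(h \<circ> (\<lambda>z. z0 + z)) holomorphic_on S"
      by (intro holomorphic_on_compose holomorphic_on_subset[OF that] holomorphic_intros) auto
    then show ?thesis by (simp add: o_def)
  qed
  have "E holomorphic_on ball 0 (4 * r)"
    unfolding E_def using z0(1) by (intro holomorphic_intros comp D) auto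
  moreover have "\<forall>z\<in>ball 0 (4 * r). norm (E z) \<le> B"
    using z0(2)[of "z0 + z" for z] z0(1) by (auto simp: E_def norm_divide divide_simps)
  moreover have "E 0 = 1" using z0(1) by (simp add: E_def)
  ultimately obtain \<rho> where \<rho>: "\<rho> \<in> {2 * r..3 * r}" "\<forall>z\<in>sphere 0 \<rho>. c \<le> norm (E z)"
    using c(2) by blast
  have "norm (f (z0 + (w - z0))) \<le> B / c"
  proof (rule maximum_modulus_frontier[of "\<lambda>z. f (z0 + z)" "cball 0 \<rho>"])
    show "(\<lambda>z. f (z0 + z)) holomorphic_on interior (cball 0 \<rho>)" by (rule comp[OF f])
    show "continuous_on (closure (cball 0 \<rho>)) (\<lambda>z. f (z0 + z))"
      by (rule holomorphic_on_imp_continuous_on[OF comp[OF f]])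
    show "w - z0 \<in> cball 0 \<rho>" using w \<rho> by auto
    fix z assume "z \<in> frontier (cball (0::complex) \<rho>)"
    then have z: "norm z = \<rho>" using \<rho>(1) r by (auto simp: frontier_cball)
    have "c * norm (D z0) \<le> norm (D (z0 + z))"
      using \<rho>(2) z z0(1) by (simp add: E_def norm_divide pos_le_divide_eq)
    then have "norm (f (z0 + z)) * (c * norm (D z0)) \<le> norm (f (z0 + z)) * norm (D (z0 + z))"
      by (rule mult_left_mono) simp
    also have "\<dots> \<le> B * norm (D z0)" using fD[of "z0 + z"] z \<rho> r by (simp add: norm_mult)
    finally have "norm (f (z0 + z)) * c \<le> B" using z0(1) by (simp add: mult.assoc[symmetric])
    then show "norm (f (z0 + z)) \<le> B / c" using c(1) by (simp add: pos_le_divide_eq)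
  qed auto
  then show ?thesis by simp
qed

text \<open>
  Off the strip the quotient is bounded by the growth estimates. In the strip the denominator may
  have zeros, but around any point of it there is a circle on which the denominator is comparable to
  its value at a nearby point on the upper edge of the strip. Liouville's theorem concludes.
\<close>
lemma entire_quotient_constant:
  fixes f D :: "complex \<Rightarrow> complex" and a :: real
  assumes f: "f holomorphic_on UNIV" and D: "D holomorphic_on UNIV" and a: "0 \<le> a"
    and up: "\<And>z. 1 \<le> norm z \<Longrightarrow> norm (D z) \<le> K * exp (a * \<bar>Im z\<bar>) / norm z"
      "\<And>z. 1 \<le> norm z \<Longrightarrow> norm (f z * D z) \<le> K * exp (a * \<bar>Im z\<bar>) / norm z"
    and low: "0 < c" "\<And>z. R \<le> \<bar>Im z\<bar> \<Longrightarrow> c * exp (a * \<bar>Im z\<bar>) / norm z \<le> norm (D z)"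
  shows "\<exists>C. \<forall>z. f z = C"
proof -
  define S where "S = max R 1"
  have S: "1 \<le> S" "R \<le> S" by (auto simp: S_def)
  have outer: "norm (f z) \<le> K / c" if z: "S \<le> \<bar>Im z\<bar>" for z
  proof -
    have nz: "1 \<le> norm z" using z S abs_Im_le_cmod[of z] by linarith
    have D0: "0 < c * exp (a * \<bar>Im z\<bar>) / norm z" using low(1) nz by (intro divide_pos_pos mult_pos_pos) auto
    have "norm (f z) * (c * exp (a * \<bar>Im z\<bar>) / norm z) \<le> norm (f z) * norm (D z)"
      using low(2)[of z] z S by (intro mult_left_mono) auto
    also have "\<dots> \<le> K * exp (a * \<bar>Im z\<bar>) / norm z" using up(2)[OF nz] by (simp add: norm_mult)
    also have "\<dots> = (K / c) * (c * exp (a * \<bar>Im z\<bar>) / norm z)" using low(1) by simp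
    finally show ?thesis using D0 mult_le_cancel_right_pos by blast
  qed
  define B where "B = 2 * \<bar>K\<bar> * exp (a * (4 * S)) / c"
  obtain m where m: "0 < m" "\<forall>D. D holomorphic_on ball 0 (4 * S) \<longrightarrow> (\<forall>z\<in>ball 0 (4 * S). norm (D z) \<le> B) \<longrightarrow> D 0 = 1 \<longrightarrow>
     (\<exists>\<rho>\<in>{2 * S..3 * S}. \<forall>z\<in>sphere 0 \<rho>. m \<le> norm (D z :: complex))"
    using uniform_minimum_modulus_on_some_circle[of S B] S by auto
  have strip: "norm (f w) \<le> B / m" if w: "\<bar>Im w\<bar> \<le> S" "8 * S \<le> \<bar>Re w\<bar>" for w
  proof (rule entire_bounded_by_values_on_circle[OF f D _ m, where ?z0.0="Complex (Re w) S"])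
    \<comment> \<open>The centre lies on the edge of the strip, where the lower bound of the denominator is available.\<close>
    let ?z0 = "Complex (Re w) S"
    have n0: "8 * S \<le> norm ?z0" using w(2) abs_Re_le_cmod[of ?z0] by simp
    have low0: "c * exp (a * S) / norm ?z0 \<le> norm (D ?z0)" using low(2)[of ?z0] S by simp
    have "0 < c * exp (a * S) / norm ?z0" using low(1) n0 S by (intro divide_pos_pos) auto
    then show "D ?z0 \<noteq> 0" using low0 by auto
    have bd: "1 \<le> norm z" "K * exp (a * \<bar>Im z\<bar>) / norm z \<le> B * norm (D ?z0)" if z: "norm (z - ?z0) < 4 * S" for z
    proof -
      have nz: "norm ?z0 \<le> 2 * norm z"
        using norm_triangle_ineq2[of ?z0 "?z0 - z"] z n0 by (simp add: norm_minus_commute)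
      then show 1: "1 \<le> norm z" using n0 S by linarith
      have "\<bar>Im (z - ?z0)\<bar> < 4 * S" using z abs_Im_le_cmod[of "z - ?z0"] by linarith
      then have "\<bar>Im z\<bar> \<le> 4 * S + S" by simp
      then have "a * \<bar>Im z\<bar> \<le> a * (4 * S + S)" using a by (intro mult_left_mono)
      then have e: "exp (a * \<bar>Im z\<bar>) \<le> exp (a * (4 * S)) * exp (a * S)"
        by (simp add: algebra_simps flip: exp_add)
      have "K * exp (a * \<bar>Im z\<bar>) / norm z \<le> \<bar>K\<bar> * (exp (a * (4 * S)) * exp (a * S)) / norm z"
        using e 1 by (intro divide_right_mono mult_mono) auto
      also have "\<dots> \<le> \<bar>K\<bar> * (exp (a * (4 * S)) * exp (a * S)) / (norm ?z0 / 2)"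
      proof (rule divide_left_mono)
        show "0 < norm z * (norm ?z0 / 2)" using 1 n0 S by (intro mult_pos_pos) linarith+
      qed (use nz in auto)
      also have "\<dots> = B * (c * exp (a * S) / norm ?z0)"
        using low(1) by (simp add: B_def)
      also have "\<dots> \<le> B * norm (D ?z0)"
        using low(1) by (intro mult_left_mono low0) (simp add: B_def)
      finally show "K * exp (a * \<bar>Im z\<bar>) / norm z \<le> B * norm (D ?z0)" .
    qed
    show "norm (D z) \<le> B * norm (D ?z0)" if "norm (z - ?z0) < 4 * S" for z
      using up(1)[OF bd(1)[OF that]] bd(2)[OF that] by linarith
    show "norm (f z * D z) \<le> B * norm (D ?z0)" if "norm (z - ?z0) < 4 * S" for z
      using up(2)[OF bd(1)[OF that]] bd(2)[OF that] by linarith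
    have "w - ?z0 = Complex 0 (Im w - S)" by (simp add: complex_eq_iff)
    then show "norm (w - ?z0) \<le> 2 * S" using w(1) by (simp add: cmod_def)
  qed (use S in simp)
  have "compact (cball (0::complex) (9 * S))" by simp
  then have "bounded (f ` cball 0 (9 * S))"
    using compact_continuous_image[OF holomorphic_on_imp_continuous_on[OF holomorphic_on_subset[OF f]]] compact_imp_bounded by blast
  then obtain C where C: "\<forall>y\<in>f ` cball 0 (9 * S). norm y \<le> C" unfolding bounded_iff by blast
  have "norm (f z) \<le> max (max (K / c) (B / m)) C" for z
  proof -
    consider "S \<le> \<bar>Im z\<bar>" | "\<bar>Im z\<bar> \<le> S" "8 * S \<le> \<bar>Re z\<bar>" | "\<bar>Im z\<bar> \<le> S" "\<bar>Re z\<bar> \<le> 8 * S" by linarith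
    then show ?thesis
    proof cases
      case 1 then show ?thesis using outer[of z] by linarith
    next
      case 2 then show ?thesis using strip[of z] by linarith
    next
      case 3
      then have "norm z \<le> 9 * S" using cmod_le[of z] by linarith
      then show ?thesis using C by (auto simp: le_max_iff_disj)
    qed
  qed
  then have "bounded (range f)" unfolding bounded_iff by blast
  then obtain C where "\<And>z. f z = C" using Liouville_theorem[OF f] by (metis constant_on_def UNIV_I)
  then show ?thesis by blast
qed

text \<open>Where the denominator vanishes the other side of the relation provides the quotient.\<close>
lemma coprime_entire_divides:
  assumes hol: "D holomorphic_on UNIV" "E holomorphic_on UNIV" "u holomorphic_on UNIV" "v holomorphic_on UNIV"
    and rel: "\<And>z. D z * u z = v z * E z" and cop: "\<And>z. D z = 0 \<Longrightarrow> E z \<noteq> (0::complex)"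
  shows "\<exists>F. F holomorphic_on UNIV \<and> (\<forall>z. v z = F z * D z)"
proof -
  define F where "F z = (if D z = 0 then u z / E z else v z / D z)" for z
  have eq: "F z = u z / E z" if "E z \<noteq> 0" for z
    using rel[of z] that by (auto simp: F_def field_simps)
  have cont: "continuous_on UNIV D" "continuous_on UNIV E" using hol holomorphic_on_imp_continuous_on by blast+
  have open1: "open {z. D z \<noteq> 0}" "open {z. E z \<noteq> 0}"
    using cont by (auto intro!: open_Collect_neq continuous_intros)
  have "F holomorphic_on {z. D z \<noteq> 0}"
  proof (rule holomorphic_transform)
    show "(\<lambda>z. v z / D z) holomorphic_on {z. D z \<noteq> 0}"
      by (intro holomorphic_intros holomorphic_on_subset[OF hol(4)] holomorphic_on_subset[OF hol(1)]) auto
  qed (auto simp: F_def)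
  moreover have "F holomorphic_on {z. E z \<noteq> 0}"
  proof (rule holomorphic_transform)
    show "(\<lambda>z. u z / E z) holomorphic_on {z. E z \<noteq> 0}"
      by (intro holomorphic_intros holomorphic_on_subset[OF hol(3)] holomorphic_on_subset[OF hol(2)]) auto
  qed (auto simp: eq)
  ultimately have "F holomorphic_on {z. D z \<noteq> 0} \<union> {z. E z \<noteq> 0}"
    using holomorphic_on_Un open1 by blast
  moreover have "{z. D z \<noteq> 0} \<union> {z. E z \<noteq> 0} = UNIV" using cop by auto
  moreover have "v z = F z * D z" for z
    using rel[of z] cop[of z] by (cases "D z = 0") (auto simp: F_def)
  ultimately show ?thesis by auto
qed

section \<open>Characteristic functions of functionals concentrated at the end\<close>

text \<open>
  A multiple of the evaluation at \<open>b\<close> plus a remainder with little mass near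
  \<open>b\<close>. On a function bounded by \<open>M1\<close> everywhere and by \<open>M2\<close>
  away from \<open>b\<close> the remainder is small as soon as \<open>M2\<close> is much smaller
  than \<open>M1\<close>, as is the case for solutions that grow exponentially towards
  \<open>b\<close>.
\<close>
definition end_functional :: "real \<Rightarrow> complex \<Rightarrow> ((real \<Rightarrow> complex) \<Rightarrow> complex) \<Rightarrow> bool" where
  "end_functional b H L \<longleftrightarrow> bounded_functional b L \<and>
     (\<forall>\<epsilon>>0. \<exists>\<delta>>0. \<exists>K\<ge>0. \<forall>f M1 M2. continuous_on {0..b} f \<longrightarrow> (\<forall>x\<in>{0..b}. norm (f x) \<le> M1) \<longrightarrow>
        (\<forall>x\<in>{0..b - \<delta>}. norm (f x) \<le> M2) \<longrightarrow> norm (L f - H * f b) \<le> \<epsilon> * M1 + K * M2)"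

definition fundamental_system where
  "fundamental_system b p q S S' C C' \<longleftrightarrow>
     (\<forall>\<mu>. pencil_pair b p q \<mu> (S \<mu>) (S' \<mu>) \<and> S \<mu> 0 = 0 \<and> S' \<mu> 0 = 1 \<and>
          pencil_pair b p q \<mu> (C \<mu>) (C' \<mu>) \<and> C \<mu> 0 = 1 \<and> C' \<mu> 0 = 0)"

lemma fundamental_systemD:
  assumes "fundamental_system b p q S S' C C'"
  shows "pencil_pair b p q \<mu> (S \<mu>) (S' \<mu>)" "pencil_pair b p q \<mu> (C \<mu>) (C' \<mu>)"
    "S \<mu> 0 = 0" "S' \<mu> 0 = 1" "C \<mu> 0 = 1" "C' \<mu> 0 = 0"
    "continuous_on {0..b} (S \<mu>)" "continuous_on {0..b} (S' \<mu>)" "continuous_on {0..b} (C \<mu>)" "continuous_on {0..b} (C' \<mu>)"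
  using assms pencil_pair_continuous unfolding fundamental_system_def by blast+

lemma fundamental_system_wronskian:
  assumes "fundamental_system b p q S S' C C'" "x \<in> {0..b}"
  shows "C \<mu> x * S' \<mu> x - C' \<mu> x * S \<mu> x = 1"
  using pencil_pair_wronskian[OF fundamental_systemD(2,1)[OF assms(1)] assms(2)] fundamental_systemD(3-6)[OF assms(1)]
  by simp

lemma fundamental_system_weakly_entire:
  assumes "pencil_coeffs b p q" "fundamental_system b p q S S' C C'"
  shows "weakly_entire b S" "weakly_entire b S'" "weakly_entire b C" "weakly_entire b C'"
  using pencil_pair_family_weakly_entire[OF assms(1) fundamental_systemD(1,3,4)[OF assms(2)]]
    pencil_pair_family_weakly_entire[OF assms(1) fundamental_systemD(2,5,6)[OF assms(2)]] by simp_all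

lemma fundamental_system_exists:
  assumes "pencil_coeffs b p q"
  shows "\<exists>S S' C C'. fundamental_system b p q S S' C C'"
  using pencil_pair_exists[OF assms, of 0 1] pencil_pair_exists[OF assms, of 1 0]
  unfolding fundamental_system_def by metis

lemma weakly_entire_functional:
  "weakly_entire b F \<Longrightarrow> bounded_functional b L \<Longrightarrow> (\<lambda>\<mu>. L (F \<mu>)) holomorphic_on UNIV"
  unfolding weakly_entire_def by simp

lemma sine_solution_bound:
  assumes co: "pencil_coeffs b p q" and fs: "fundamental_system b p q S S' C C'"
    and \<mu>: "1 \<le> norm \<mu>" and x: "x \<in> {0..b}"
  shows "norm (S \<mu> x) \<le> 2 * growth_const b p q * exp (\<bar>Im \<mu>\<bar> * x) / norm \<mu>"
    "norm (S' \<mu> x) \<le> 2 * growth_const b p q * exp (\<bar>Im \<mu>\<bar> * x)"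
proof -
  note F = fundamental_systemD[OF fs, of \<mu>]
  have "0 < norm \<mu>" using \<mu> by linarith
  have *: "norm \<mu> * norm (S \<mu> x) + norm (S' \<mu> x) \<le> 2 * growth_const b p q * exp (\<bar>Im \<mu>\<bar> * x)"
    using pencil_growth_from_0[OF co F(1) \<mu>, of x] x F(3,4) by simp
  moreover have "0 \<le> norm \<mu> * norm (S \<mu> x)" by simp
  ultimately show "norm (S' \<mu> x) \<le> 2 * growth_const b p q * exp (\<bar>Im \<mu>\<bar> * x)" by linarith
  have "norm \<mu> * norm (S \<mu> x) \<le> 2 * growth_const b p q * exp (\<bar>Im \<mu>\<bar> * x)"
    using * norm_ge_zero[of "S' \<mu> x"] by linarith
  then show "norm (S \<mu> x) \<le> 2 * growth_const b p q * exp (\<bar>Im \<mu>\<bar> * x) / norm \<mu>"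
    using \<open>0 < norm \<mu>\<close> by (simp only: pos_le_divide_eq mult.commute[of "norm (S \<mu> x)"])
qed

lemma eventually_small_damping:
  fixes K \<epsilon> \<delta> :: real
  assumes "0 < \<epsilon>" "0 < \<delta>"
  shows "\<exists>R\<ge>1. \<forall>\<tau>\<ge>R. K / \<tau> + K * exp (- \<delta> * \<tau>) \<le> \<epsilon>"
proof -
  have "((\<lambda>\<tau>. K / \<tau> + K * exp (- \<delta> * \<tau>)) \<longlongrightarrow> K * 0 + K * 0) at_top"
  proof (intro tendsto_add tendsto_mult tendsto_const)
    show "((\<lambda>\<tau>. exp (- \<delta> * \<tau>)) \<longlongrightarrow> 0) at_top"
    proof (rule filterlim_compose[OF exp_at_bot])
      show "LIM \<tau> at_top. - \<delta> * \<tau> :> at_bot"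
        using assms by (intro filterlim_tendsto_neg_mult_at_bot[OF tendsto_const _ filterlim_ident]) auto
    qed
    have "((\<lambda>\<tau>::real. K * inverse \<tau>) \<longlongrightarrow> K * 0) at_top"
      by (intro tendsto_intros tendsto_inverse_0_at_top filterlim_ident)
    then show "((\<lambda>\<tau>. K / \<tau>) \<longlongrightarrow> K * 0) at_top" by (simp add: divide_inverse)
  qed
  then have "\<forall>\<^sub>F \<tau> in at_top. K / \<tau> + K * exp (- \<delta> * \<tau>) < \<epsilon>"
    using assms by (intro order_tendstoD) auto
  then obtain R where "\<forall>\<tau>\<ge>R. K / \<tau> + K * exp (- \<delta> * \<tau>) < \<epsilon>"
    unfolding eventually_at_top_linorder by blast
  then show ?thesis by (intro exI[of _ "max R 1"]) (auto intro: less_imp_le)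
qed

lemma sine_solution_asymptotics_upper:
  assumes co: "pencil_coeffs b p q" and fs: "fundamental_system b p q S S' C C'"
    and x: "0 < x" "x \<le> b" and e: "0 < \<epsilon>"
  shows "\<exists>R\<ge>1. \<forall>\<mu>. R \<le> Im \<mu> \<longrightarrow> norm (- 2 * \<i> * \<mu> * S \<mu> x * exp (\<i> * \<mu> * x - \<i> * integral {0..x} p) - 1) \<le> \<epsilon>"
proof -
  obtain K where K: "0 \<le> K" "\<forall>\<mu> y z x. 1 \<le> Im \<mu> \<longrightarrow> pencil_pair b p q \<mu> y z \<longrightarrow> y 0 = 0 \<longrightarrow> z 0 = 1 \<longrightarrow> x \<in> {0..b} \<longrightarrow>
     norm (- 2 * \<i> * \<mu> * y x * exp (\<i> * \<mu> * x - \<i> * integral {0..x} p) - 1) \<le> K / Im \<mu> + K * exp (- 2 * Im \<mu> * x)"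
    using pencil_asymptotics_upper[OF co] by blast
  obtain R where R: "1 \<le> R" "\<forall>\<tau>\<ge>R. K / \<tau> + K * exp (- (2 * x) * \<tau>) \<le> \<epsilon>"
    using eventually_small_damping[OF e, of "2 * x" K] x by auto
  show ?thesis
  proof (intro exI[of _ R] conjI allI impI R(1))
    fix \<mu> assume \<mu>: "R \<le> Im \<mu>"
    have "norm (- 2 * \<i> * \<mu> * S \<mu> x * exp (\<i> * \<mu> * x - \<i> * integral {0..x} p) - 1) \<le> K / Im \<mu> + K * exp (- 2 * Im \<mu> * x)"
      using \<mu> R(1) x by (intro K(2)[rule_format, OF _ fundamental_systemD(1,3,4)[OF fs]]) auto
    also have "\<dots> \<le> \<epsilon>" using R(2)[rule_format, OF \<mu>] by (simp add: mult_ac)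
    finally show "norm (- 2 * \<i> * \<mu> * S \<mu> x * exp (\<i> * \<mu> * x - \<i> * integral {0..x} p) - 1) \<le> \<epsilon>" .
  qed
qed

lemma sine_solution_asymptotics_lower:
  assumes co: "pencil_coeffs b p q" and fs: "fundamental_system b p q S S' C C'"
    and x: "0 < x" "x \<le> b" and e: "0 < \<epsilon>"
  shows "\<exists>R\<ge>1. \<forall>\<mu>. Im \<mu> \<le> - R \<longrightarrow> norm (2 * \<i> * \<mu> * S \<mu> x * exp (- \<i> * \<mu> * x + \<i> * integral {0..x} p) - 1) \<le> \<epsilon>"
proof -
  obtain K where K: "0 \<le> K" "\<forall>\<mu> y z x. Im \<mu> \<le> - 1 \<longrightarrow> pencil_pair b p q \<mu> y z \<longrightarrow> y 0 = 0 \<longrightarrow> z 0 = 1 \<longrightarrow> x \<in> {0..b} \<longrightarrow>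
     norm (2 * \<i> * \<mu> * y x * exp (- \<i> * \<mu> * x + \<i> * integral {0..x} p) - 1) \<le> K / \<bar>Im \<mu>\<bar> + K * exp (- 2 * \<bar>Im \<mu>\<bar> * x)"
    using pencil_asymptotics_lower[OF co] by blast
  obtain R where R: "1 \<le> R" "\<forall>\<tau>\<ge>R. K / \<tau> + K * exp (- (2 * x) * \<tau>) \<le> \<epsilon>"
    using eventually_small_damping[OF e, of "2 * x" K] x by auto
  show ?thesis
  proof (intro exI[of _ R] conjI allI impI R(1))
    fix \<mu> assume \<mu>: "Im \<mu> \<le> - R"
    then have a: "R \<le> \<bar>Im \<mu>\<bar>" by linarith
    have "norm (2 * \<i> * \<mu> * S \<mu> x * exp (- \<i> * \<mu> * x + \<i> * integral {0..x} p) - 1) \<le> K / \<bar>Im \<mu>\<bar> + K * exp (- 2 * \<bar>Im \<mu>\<bar> * x)"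
      using \<mu> R(1) x by (intro K(2)[rule_format, OF _ fundamental_systemD(1,3,4)[OF fs]]) auto
    also have "\<dots> \<le> \<epsilon>" using R(2)[rule_format, OF a] by (simp add: mult_ac)
    finally show "norm (2 * \<i> * \<mu> * S \<mu> x * exp (- \<i> * \<mu> * x + \<i> * integral {0..x} p) - 1) \<le> \<epsilon>" .
  qed
qed

text \<open>
  In either half plane the asymptotics place the normalized solution in the disc of radius
  \<open>1/2\<close> about \<open>1\<close>.
\<close>
lemma sine_solution_lower_bound:
  assumes co: "pencil_coeffs b p q" and fs: "fundamental_system b p q S S' C C'" and x: "0 < x" "x \<le> b"
  shows "\<exists>c>0. \<exists>R\<ge>1. \<forall>\<mu>. R \<le> \<bar>Im \<mu>\<bar> \<longrightarrow> c * exp (\<bar>Im \<mu>\<bar> * x) / norm \<mu> \<le> norm (S \<mu> x)"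
proof -
  define Q where "Q = integral {0..x} p"
  obtain R1 where R1: "1 \<le> R1" "\<forall>\<mu>. R1 \<le> Im \<mu> \<longrightarrow> norm (- 2 * \<i> * \<mu> * S \<mu> x * exp (\<i> * \<mu> * x - \<i> * Q) - 1) \<le> 1/2"
    using sine_solution_asymptotics_upper[OF co fs x, of "1/2"] unfolding Q_def by auto
  obtain R2 where R2: "1 \<le> R2" "\<forall>\<mu>. Im \<mu> \<le> - R2 \<longrightarrow> norm (2 * \<i> * \<mu> * S \<mu> x * exp (- \<i> * \<mu> * x + \<i> * Q) - 1) \<le> 1/2"
    using sine_solution_asymptotics_lower[OF co fs x, of "1/2"] unfolding Q_def by auto
  define E where "E = exp \<bar>Im Q\<bar>"
  have E: "0 < E" by (simp add: E_def)
  have half: "1/2 \<le> norm w" if "norm (w - 1) \<le> 1/2" for w :: complex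
    using norm_triangle_ineq4[of w "w - 1"] that by simp
  have fin: "1 / (4 * E) * exp (\<bar>Im \<mu>\<bar> * x) / norm \<mu> \<le> norm (S \<mu> x)"
    if "1/2 \<le> 2 * norm \<mu> * norm (S \<mu> x) * g" "g \<le> exp (- \<bar>Im \<mu>\<bar> * x) * E" "1 \<le> \<bar>Im \<mu>\<bar>" for \<mu> g
  proof -
    have m: "0 < norm \<mu>" using that(3) abs_Im_le_cmod[of \<mu>] by linarith
    have "1/2 \<le> 2 * norm \<mu> * norm (S \<mu> x) * (exp (- \<bar>Im \<mu>\<bar> * x) * E)"
      using that(1) mult_left_mono[OF that(2), of "2 * norm \<mu> * norm (S \<mu> x)"] by simp
    then have "exp (\<bar>Im \<mu>\<bar> * x) * (1/2) \<le> exp (\<bar>Im \<mu>\<bar> * x) * (2 * norm \<mu> * norm (S \<mu> x) * (exp (- \<bar>Im \<mu>\<bar> * x) * E))"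
      by (rule mult_left_mono) simp
    also have "\<dots> = 2 * norm \<mu> * norm (S \<mu> x) * E * (exp (\<bar>Im \<mu>\<bar> * x) * exp (- \<bar>Im \<mu>\<bar> * x))"
      by (simp only: mult_ac)
    also have "exp (\<bar>Im \<mu>\<bar> * x) * exp (- \<bar>Im \<mu>\<bar> * x) = 1" by (simp flip: exp_add)
    finally have "exp (\<bar>Im \<mu>\<bar> * x) \<le> 4 * E * norm (S \<mu> x) * norm \<mu>" by (simp add: mult_ac)
    then show ?thesis using E m by (simp add: divide_le_eq mult_ac)
  qed
  have "\<exists>R\<ge>1. \<forall>\<mu>. R \<le> \<bar>Im \<mu>\<bar> \<longrightarrow> 1 / (4 * E) * exp (\<bar>Im \<mu>\<bar> * x) / norm \<mu> \<le> norm (S \<mu> x)"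
  proof (intro conjI exI[of _ "max R1 R2"] allI impI)
    fix \<mu> assume \<mu>: "max R1 R2 \<le> \<bar>Im \<mu>\<bar>"
    then have \<mu>1: "1 \<le> \<bar>Im \<mu>\<bar>" using R1(1) by linarith
    show "1 / (4 * E) * exp (\<bar>Im \<mu>\<bar> * x) / norm \<mu> \<le> norm (S \<mu> x)"
    proof (cases "0 \<le> Im \<mu>")
      case True
      have "1/2 \<le> norm (- 2 * \<i> * \<mu> * S \<mu> x * exp (\<i> * \<mu> * x - \<i> * Q))"
        using R1(2)[rule_format, of \<mu>] True \<mu> by (intro half) auto
      then have "1/2 \<le> 2 * norm \<mu> * norm (S \<mu> x) * exp (- Im \<mu> * x + Im Q)" by (simp add: norm_mult)
      moreover have "exp (- Im \<mu> * x + Im Q) \<le> exp (- \<bar>Im \<mu>\<bar> * x) * E"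
        using True by (simp add: E_def flip: exp_add)
      ultimately show ?thesis using \<mu>1 by (rule fin)
    next
      case False
      have "1/2 \<le> norm (2 * \<i> * \<mu> * S \<mu> x * exp (- \<i> * \<mu> * x + \<i> * Q))"
        using R2(2)[rule_format, of \<mu>] False \<mu> by (intro half) auto
      then have "1/2 \<le> 2 * norm \<mu> * norm (S \<mu> x) * exp (Im \<mu> * x - Im Q)" by (simp add: norm_mult)
      moreover have "exp (Im \<mu> * x - Im Q) \<le> exp (- \<bar>Im \<mu>\<bar> * x) * E"
        using False by (simp add: E_def flip: exp_add)
      ultimately show ?thesis using \<mu>1 by (rule fin)
    qed
  qed (use R1 in auto)
  moreover have "0 < 1 / (4 * E)" using E by simp
  ultimately show ?thesis by blast
qed

text \<open>
  At distance \<open>\<delta>\<close> from the end the solution is smaller by the factor \<open>exp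
  (- \<delta> \<bar>Im \<mu>\<bar>)\<close>, which compensates the constant of the functional there.
\<close>
lemma end_functional_leading_term:
  assumes co: "pencil_coeffs b p q" and fs: "fundamental_system b p q S S' C C'"
    and L: "end_functional b H L" and e: "0 < \<epsilon>"
  shows "\<exists>R\<ge>1. \<forall>\<mu>. R \<le> \<bar>Im \<mu>\<bar> \<longrightarrow> norm (L (S \<mu>) - H * S \<mu> b) \<le> \<epsilon> * (exp (\<bar>Im \<mu>\<bar> * b) / norm \<mu>)"
proof -
  define G where "G = 2 * growth_const b p q"
  have G: "0 < G" using growth_const_ge_1[OF co] by (simp add: G_def)
  have b: "0 < b" using pencil_coeffs_D(1)[OF co] .
  have "0 < \<epsilon> / (2 * G)" using e G by simp
  then obtain \<delta> K where \<delta>: "0 < \<delta>" and K: "0 \<le> K" and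
    LK: "\<forall>f M1 M2. continuous_on {0..b} f \<longrightarrow> (\<forall>x\<in>{0..b}. norm (f x) \<le> M1) \<longrightarrow>
        (\<forall>x\<in>{0..b - \<delta>}. norm (f x) \<le> M2) \<longrightarrow> norm (L f - H * f b) \<le> \<epsilon> / (2 * G) * M1 + K * M2"
    using L unfolding end_functional_def by blast
  obtain R where R: "1 \<le> R" "\<forall>\<tau>\<ge>R. K * G / \<tau> + K * G * exp (- \<delta> * \<tau>) \<le> \<epsilon> / 2"
    using eventually_small_damping[of "\<epsilon> / 2" \<delta> "K * G"] e \<delta> by auto
  show ?thesis
  proof (intro exI[of _ R] conjI allI impI R(1))
    fix \<mu> assume \<mu>: "R \<le> \<bar>Im \<mu>\<bar>"
    have \<mu>1: "1 \<le> norm \<mu>" using \<mu> R(1) abs_Im_le_cmod[of \<mu>] by linarith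
    have Sb: "norm (S \<mu> x) \<le> G * exp (\<bar>Im \<mu>\<bar> * y) / norm \<mu>" if "x \<in> {0..b}" "x \<le> y" for x y
    proof -
      have "\<bar>Im \<mu>\<bar> * x \<le> \<bar>Im \<mu>\<bar> * y" using that by (intro mult_left_mono) auto
      then have "G * exp (\<bar>Im \<mu>\<bar> * x) / norm \<mu> \<le> G * exp (\<bar>Im \<mu>\<bar> * y) / norm \<mu>"
        using G by (intro divide_right_mono mult_left_mono) auto
      then show ?thesis using sine_solution_bound(1)[OF co fs \<mu>1 that(1)] by (simp add: G_def)
    qed
    have "norm (L (S \<mu>) - H * S \<mu> b) \<le> \<epsilon> / (2 * G) * (G * exp (\<bar>Im \<mu>\<bar> * b) / norm \<mu>) + K * (G * exp (\<bar>Im \<mu>\<bar> * (b - \<delta>)) / norm \<mu>)"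
      using \<delta> by (intro LK[rule_format] fundamental_systemD(7)[OF fs] Sb) auto
    also have "exp (\<bar>Im \<mu>\<bar> * (b - \<delta>)) = exp (- \<delta> * \<bar>Im \<mu>\<bar>) * exp (\<bar>Im \<mu>\<bar> * b)"
      by (simp add: algebra_simps flip: exp_add)
    also have "\<epsilon> / (2 * G) * (G * exp (\<bar>Im \<mu>\<bar> * b) / norm \<mu>) + K * (G * (exp (- \<delta> * \<bar>Im \<mu>\<bar>) * exp (\<bar>Im \<mu>\<bar> * b)) / norm \<mu>)
       = (\<epsilon> / 2 + K * G * exp (- \<delta> * \<bar>Im \<mu>\<bar>)) * (exp (\<bar>Im \<mu>\<bar> * b) / norm \<mu>)"
      using G by (simp add: algebra_simps)
    also have "\<dots> \<le> \<epsilon> * (exp (\<bar>Im \<mu>\<bar> * b) / norm \<mu>)"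
    proof (rule mult_right_mono)
      have "0 \<le> K * G / \<bar>Im \<mu>\<bar>" using K G by simp
      then show "\<epsilon> / 2 + K * G * exp (- \<delta> * \<bar>Im \<mu>\<bar>) \<le> \<epsilon>" using R(2)[rule_format, OF \<mu>] by linarith
    qed simp
    finally show "norm (L (S \<mu>) - H * S \<mu> b) \<le> \<epsilon> * (exp (\<bar>Im \<mu>\<bar> * b) / norm \<mu>)" .
  qed
qed

lemma char_function_upper_bound:
  assumes co: "pencil_coeffs b p q" and fs: "fundamental_system b p q S S' C C'" and L: "bounded_functional b L"
  shows "\<exists>K\<ge>0. \<forall>\<mu>. 1 \<le> norm \<mu> \<longrightarrow> norm (L (S \<mu>)) \<le> K * exp (b * \<bar>Im \<mu>\<bar>) / norm \<mu>"
proof -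
  obtain K where K0: "0 \<le> K" and
    Kb: "\<forall>f M. continuous_on {0..b} f \<longrightarrow> (\<forall>x\<in>{0..b}. norm (f x) \<le> M) \<longrightarrow> norm (L f) \<le> K * M"
    using bounded_functional_bound[OF L] by blast
  define G where "G = 2 * growth_const b p q"
  have G: "0 < G" using growth_const_ge_1[OF co] by (simp add: G_def)
  show ?thesis
  proof (intro exI[of _ "K * G"] conjI allI impI)
    fix \<mu> :: complex assume \<mu>: "1 \<le> norm \<mu>"
    have "norm (L (S \<mu>)) \<le> K * (G * exp (\<bar>Im \<mu>\<bar> * b) / norm \<mu>)"
    proof (rule Kb[rule_format, OF fundamental_systemD(7)[OF fs]])
      show "norm (S \<mu> x) \<le> G * exp (\<bar>Im \<mu>\<bar> * b) / norm \<mu>" if x: "x \<in> {0..b}" for x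
      proof -
        have "\<bar>Im \<mu>\<bar> * x \<le> \<bar>Im \<mu>\<bar> * b" using x by (intro mult_left_mono) auto
        then have "G * exp (\<bar>Im \<mu>\<bar> * x) / norm \<mu> \<le> G * exp (\<bar>Im \<mu>\<bar> * b) / norm \<mu>"
          using G by (intro divide_right_mono mult_left_mono) auto
        then show ?thesis
          using sine_solution_bound(1)[OF co fs \<mu> x] by (simp add: G_def)
      qed
    qed
    then show "norm (L (S \<mu>)) \<le> K * G * exp (b * \<bar>Im \<mu>\<bar>) / norm \<mu>" by (simp add: mult_ac)
  qed (use K0 G in simp)
qed

lemma char_function_lower_bound:
  assumes co: "pencil_coeffs b p q" and fs: "fundamental_system b p q S S' C C'"
    and L: "end_functional b H L" and H: "H \<noteq> 0"
  shows "\<exists>c>0. \<exists>R\<ge>1. \<forall>\<mu>. R \<le> \<bar>Im \<mu>\<bar> \<longrightarrow> c * exp (b * \<bar>Im \<mu>\<bar>) / norm \<mu> \<le> norm (L (S \<mu>))"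
proof -
  have b: "0 < b" using pencil_coeffs_D(1)[OF co] .
  obtain c R1 where c: "0 < c" and R1: "1 \<le> R1" "\<forall>\<mu>. R1 \<le> \<bar>Im \<mu>\<bar> \<longrightarrow> c * exp (\<bar>Im \<mu>\<bar> * b) / norm \<mu> \<le> norm (S \<mu> b)"
    using sine_solution_lower_bound[OF co fs b order_refl] by blast
  define d where "d = norm H * c / 2"
  have d: "0 < d" using H c by (simp add: d_def)
  obtain R2 where R2: "1 \<le> R2" "\<forall>\<mu>. R2 \<le> \<bar>Im \<mu>\<bar> \<longrightarrow> norm (L (S \<mu>) - H * S \<mu> b) \<le> d * (exp (\<bar>Im \<mu>\<bar> * b) / norm \<mu>)"
    using end_functional_leading_term[OF co fs L d] by blast
  have "\<exists>R\<ge>1. \<forall>\<mu>. R \<le> \<bar>Im \<mu>\<bar> \<longrightarrow> d * exp (b * \<bar>Im \<mu>\<bar>) / norm \<mu> \<le> norm (L (S \<mu>))"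
  proof (intro exI[of _ "max R1 R2"] conjI allI impI)
    fix \<mu> assume \<mu>: "max R1 R2 \<le> \<bar>Im \<mu>\<bar>"
    define e where "e = exp (\<bar>Im \<mu>\<bar> * b) / norm \<mu>"
    have "norm H * (c * e) \<le> norm H * norm (S \<mu> b)"
      using R1(2)[rule_format, of \<mu>] \<mu> by (intro mult_left_mono) (auto simp: e_def)
    moreover have "norm (L (S \<mu>) - H * S \<mu> b) \<le> d * e"
      using R2(2)[rule_format, of \<mu>] \<mu> by (simp add: e_def)
    moreover have "norm H * norm (S \<mu> b) \<le> norm (L (S \<mu>)) + norm (L (S \<mu>) - H * S \<mu> b)"
      using norm_triangle_ineq4[of "L (S \<mu>)" "L (S \<mu>) - H * S \<mu> b"] by (simp add: norm_mult)
    moreover have "norm H * (c * e) = 2 * (d * e)" by (simp add: d_def)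
    ultimately have "d * e \<le> norm (L (S \<mu>))" by linarith
    then show "d * exp (b * \<bar>Im \<mu>\<bar>) / norm \<mu> \<le> norm (L (S \<mu>))" by (simp add: e_def mult_ac)
  qed (use R1 in auto)
  with d show ?thesis by blast
qed

lemma char_function_asymptotics:
  assumes co: "pencil_coeffs b p q" and fs: "fundamental_system b p q S S' C C'"
    and L: "end_functional b H L" and e: "0 < \<epsilon>"
  shows "\<exists>R\<ge>1. \<forall>\<mu>. R \<le> Im \<mu> \<longrightarrow> norm (- 2 * \<i> * \<mu> * L (S \<mu>) * exp (\<i> * \<mu> * b - \<i> * integral {0..b} p) - H) \<le> \<epsilon>"
proof -
  have b: "0 < b" using pencil_coeffs_D(1)[OF co] .
  define Q where "Q = integral {0..b} p"
  define e1 where "e1 = \<epsilon> / (2 * (norm H + 1))"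
  have e1: "0 < e1" using e by (simp add: e1_def add_nonneg_pos)
  define e2 where "e2 = \<epsilon> / (4 * exp (Im Q))"
  have e2: "0 < e2" using e by (simp add: e2_def)
  obtain R1 where R1: "1 \<le> R1" "\<forall>\<mu>. R1 \<le> Im \<mu> \<longrightarrow> norm (- 2 * \<i> * \<mu> * S \<mu> b * exp (\<i> * \<mu> * b - \<i> * Q) - 1) \<le> e1"
    using sine_solution_asymptotics_upper[OF co fs b order_refl e1] unfolding Q_def by blast
  obtain R2 where R2: "1 \<le> R2" "\<forall>\<mu>. R2 \<le> \<bar>Im \<mu>\<bar> \<longrightarrow> norm (L (S \<mu>) - H * S \<mu> b) \<le> e2 * (exp (\<bar>Im \<mu>\<bar> * b) / norm \<mu>)"
    using end_functional_leading_term[OF co fs L e2] by blast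
  show ?thesis
    unfolding Q_def[symmetric]
  proof (intro exI[of _ "max R1 R2"] conjI allI impI)
    fix \<mu> assume \<mu>: "max R1 R2 \<le> Im \<mu>"
    then have p: "0 < Im \<mu>" "0 < norm \<mu>" using R1 abs_Im_le_cmod[of \<mu>] by linarith+
    define g where "g = exp (\<i> * \<mu> * b - \<i> * Q)"
    have ng: "norm g = exp (- (Im \<mu> * b)) * exp (Im Q)" by (simp add: g_def flip: exp_add)
    have "- 2 * \<i> * \<mu> * L (S \<mu>) * g - H = H * (- 2 * \<i> * \<mu> * S \<mu> b * g - 1) + (- 2 * \<i> * \<mu> * g) * (L (S \<mu>) - H * S \<mu> b)"
      by (simp add: algebra_simps)
    also have "norm \<dots> \<le> norm H * norm (- 2 * \<i> * \<mu> * S \<mu> b * g - 1) + norm (- 2 * \<i> * \<mu> * g) * norm (L (S \<mu>) - H * S \<mu> b)"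
      by (rule order_trans[OF norm_triangle_ineq]) (simp add: norm_mult)
    also have "\<dots> \<le> norm H * e1 + norm (- 2 * \<i> * \<mu> * g) * (e2 * (exp (\<bar>Im \<mu>\<bar> * b) / norm \<mu>))"
      using R1(2)[rule_format, of \<mu>] R2(2)[rule_format, of \<mu>] \<mu> unfolding g_def
      by (intro add_mono mult_left_mono) auto
    also have "norm (- 2 * \<i> * \<mu> * g) * (e2 * (exp (\<bar>Im \<mu>\<bar> * b) / norm \<mu>)) = \<epsilon> / 2"
      using p by (simp add: norm_mult ng e2_def exp_minus)
    also have "norm H * e1 \<le> \<epsilon> / 2"
    proof -
      have "norm H / (norm H + 1) \<le> 1" by (simp add: add_nonneg_pos)
      then have "\<epsilon> / 2 * (norm H / (norm H + 1)) \<le> \<epsilon> / 2 * 1" using e by (intro mult_left_mono) auto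
      then show ?thesis by (simp add: e1_def mult.commute)
    qed
    finally show "norm (- 2 * \<i> * \<mu> * L (S \<mu>) * exp (\<i> * \<mu> * b - \<i> * Q) - H) \<le> \<epsilon>" by (simp add: g_def)
  qed (use R1 in auto)
qed

section \<open>Uniqueness on the half interval next to the initial point\<close>

lemma has_vector_derivative_unique_Icc:
  assumes "a < (b::real)" "x \<in> {a..b}"
    and "(f has_vector_derivative f') (at x within {a..b})" "(f has_vector_derivative f'') (at x within {a..b})"
  shows "f' = f''"
  using vector_derivative_unique_within_closed_interval[of a b x f f' f''] assms by simp

lemma pencil_pair_derivative:
  assumes "pencil_pair b p q \<mu> y z" "x \<in> {0..b}"
  shows "(y has_vector_derivative z x) (at x within {0..b})"
proof (rule has_vector_derivative_transform[OF assms(2)])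
  show "((\<lambda>x. y 0 + integral {0..x} z) has_vector_derivative z x) (at x within {0..b})"
    using integral_has_vector_derivative[OF pencil_pair_continuous(2)[OF assms(1)] assms(2)]
    by (auto intro!: derivative_eq_intros)
  show "y x = y 0 + integral {0..x} z" if "x \<in> {0..b}" for x
    using assms(1) that unfolding pencil_pair_def has_ac_density_def by blast
qed

text \<open>
  The functional annihilates the combination \<open>L(C) S - L(S) C\<close>. The value of this
  combination at \<open>x\<close> is \<open>L\<close> applied to the solution with value
  \<open>0\<close> and derivative \<open>-1\<close> at \<open>x\<close>, and its derivative at
  \<open>x\<close> is \<open>L\<close> applied to the solution with value \<open>1\<close> and
  derivative \<open>0\<close> there. These solutions grow with the distance from \<open>x\<close>,
  which is at most \<open>b - x\<close> because \<open>x\<close> lies in the left half.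
\<close>
lemma annihilated_solution_bound:
  assumes co: "pencil_coeffs b p q" and fs: "fundamental_system b p q S S' C C'" and L: "bounded_functional b L"
  shows "\<exists>K\<ge>0. \<forall>\<mu> x. 1 \<le> norm \<mu> \<longrightarrow> x \<in> {0..b/2} \<longrightarrow>
     norm (L (C \<mu>) * S \<mu> x - L (S \<mu>) * C \<mu> x) \<le> K * exp (\<bar>Im \<mu>\<bar> * (b - x)) / norm \<mu> \<and>
     norm (L (C \<mu>) * S' \<mu> x - L (S \<mu>) * C' \<mu> x) \<le> K * exp (\<bar>Im \<mu>\<bar> * (b - x))"
proof -
  obtain K where K0: "0 \<le> K" and
    Kb: "\<forall>f M. continuous_on {0..b} f \<longrightarrow> (\<forall>x\<in>{0..b}. norm (f x) \<le> M) \<longrightarrow> norm (L f) \<le> K * M"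
    using bounded_functional_bound[OF L] by blast
  define G where "G = 2 * growth_const b p q"
  have G: "0 < G" using growth_const_ge_1[OF co] by (simp add: G_def)
  have main: "norm (k1 * L (C \<mu>) - k2 * L (S \<mu>)) \<le> K * (G * exp (\<bar>Im \<mu>\<bar> * (b - x)) * E / norm \<mu>)"
    if \<mu>: "1 \<le> norm \<mu>" and x: "x \<in> {0..b/2}"
      and E: "norm \<mu> * norm (k1 * C \<mu> x - k2 * S \<mu> x) + norm (k1 * C' \<mu> x - k2 * S' \<mu> x) \<le> E" for \<mu> x k1 k2 E
  proof -
    note F = fundamental_systemD[OF fs, of \<mu>]
    have m0: "0 < norm \<mu>" using \<mu> by linarith
    have xb: "x \<in> {0..b}" using x by auto
    have "pencil_pair b p q \<mu> (\<lambda>t. k1 * C \<mu> t + (- k2) * S \<mu> t) (\<lambda>t. k1 * C' \<mu> t + (- k2) * S' \<mu> t)"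
      by (rule pencil_pair_lincomb[OF F(2,1)])
    then have pp: "pencil_pair b p q \<mu> (\<lambda>t. k1 * C \<mu> t - k2 * S \<mu> t) (\<lambda>t. k1 * C' \<mu> t - k2 * S' \<mu> t)" by simp
    have "L (\<lambda>t. k1 * C \<mu> t - k2 * S \<mu> t) = k1 * L (C \<mu>) - k2 * L (S \<mu>)"
      using F(7,9) by (subst bounded_functionalD(3)[OF L]) (auto simp: bounded_functionalD(2)[OF L] intro!: continuous_intros)
    moreover have "norm (L (\<lambda>t. k1 * C \<mu> t - k2 * S \<mu> t)) \<le> K * (G * exp (\<bar>Im \<mu>\<bar> * (b - x)) * E / norm \<mu>)"
    proof (rule Kb[rule_format, OF pencil_pair_continuous(1)[OF pp]])
      fix t assume t: "t \<in> {0..b}"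
      let ?N = "norm \<mu> * norm (k1 * C \<mu> t - k2 * S \<mu> t)"
      have "?N \<le> ?N + norm (k1 * C' \<mu> t - k2 * S' \<mu> t)" by simp
      also have "\<dots> \<le> G * exp (\<bar>Im \<mu>\<bar> * \<bar>t - x\<bar>) * (norm \<mu> * norm (k1 * C \<mu> x - k2 * S \<mu> x) + norm (k1 * C' \<mu> x - k2 * S' \<mu> x))"
        unfolding G_def by (rule pencil_growth[OF co pp \<mu> t xb])
      also have "\<dots> \<le> G * exp (\<bar>Im \<mu>\<bar> * (b - x)) * E"
      proof (intro mult_mono E)
        have "\<bar>t - x\<bar> \<le> b - x" using t x by auto
        then show "exp (\<bar>Im \<mu>\<bar> * \<bar>t - x\<bar>) \<le> exp (\<bar>Im \<mu>\<bar> * (b - x))" by (simp add: mult_left_mono)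
      qed (use G in auto)
      finally have "?N \<le> G * exp (\<bar>Im \<mu>\<bar> * (b - x)) * E" .
      then show "norm (k1 * C \<mu> t - k2 * S \<mu> t) \<le> G * exp (\<bar>Im \<mu>\<bar> * (b - x)) * E / norm \<mu>"
        using m0 by (simp only: pos_le_divide_eq mult.commute[of "norm \<mu>"])
    qed
    ultimately show ?thesis by simp
  qed
  show ?thesis
  proof (intro exI[of _ "K * G"] conjI allI impI)
    fix \<mu> :: complex and x :: real assume \<mu>: "1 \<le> norm \<mu>" and x: "x \<in> {0..b/2}"
    have m0: "norm \<mu> \<noteq> 0" using \<mu> by linarith
    have W: "C \<mu> x * S' \<mu> x - C' \<mu> x * S \<mu> x = 1" using x by (intro fundamental_system_wronskian[OF fs]) auto
    have "norm (S \<mu> x * L (C \<mu>) - C \<mu> x * L (S \<mu>)) \<le> K * (G * exp (\<bar>Im \<mu>\<bar> * (b - x)) * 1 / norm \<mu>)"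
    proof (rule main[OF \<mu> x])
      have "S \<mu> x * C' \<mu> x - C \<mu> x * S' \<mu> x = - 1" using W by (simp add: algebra_simps)
      then show "norm \<mu> * norm (S \<mu> x * C \<mu> x - C \<mu> x * S \<mu> x) + norm (S \<mu> x * C' \<mu> x - C \<mu> x * S' \<mu> x) \<le> 1"
        by (simp add: mult.commute)
    qed
    then show "norm (L (C \<mu>) * S \<mu> x - L (S \<mu>) * C \<mu> x) \<le> K * G * exp (\<bar>Im \<mu>\<bar> * (b - x)) / norm \<mu>"
      by (simp add: mult_ac)
    have "norm (S' \<mu> x * L (C \<mu>) - C' \<mu> x * L (S \<mu>)) \<le> K * (G * exp (\<bar>Im \<mu>\<bar> * (b - x)) * norm \<mu> / norm \<mu>)"
    proof (rule main[OF \<mu> x])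
      have "S' \<mu> x * C \<mu> x - C' \<mu> x * S \<mu> x = 1" using W by (simp add: algebra_simps)
      then show "norm \<mu> * norm (S' \<mu> x * C \<mu> x - C' \<mu> x * S \<mu> x) + norm (S' \<mu> x * C' \<mu> x - C' \<mu> x * S' \<mu> x) \<le> norm \<mu>"
        by (simp add: mult.commute)
    qed
    then show "norm (L (C \<mu>) * S' \<mu> x - L (S \<mu>) * C' \<mu> x) \<le> K * G * exp (\<bar>Im \<mu>\<bar> * (b - x))"
      using m0 by (simp add: mult_ac)
  qed (use K0 G in simp)
qed

text \<open>
  The functions \<open>f\<close> and \<open>g\<close> are the coefficients in \<open>S = f St + g
  St'\<close> at the point \<open>x\<close> for which the same relation holds between the
  combinations that \<open>L\<close> annihilates in the two systems; the term with \<open>h\<close>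
  accounts for the difference of these combinations. By Cramer's rule, multiplied by
  \<open>L(S)\<close> they are sums of products of a sine-type solution, of growth \<open>exp
  (\<bar>Im \<mu>\<bar> x)\<close>, and an annihilated one, of growth \<open>exp (\<bar>Im
  \<mu>\<bar> (b - x))\<close>. Together this is the growth of \<open>L(S)\<close>, so
  \<open>f\<close> and \<open>g\<close> are bounded, hence constant; \<open>g\<close> also decays
  along the imaginary axis, hence vanishes.
\<close>
lemma transition_matrix_constant:
  assumes co: "pencil_coeffs b p q" "pencil_coeffs b pt qt"
    and fs: "fundamental_system b p q S S' C C'" and ft: "fundamental_system b pt qt St St' Ct Ct'"
    and L: "end_functional b H L" and H: "H \<noteq> 0" and h: "h holomorphic_on UNIV"
    and LS: "\<And>\<mu>. L (S \<mu>) = L (St \<mu>)" and LC: "\<And>\<mu>. L (Ct \<mu>) - L (C \<mu>) = h \<mu> * L (S \<mu>)"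
    and x: "x \<in> {0..b/2}"
  shows "\<exists>A. \<forall>\<mu>. S \<mu> x = A * St \<mu> x" "\<And>\<mu>. S \<mu> x * Ct \<mu> x - C \<mu> x * St \<mu> x - h \<mu> * S \<mu> x * St \<mu> x = 0"
proof -
  have b: "0 < b" and xb: "x \<in> {0..b}" using pencil_coeffs_D(1)[OF co(1)] x by auto
  have Lb: "bounded_functional b L" using L by (simp add: end_functional_def)
  define f where "f \<mu> = h \<mu> * S \<mu> x * St' \<mu> x + C \<mu> x * St' \<mu> x - S \<mu> x * Ct' \<mu> x" for \<mu>
  define g where "g \<mu> = S \<mu> x * Ct \<mu> x - C \<mu> x * St \<mu> x - h \<mu> * S \<mu> x * St \<mu> x" for \<mu>
  define \<Delta> where "\<Delta> \<mu> = L (S \<mu>)" for \<mu>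
  note WE = fundamental_system_weakly_entire[OF co(1) fs] fundamental_system_weakly_entire[OF co(2) ft]
  note EV = WE[THEN weakly_entire_eval[OF _ xb]]
  have fh: "f holomorphic_on UNIV" and gh: "g holomorphic_on UNIV"
    unfolding f_def g_def by (intro holomorphic_intros h EV)+
  have \<Delta>h: "\<Delta> holomorphic_on UNIV" unfolding \<Delta>_def by (rule weakly_entire_functional[OF WE(1) Lb])
  define \<theta> where "\<theta> \<mu> = L (C \<mu>) * S \<mu> x - L (S \<mu>) * C \<mu> x" for \<mu>
  define \<theta>' where "\<theta>' \<mu> = L (C \<mu>) * S' \<mu> x - L (S \<mu>) * C' \<mu> x" for \<mu>
  define \<theta>t where "\<theta>t \<mu> = L (Ct \<mu>) * St \<mu> x - L (St \<mu>) * Ct \<mu> x" for \<mu>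
  define \<theta>t' where "\<theta>t' \<mu> = L (Ct \<mu>) * St' \<mu> x - L (St \<mu>) * Ct' \<mu> x" for \<mu>
  have LC': "L (Ct \<mu>) = L (C \<mu>) + h \<mu> * \<Delta> \<mu>" for \<mu> using LC[of \<mu>] by (simp add: \<Delta>_def algebra_simps)
  have fD: "f \<mu> * \<Delta> \<mu> = S \<mu> x * \<theta>t' \<mu> - \<theta> \<mu> * St' \<mu> x" for \<mu>
    unfolding \<theta>_def \<theta>t'_def LC' LS[symmetric] f_def unfolding \<Delta>_def by (simp add: algebra_simps)
  have gD: "g \<mu> * \<Delta> \<mu> = \<theta> \<mu> * St \<mu> x - S \<mu> x * \<theta>t \<mu>" for \<mu>
    unfolding \<theta>_def \<theta>t_def LC' LS[symmetric] g_def unfolding \<Delta>_def by (simp add: algebra_simps)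
  obtain K1 where K1: "0 \<le> K1" "\<forall>\<mu> x. 1 \<le> norm \<mu> \<longrightarrow> x \<in> {0..b/2} \<longrightarrow>
     norm (L (C \<mu>) * S \<mu> x - L (S \<mu>) * C \<mu> x) \<le> K1 * exp (\<bar>Im \<mu>\<bar> * (b - x)) / norm \<mu> \<and>
     norm (L (C \<mu>) * S' \<mu> x - L (S \<mu>) * C' \<mu> x) \<le> K1 * exp (\<bar>Im \<mu>\<bar> * (b - x))"
    using annihilated_solution_bound[OF co(1) fs Lb] by blast
  obtain K2 where K2: "0 \<le> K2" "\<forall>\<mu> x. 1 \<le> norm \<mu> \<longrightarrow> x \<in> {0..b/2} \<longrightarrow>
     norm (L (Ct \<mu>) * St \<mu> x - L (St \<mu>) * Ct \<mu> x) \<le> K2 * exp (\<bar>Im \<mu>\<bar> * (b - x)) / norm \<mu> \<and>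
     norm (L (Ct \<mu>) * St' \<mu> x - L (St \<mu>) * Ct' \<mu> x) \<le> K2 * exp (\<bar>Im \<mu>\<bar> * (b - x))"
    using annihilated_solution_bound[OF co(2) ft Lb] by blast
  obtain K3 where K3: "0 \<le> K3" "\<forall>\<mu>. 1 \<le> norm \<mu> \<longrightarrow> norm (L (S \<mu>)) \<le> K3 * exp (b * \<bar>Im \<mu>\<bar>) / norm \<mu>"
    using char_function_upper_bound[OF co(1) fs Lb] by blast
  obtain c R where c: "0 < c" and R: "1 \<le> R" "\<forall>\<mu>. R \<le> \<bar>Im \<mu>\<bar> \<longrightarrow> c * exp (b * \<bar>Im \<mu>\<bar>) / norm \<mu> \<le> norm (L (S \<mu>))"
    using char_function_lower_bound[OF co(1) fs L H] by blast
  define G where "G = 2 * growth_const b p q"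
  define Gt where "Gt = 2 * growth_const b pt qt"
  have G: "0 < G" "0 < Gt" using growth_const_ge_1[OF co(1)] growth_const_ge_1[OF co(2)] by (simp_all add: G_def Gt_def)
  define K where "K = max K3 (G * K2 + K1 * Gt)"
  have K: "K3 \<le> K" "G * K2 + K1 * Gt \<le> K" by (simp_all add: K_def)
  have e: "exp (\<bar>Im \<mu>\<bar> * x) * exp (\<bar>Im \<mu>\<bar> * (b - x)) = exp (b * \<bar>Im \<mu>\<bar>)" for \<mu>
    by (simp add: algebra_simps flip: exp_add)
  have fbd: "norm (f \<mu> * \<Delta> \<mu>) \<le> K * exp (b * \<bar>Im \<mu>\<bar>) / norm \<mu>" if \<mu>: "1 \<le> norm \<mu>" for \<mu>
  proof -
    have "norm (f \<mu> * \<Delta> \<mu>) \<le> norm (S \<mu> x) * norm (\<theta>t' \<mu>) + norm (\<theta> \<mu>) * norm (St' \<mu> x)"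
      unfolding fD by (rule order_trans[OF norm_triangle_ineq4]) (simp add: norm_mult)
    also have "\<dots> \<le> (G * exp (\<bar>Im \<mu>\<bar> * x) / norm \<mu>) * (K2 * exp (\<bar>Im \<mu>\<bar> * (b - x))) +
        (K1 * exp (\<bar>Im \<mu>\<bar> * (b - x)) / norm \<mu>) * (Gt * exp (\<bar>Im \<mu>\<bar> * x))"
      unfolding G_def Gt_def \<theta>_def \<theta>t'_def using K1(1) K2(1)
      by (intro add_mono mult_mono sine_solution_bound[OF co(1) fs \<mu> xb] sine_solution_bound[OF co(2) ft \<mu> xb]
          K1(2)[rule_format, OF \<mu> x, THEN conjunct1] K2(2)[rule_format, OF \<mu> x, THEN conjunct2])
         (use growth_const_ge_1[OF co(1)] in auto)
    also have "\<dots> = (G * K2 + K1 * Gt) * (exp (\<bar>Im \<mu>\<bar> * x) * exp (\<bar>Im \<mu>\<bar> * (b - x))) / norm \<mu>"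
      by (simp add: algebra_simps add_divide_distrib)
    also have "\<dots> = (G * K2 + K1 * Gt) * exp (b * \<bar>Im \<mu>\<bar>) / norm \<mu>" unfolding e ..
    also have "\<dots> \<le> K * exp (b * \<bar>Im \<mu>\<bar>) / norm \<mu>" using K by (intro divide_right_mono mult_right_mono) auto
    finally show ?thesis .
  qed
  have gbd: "norm (g \<mu> * \<Delta> \<mu>) \<le> (K * exp (b * \<bar>Im \<mu>\<bar>) / norm \<mu>) / norm \<mu>" if \<mu>: "1 \<le> norm \<mu>" for \<mu>
  proof -
    have "norm (g \<mu> * \<Delta> \<mu>) \<le> norm (S \<mu> x) * norm (\<theta>t \<mu>) + norm (\<theta> \<mu>) * norm (St \<mu> x)"
      unfolding gD by (rule order_trans[OF norm_triangle_ineq4]) (simp add: norm_mult)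
    also have "\<dots> \<le> (G * exp (\<bar>Im \<mu>\<bar> * x) / norm \<mu>) * (K2 * exp (\<bar>Im \<mu>\<bar> * (b - x)) / norm \<mu>) +
        (K1 * exp (\<bar>Im \<mu>\<bar> * (b - x)) / norm \<mu>) * (Gt * exp (\<bar>Im \<mu>\<bar> * x) / norm \<mu>)"
      unfolding G_def Gt_def \<theta>_def \<theta>t_def using K1(1) K2(1)
      by (intro add_mono mult_mono sine_solution_bound[OF co(1) fs \<mu> xb] sine_solution_bound[OF co(2) ft \<mu> xb]
          K1(2)[rule_format, OF \<mu> x, THEN conjunct1] K2(2)[rule_format, OF \<mu> x, THEN conjunct1])
         (use growth_const_ge_1[OF co(1)] in auto)
    also have "\<dots> = ((G * K2 + K1 * Gt) * (exp (\<bar>Im \<mu>\<bar> * x) * exp (\<bar>Im \<mu>\<bar> * (b - x))) / norm \<mu>) / norm \<mu>"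
      by (simp add: algebra_simps add_divide_distrib)
    also have "\<dots> = ((G * K2 + K1 * Gt) * exp (b * \<bar>Im \<mu>\<bar>) / norm \<mu>) / norm \<mu>" unfolding e ..
    also have "\<dots> \<le> (K * exp (b * \<bar>Im \<mu>\<bar>) / norm \<mu>) / norm \<mu>" using K by (intro divide_right_mono mult_right_mono) auto
    finally show ?thesis .
  qed
  have Dbd: "norm (\<Delta> \<mu>) \<le> K * exp (b * \<bar>Im \<mu>\<bar>) / norm \<mu>" if \<mu>: "1 \<le> norm \<mu>" for \<mu>
  proof -
    have "K3 * exp (b * \<bar>Im \<mu>\<bar>) / norm \<mu> \<le> K * exp (b * \<bar>Im \<mu>\<bar>) / norm \<mu>"
      using K by (intro divide_right_mono mult_right_mono) auto
    then show ?thesis using K3(2)[rule_format, OF \<mu>] by (simp add: \<Delta>_def)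
  qed
  have low: "c * exp (b * \<bar>Im \<mu>\<bar>) / norm \<mu> \<le> norm (\<Delta> \<mu>)" if "R \<le> \<bar>Im \<mu>\<bar>" for \<mu>
    using R(2) that by (simp add: \<Delta>_def)
  have "\<exists>C. \<forall>z. f z = C"
    by (rule entire_quotient_constant[OF fh \<Delta>h _ Dbd fbd c low]) (use b in auto)
  then obtain A where A: "\<And>\<mu>. f \<mu> = A" by blast
  have gbd': "norm (g \<mu> * \<Delta> \<mu>) \<le> K * exp (b * \<bar>Im \<mu>\<bar>) / norm \<mu>" if \<mu>: "1 \<le> norm \<mu>" for \<mu>
  proof -
    have K0: "0 \<le> K * exp (b * \<bar>Im \<mu>\<bar>) / norm \<mu>" using K3(1) K(1) by simp
    have "(K * exp (b * \<bar>Im \<mu>\<bar>) / norm \<mu>) / norm \<mu> \<le> (K * exp (b * \<bar>Im \<mu>\<bar>) / norm \<mu>) / 1"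
      using \<mu> by (intro divide_left_mono K0) auto
    then show ?thesis using gbd[OF \<mu>] by simp
  qed
  have "\<exists>C. \<forall>z. g z = C"
    by (rule entire_quotient_constant[OF gh \<Delta>h _ Dbd gbd' c low]) (use b in auto)
  then obtain B where B: "\<And>\<mu>. g \<mu> = B" by blast
  have "norm B * c \<le> K / R'" if R': "R \<le> R'" for R'
  proof -
    define \<mu> where "\<mu> = Complex 0 R'"
    have \<mu>: "Im \<mu> = R'" "norm \<mu> = R'" "1 \<le> R'" using R' R(1) by (auto simp: \<mu>_def cmod_def)
    have "norm B * (c * exp (b * \<bar>Im \<mu>\<bar>) / norm \<mu>) \<le> norm B * norm (\<Delta> \<mu>)"
      using low[of \<mu>] \<mu> R' by (intro mult_left_mono) auto
    also have "\<dots> \<le> (K * exp (b * \<bar>Im \<mu>\<bar>) / norm \<mu>) / norm \<mu>"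
      using gbd[of \<mu>] \<mu> by (simp add: B norm_mult)
    finally show ?thesis using \<mu> by (simp add: field_simps)
  qed
  then have "\<forall>\<^sub>F r in at_top. norm B * c \<le> K / r" by (rule eventually_at_top_linorderI)
  moreover have "((\<lambda>r::real. K / r) \<longlongrightarrow> 0) at_top"
    by (rule real_tendsto_divide_at_top[OF tendsto_const filterlim_ident])
  ultimately have "norm B * c \<le> 0"
    by (intro tendsto_lowerbound[OF _ _ trivial_limit_at_top_linorder])
  then have B0: "B = 0" using c by (metis mult_le_0_iff norm_le_zero_iff not_less)
  then show "S \<mu> x * Ct \<mu> x - C \<mu> x * St \<mu> x - h \<mu> * S \<mu> x * St \<mu> x = 0" for \<mu>
    using B[of \<mu>] by (simp add: g_def)
  show "\<exists>A. \<forall>\<mu>. S \<mu> x = A * St \<mu> x"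
  proof (intro exI[of _ A] allI)
    fix \<mu>
    \<comment> \<open>By this Wronskian the definitions of \<open>f\<close> and \<open>g\<close> give \<open>S = f St + g St'\<close>.\<close>
    have W: "Ct \<mu> x * St' \<mu> x - Ct' \<mu> x * St \<mu> x = 1" by (rule fundamental_system_wronskian[OF ft xb])
    have "S \<mu> x = S \<mu> x * (Ct \<mu> x * St' \<mu> x - Ct' \<mu> x * St \<mu> x)" unfolding W by simp
    also have "\<dots> = f \<mu> * St \<mu> x + g \<mu> * St' \<mu> x" by (simp add: f_def g_def algebra_simps)
    also have "\<dots> = A * St \<mu> x" using A[of \<mu>] B[of \<mu>] B0 by simp
    finally show "S \<mu> x = A * St \<mu> x" .
  qed
qed

text \<open>Identifies the constant ratio of two functions that have the same nonzero limit.\<close>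
lemma eq_1_if_scaled_limits:
  fixes k :: complex
  assumes "\<And>\<epsilon>. 0 < \<epsilon> \<Longrightarrow> \<exists>w v. norm (w - H) \<le> \<epsilon> \<and> norm (v - H) \<le> \<epsilon> \<and> w = k * v" and H: "H \<noteq> 0"
  shows "k = 1"
proof -
  have "norm ((k - 1) * H) \<le> 0 + e" if e: "0 < e" for e
  proof -
    define d where "d = e / (norm k + 1)"
    have kp: "0 < norm k + 1" by (simp add: add_nonneg_pos)
    have d: "0 < d" using e kp by (simp add: d_def)
    obtain w v where w: "norm (w - H) \<le> d" "norm (v - H) \<le> d" "w = k * v" using assms(1)[OF d] by blast
    have "(k - 1) * H = (w - H) - k * (v - H)" using w(3) by (simp add: algebra_simps)
    also have "norm \<dots> \<le> norm (w - H) + norm k * norm (v - H)"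
      by (rule order_trans[OF norm_triangle_ineq4]) (simp add: norm_mult)
    also have "\<dots> \<le> d + norm k * d" using w by (intro add_mono mult_left_mono) auto
    also have "\<dots> = d * (norm k + 1)" by (simp add: algebra_simps)
    also have "\<dots> = e" using kp by (simp add: d_def)
    finally show ?thesis by simp
  qed
  then have "norm ((k - 1) * H) \<le> 0" by (rule field_le_epsilon)
  then show ?thesis using H by simp
qed

text \<open>
  Comparing the asymptotics along the two imaginary half axes, the inverse of the factor
  \<open>A\<close> equals both \<open>exp (\<i> D)\<close> and \<open>exp (- \<i> D)\<close>, where
  \<open>D\<close> is the integral of \<open>pt - p\<close>. Hence \<open>exp (2 \<i> D) = 1\<close>
  on the whole interval, and differentiation gives the claim.
\<close>
lemma proportional_sine_solutions_imp_eq_p: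
  assumes co: "pencil_coeffs b p q" "pencil_coeffs b pt qt"
    and fs: "fundamental_system b p q S S' C C'" and ft: "fundamental_system b pt qt St St' Ct Ct'"
    and c: "0 < c" "c \<le> b" and pr: "\<forall>x\<in>{0..c}. \<exists>A. \<forall>\<mu>. S \<mu> x = A * St \<mu> x"
  shows "\<And>x. x \<in> {0..c} \<Longrightarrow> p x = pt x" "\<And>\<mu> x. x \<in> {0..c} \<Longrightarrow> S \<mu> x = St \<mu> x"
proof -
  define D where "D x = integral {0..x} pt - integral {0..x} p" for x
  have AD: "\<exists>A. (\<forall>\<mu>. S \<mu> x = A * St \<mu> x) \<and> A * exp (\<i> * D x) = 1 \<and> A * exp (- \<i> * D x) = 1"
    if x: "0 < x" "x \<le> c" for x
  proof -
    have xb: "x \<le> b" using x c by simp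
    obtain A where A: "\<forall>\<mu>. S \<mu> x = A * St \<mu> x" using bspec[OF pr, of x] x by auto
    have "A * exp (\<i> * D x) = 1"
    proof (rule eq_1_if_scaled_limits[of 1])
      fix e :: real assume e: "0 < e"
      obtain R1 where R1: "\<forall>\<mu>. R1 \<le> Im \<mu> \<longrightarrow> norm (- 2 * \<i> * \<mu> * S \<mu> x * exp (\<i> * \<mu> * x - \<i> * integral {0..x} p) - 1) \<le> e"
        using sine_solution_asymptotics_upper[OF co(1) fs x(1) xb e] by blast
      obtain R2 where R2: "\<forall>\<mu>. R2 \<le> Im \<mu> \<longrightarrow> norm (- 2 * \<i> * \<mu> * St \<mu> x * exp (\<i> * \<mu> * x - \<i> * integral {0..x} pt) - 1) \<le> e"
        using sine_solution_asymptotics_upper[OF co(2) ft x(1) xb e] by blast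
      define \<mu> where "\<mu> = Complex 0 (max R1 R2)"
      have "exp (\<i> * \<mu> * x - \<i> * integral {0..x} p) = exp (\<i> * D x) * exp (\<i> * \<mu> * x - \<i> * integral {0..x} pt)"
        by (simp add: D_def algebra_simps flip: exp_add)
      then have "- 2 * \<i> * \<mu> * S \<mu> x * exp (\<i> * \<mu> * x - \<i> * integral {0..x} p) =
          A * exp (\<i> * D x) * (- 2 * \<i> * \<mu> * St \<mu> x * exp (\<i> * \<mu> * x - \<i> * integral {0..x} pt))"
        by (simp add: A[rule_format, of \<mu>] mult_ac)
      moreover have "norm (- 2 * \<i> * \<mu> * S \<mu> x * exp (\<i> * \<mu> * x - \<i> * integral {0..x} p) - 1) \<le> e"
        "norm (- 2 * \<i> * \<mu> * St \<mu> x * exp (\<i> * \<mu> * x - \<i> * integral {0..x} pt) - 1) \<le> e"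
        by (intro R1[rule_format] R2[rule_format]; simp add: \<mu>_def)+
      ultimately show "\<exists>w v. norm (w - 1) \<le> e \<and> norm (v - 1) \<le> e \<and> w = A * exp (\<i> * D x) * v" by blast
    qed simp
    moreover have "A * exp (- \<i> * D x) = 1"
    proof (rule eq_1_if_scaled_limits[of 1])
      fix e :: real assume e: "0 < e"
      obtain R1 where R1: "\<forall>\<mu>. Im \<mu> \<le> - R1 \<longrightarrow> norm (2 * \<i> * \<mu> * S \<mu> x * exp (- \<i> * \<mu> * x + \<i> * integral {0..x} p) - 1) \<le> e"
        using sine_solution_asymptotics_lower[OF co(1) fs x(1) xb e] by blast
      obtain R2 where R2: "\<forall>\<mu>. Im \<mu> \<le> - R2 \<longrightarrow> norm (2 * \<i> * \<mu> * St \<mu> x * exp (- \<i> * \<mu> * x + \<i> * integral {0..x} pt) - 1) \<le> e"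
        using sine_solution_asymptotics_lower[OF co(2) ft x(1) xb e] by blast
      define \<mu> where "\<mu> = Complex 0 (- max R1 R2)"
      have "exp (- \<i> * \<mu> * x + \<i> * integral {0..x} p) = exp (- \<i> * D x) * exp (- \<i> * \<mu> * x + \<i> * integral {0..x} pt)"
        by (simp add: D_def algebra_simps flip: exp_add)
      then have "2 * \<i> * \<mu> * S \<mu> x * exp (- \<i> * \<mu> * x + \<i> * integral {0..x} p) =
          A * exp (- \<i> * D x) * (2 * \<i> * \<mu> * St \<mu> x * exp (- \<i> * \<mu> * x + \<i> * integral {0..x} pt))"
        by (simp add: A[rule_format, of \<mu>] mult_ac)
      moreover have "norm (2 * \<i> * \<mu> * S \<mu> x * exp (- \<i> * \<mu> * x + \<i> * integral {0..x} p) - 1) \<le> e"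
        "norm (2 * \<i> * \<mu> * St \<mu> x * exp (- \<i> * \<mu> * x + \<i> * integral {0..x} pt) - 1) \<le> e"
        by (intro R1[rule_format] R2[rule_format]; simp add: \<mu>_def)+
      ultimately show "\<exists>w v. norm (w - 1) \<le> e \<and> norm (v - 1) \<le> e \<and> w = A * exp (- \<i> * D x) * v" by blast
    qed simp
    ultimately show ?thesis using A by blast
  qed
  have E1: "exp (2 * \<i> * D x) = 1" if x: "x \<in> {0..c}" for x
  proof (cases "x = 0")
    case False
    then obtain A where A: "A * exp (\<i> * D x) = 1" "A * exp (- \<i> * D x) = 1" using AD[of x] x by auto
    have "exp (2 * \<i> * D x) = exp (\<i> * D x) * exp (\<i> * D x)" by (simp add: mult.assoc flip: exp_add)
    also have "exp (\<i> * D x) = exp (- \<i> * D x)" using A by (metis mult_cancel_left mult_zero_left zero_neq_one)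
    also have "exp (- \<i> * D x) * exp (- \<i> * D x) = exp (- \<i> * D x) * exp (\<i> * D x)"
      using A by (metis mult_cancel_left mult_zero_left zero_neq_one)
    also have "\<dots> = 1" by (simp flip: exp_add)
    finally show ?thesis .
  qed (simp add: D_def)
  have cont: "continuous_on {0..c} p" "continuous_on {0..c} pt"
    using pencil_coeffs_D(2)[OF co(1)] pencil_coeffs_D(2)[OF co(2)] c by (auto intro: continuous_on_subset)
  show peq: "p x = pt x" if x: "x \<in> {0..c}" for x
  proof -
    have Dd: "(D has_vector_derivative (pt x - p x)) (at x within {0..c})"
      unfolding D_def using integral_has_vector_derivative[OF cont(1) x] integral_has_vector_derivative[OF cont(2) x]
      by (rule has_vector_derivative_diff[rotated])
    have "((\<lambda>x. 2 * \<i> * D x) has_vector_derivative 2 * \<i> * (pt x - p x)) (at x within {0..c})"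
      by (rule has_vector_derivative_mult_right[OF Dd])
    from field_vector_diff_chain_within[OF this, of exp "exp (2 * \<i> * D x)"]
    have "((\<lambda>x. exp (2 * \<i> * D x)) has_vector_derivative 2 * \<i> * (pt x - p x) * exp (2 * \<i> * D x)) (at x within {0..c})"
      by (simp add: o_def DERIV_exp has_field_derivative_at_within)
    moreover have "((\<lambda>x. exp (2 * \<i> * D x)) has_vector_derivative 0) (at x within {0..c})"
      by (rule has_vector_derivative_transform[OF x, where f="\<lambda>_. 1"]) (auto simp: E1)
    ultimately have "2 * \<i> * (pt x - p x) * exp (2 * \<i> * D x) = 0"
      by (rule has_vector_derivative_unique_Icc[OF c(1) x])
    then show ?thesis by simp
  qed
  have D0: "D x = 0" if "x \<in> {0..c}" for x
  proof -
    have "integral {0..x} p = integral {0..x} pt" using that by (intro integral_cong peq) auto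
    then show ?thesis by (simp add: D_def)
  qed
  show "S \<mu> x = St \<mu> x" if x: "x \<in> {0..c}" for \<mu> x
  proof (cases "x = 0")
    case True then show ?thesis using fundamental_systemD(3)[OF fs] fundamental_systemD(3)[OF ft] by simp
  next
    case False
    then obtain A where "\<forall>\<mu>. S \<mu> x = A * St \<mu> x" "A * exp (\<i> * D x) = 1" using AD[of x] x by auto
    then show ?thesis using D0[OF x] by simp
  qed
qed

text \<open>
  Subtracting the two equations gives \<open>(q - qt) S = 0\<close> almost everywhere, with an
  exceptional set that depends on the spectral parameter. Countably many parameters suffice: at each
  point \<open>x > 0\<close> the solution for some parameter \<open>\<i> n\<close> is nonzero by the
  lower bound.
\<close>
lemma equal_sine_solutions_imp_eq_q:
  assumes co: "pencil_coeffs b p q" "pencil_coeffs b pt qt"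
    and fs: "fundamental_system b p q S S' C C'" and ft: "fundamental_system b pt qt St St' Ct Ct'"
    and c: "0 < c" "c \<le> b" and peq: "\<forall>x\<in>{0..c}. p x = pt x"
    and Seq: "\<forall>\<mu>. \<forall>x\<in>{0..c}. S \<mu> x = St \<mu> x"
  shows "negligible {x \<in> {0..c}. q x \<noteq> qt x}" "\<And>\<mu> x. x \<in> {0..c} \<Longrightarrow> S' \<mu> x = St' \<mu> x"
    "\<And>\<mu> x. x \<in> {0..c} \<Longrightarrow> C \<mu> x = Ct \<mu> x" "\<And>\<mu> x. x \<in> {0..c} \<Longrightarrow> C' \<mu> x = Ct' \<mu> x"
proof -
  note F = fundamental_systemD[OF fs] and Ft = fundamental_systemD[OF ft]
  note r = pencil_pair_restrict[OF F(1) c(2)] pencil_pair_restrict[OF Ft(1) c(2)]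
    pencil_pair_restrict[OF F(2) c(2)] pencil_pair_restrict[OF Ft(2) c(2)]
  show S'eq: "S' \<mu> x = St' \<mu> x" if x: "x \<in> {0..c}" for \<mu> x
  proof -
    have "(St \<mu> has_vector_derivative S' \<mu> x) (at x within {0..c})"
      by (rule has_vector_derivative_transform[OF x _ pencil_pair_derivative[OF r(1) x]]) (simp add: Seq)
    then show ?thesis
      using pencil_pair_derivative[OF r(2) x] by (rule has_vector_derivative_unique_Icc[OF c(1) x])
  qed
  have n1: "negligible {x \<in> {0..c}. (q x - qt x) * S \<mu> x \<noteq> 0}" for \<mu>
  proof -
    have 1: "has_ac_density c (S' \<mu>) (\<lambda>x. (q x + 2 * \<mu> * p x - \<mu>\<^sup>2) * S \<mu> x)"
      using r(1)[of \<mu>] unfolding pencil_pair_def by blast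
    have "has_ac_density c (St' \<mu>) (\<lambda>x. (qt x + 2 * \<mu> * pt x - \<mu>\<^sup>2) * St \<mu> x)"
      using r(2)[of \<mu>] unfolding pencil_pair_def by blast
    then have 2: "has_ac_density c (S' \<mu>) (\<lambda>x. (qt x + 2 * \<mu> * p x - \<mu>\<^sup>2) * S \<mu> x)"
      by (rule ac_density_cong[where N="{}"]) (use c in \<open>auto simp: S'eq Seq peq\<close>)
    show ?thesis
      by (rule negligible_subset[OF ac_density_unique[OF 1 2]]) (auto simp: algebra_simps)
  qed
  define N where "N = {0} \<union> (\<Union>n::nat. {x \<in> {0..c}. (q x - qt x) * S (Complex 0 (real n)) x \<noteq> 0})"
  have N: "negligible N"
    unfolding N_def
  proof (intro negligible_Un negligible_countable_Union)
    fix X assume "X \<in> range (\<lambda>n::nat. {x \<in> {0..c}. (q x - qt x) * S (Complex 0 (real n)) x \<noteq> 0})"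
    then show "negligible X" by (elim rangeE) (simp only: n1)
  qed auto
  have sub: "{x \<in> {0..c}. q x \<noteq> qt x} \<subseteq> N"
  proof
    fix x assume "x \<in> {x \<in> {0..c}. q x \<noteq> qt x}"
    then have x: "x \<in> {0..c}" "q x \<noteq> qt x" by auto
    show "x \<in> N"
    proof (cases "x = 0")
      case False
      then have x0: "0 < x" "x \<le> b" using x c by auto
      obtain d R where d: "0 < d" and R: "1 \<le> R" "\<forall>\<mu>. R \<le> \<bar>Im \<mu>\<bar> \<longrightarrow> d * exp (\<bar>Im \<mu>\<bar> * x) / norm \<mu> \<le> norm (S \<mu> x)"
        using sine_solution_lower_bound[OF co(1) fs x0] by blast
      obtain n :: nat where n: "R \<le> real n" using real_arch_simple by blast
      then have n0: "0 < real n" using R(1) by linarith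
      have "0 < d * exp (\<bar>Im (Complex 0 (real n))\<bar> * x) / norm (Complex 0 (real n))"
        using d n0 by (intro divide_pos_pos mult_pos_pos) (auto simp: complex_eq_iff)
      also have "\<dots> \<le> norm (S (Complex 0 (real n)) x)" using n by (intro R(2)[rule_format]) simp
      finally have "S (Complex 0 (real n)) x \<noteq> 0" by auto
      then show ?thesis using x unfolding N_def by auto
    qed (simp add: N_def)
  qed
  show neg: "negligible {x \<in> {0..c}. q x \<noteq> qt x}" by (rule negligible_subset[OF N sub])
  have cc: "pencil_coeffs c p q" by (rule pencil_coeffs_restrict[OF co(1) c])
  have pc: "pencil_pair c p q \<mu> (Ct \<mu>) (Ct' \<mu>)" for \<mu>
    by (rule pencil_pair_cong[OF r(4) _ _ _ neg]) (use c peq in auto)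
  show "C \<mu> x = Ct \<mu> x" "C' \<mu> x = Ct' \<mu> x" if "x \<in> {0..c}" for \<mu> x
  proof -
    have 0: "C \<mu> 0 = Ct \<mu> 0" "C' \<mu> 0 = Ct' \<mu> 0" using F(5,6) Ft(5,6) by simp_all
    show "C \<mu> x = Ct \<mu> x" "C' \<mu> x = Ct' \<mu> x" by (rule pencil_pair_unique[OF cc r(3) pc 0 that])+
  qed
qed

text \<open>
  Once the two systems agree, the vanishing entry of the transition matrix reads \<open>h S^2 =
  0\<close>. As \<open>S' = 1\<close> at the initial point, \<open>S\<close> cannot vanish on the
  whole interval, so \<open>h = 0\<close>.
\<close>
lemma uniqueness_on_half_interval:
  assumes co: "pencil_coeffs b p q" "pencil_coeffs b pt qt"
    and fs: "fundamental_system b p q S S' C C'" and ft: "fundamental_system b pt qt St St' Ct Ct'"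
    and L: "end_functional b H L" and H: "H \<noteq> 0" and h: "h holomorphic_on UNIV"
    and LS: "\<And>\<mu>. L (S \<mu>) = L (St \<mu>)" and LC: "\<And>\<mu>. L (Ct \<mu>) - L (C \<mu>) = h \<mu> * L (S \<mu>)"
  shows "\<And>x. x \<in> {0..b/2} \<Longrightarrow> p x = pt x" "negligible {x \<in> {0..b/2}. q x \<noteq> qt x}"
    "\<And>\<mu> x. x \<in> {0..b/2} \<Longrightarrow> S \<mu> x = St \<mu> x \<and> S' \<mu> x = St' \<mu> x \<and> C \<mu> x = Ct \<mu> x \<and> C' \<mu> x = Ct' \<mu> x"
    "\<And>\<mu>. h \<mu> = 0"
proof -
  have c: "0 < b / 2" "b / 2 \<le> b" using pencil_coeffs_D(1)[OF co(1)] by auto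
  note T = transition_matrix_constant[OF co fs ft L H h LS LC]
  have T1: "\<forall>x\<in>{0..b/2}. \<exists>A. \<forall>\<mu>. S \<mu> x = A * St \<mu> x" using T(1) by blast
  note P = proportional_sine_solutions_imp_eq_p[OF co fs ft c T1]
  have P': "\<forall>x\<in>{0..b/2}. p x = pt x" "\<forall>\<mu>. \<forall>x\<in>{0..b/2}. S \<mu> x = St \<mu> x" using P by blast+
  note Q = equal_sine_solutions_imp_eq_q[OF co fs ft c P']
  show "\<And>x. x \<in> {0..b/2} \<Longrightarrow> p x = pt x" "negligible {x \<in> {0..b/2}. q x \<noteq> qt x}"
    "\<And>\<mu> x. x \<in> {0..b/2} \<Longrightarrow> S \<mu> x = St \<mu> x \<and> S' \<mu> x = St' \<mu> x \<and> C \<mu> x = Ct \<mu> x \<and> C' \<mu> x = Ct' \<mu> x"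
    using P Q by simp_all
  show "h \<mu> = 0" for \<mu>
  proof (rule ccontr)
    assume h0: "h \<mu> \<noteq> 0"
    have S0: "S \<mu> x = 0" if x: "x \<in> {0..b/2}" for x
      using T(2)[OF x, of \<mu>] P(2)[OF x, of \<mu>] Q(3)[OF x, of \<mu>] h0 by (simp add: mult.commute)
    have x0: "0 \<in> {0..b/2}" using c by simp
    note F = fundamental_systemD[OF fs]
    have "((\<lambda>_. 0) has_vector_derivative S' \<mu> 0) (at 0 within {0..b/2})"
      by (rule has_vector_derivative_transform[OF x0 _ pencil_pair_derivative[OF pencil_pair_restrict[OF F(1) c(2)] x0]])
         (simp add: S0)
    moreover have "((\<lambda>_. 0) has_vector_derivative (0::complex)) (at 0 within {0..b/2})" by simp
    ultimately have "S' \<mu> 0 = 0"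
      by (rule has_vector_derivative_unique_Icc[OF c(1) x0])
    then show False using F(4) by simp
  qed
qed

section \<open>Halving the remaining interval\<close>

text \<open>
  The solutions are recombined by the inverse of their transfer matrix at \<open>c\<close>, whose
  determinant is the Wronskian.
\<close>
lemma fundamental_system_shift:
  assumes fs: "fundamental_system b p q S S' C C'" and c: "0 \<le> c" "c \<le> b"
  shows "fundamental_system (b - c) (\<lambda>s. p (c + s)) (\<lambda>s. q (c + s))
     (\<lambda>\<mu> s. C \<mu> c * S \<mu> (c + s) + (- S \<mu> c) * C \<mu> (c + s)) (\<lambda>\<mu> s. C \<mu> c * S' \<mu> (c + s) + (- S \<mu> c) * C' \<mu> (c + s))
     (\<lambda>\<mu> s. (- C' \<mu> c) * S \<mu> (c + s) + S' \<mu> c * C \<mu> (c + s)) (\<lambda>\<mu> s. (- C' \<mu> c) * S' \<mu> (c + s) + S' \<mu> c * C' \<mu> (c + s))"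
  unfolding fundamental_system_def
proof (intro allI conjI)
  fix \<mu>
  note F = fundamental_systemD[OF fs]
  have W: "C \<mu> c * S' \<mu> c - C' \<mu> c * S \<mu> c = 1" using c by (intro fundamental_system_wronskian[OF fs]) auto
  show "pencil_pair (b - c) (\<lambda>s. p (c + s)) (\<lambda>s. q (c + s)) \<mu> (\<lambda>s. C \<mu> c * S \<mu> (c + s) + (- S \<mu> c) * C \<mu> (c + s))
     (\<lambda>s. C \<mu> c * S' \<mu> (c + s) + (- S \<mu> c) * C' \<mu> (c + s))"
    by (rule pencil_pair_shift[OF pencil_pair_lincomb[OF F(1,2)] c(1)])
  show "pencil_pair (b - c) (\<lambda>s. p (c + s)) (\<lambda>s. q (c + s)) \<mu> (\<lambda>s. (- C' \<mu> c) * S \<mu> (c + s) + S' \<mu> c * C \<mu> (c + s))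
     (\<lambda>s. (- C' \<mu> c) * S' \<mu> (c + s) + S' \<mu> c * C' \<mu> (c + s))"
    by (rule pencil_pair_shift[OF pencil_pair_lincomb[OF F(1,2)] c(1)])
qed (use fundamental_system_wronskian[OF fs, of c] c in \<open>auto simp: algebra_simps\<close>)

text \<open>
  A function on the shorter interval is continued to the left by its initial value, which preserves
  continuity and bounds.
\<close>
lemma end_functional_shift:
  assumes L: "end_functional b H L" and c: "0 \<le> c" "c < b"
  shows "end_functional (b - c) H (\<lambda>f. L (\<lambda>s. f (max 0 (s - c))))"
proof -
  have Lb: "bounded_functional b L" using L by (simp add: end_functional_def)
  have cont: "continuous_on {0..b} (\<lambda>s. f (max 0 (s - c)))" if "continuous_on {0..b - c} f" for f :: "real \<Rightarrow> complex"
    by (rule continuous_on_compose2[OF that]) (use c in \<open>auto intro!: continuous_intros\<close>)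
  have "bounded_functional (b - c) (\<lambda>f. L (\<lambda>s. f (max 0 (s - c))))"
    unfolding bounded_functional_def
  proof (intro conjI allI impI)
    obtain K where K0: "0 \<le> K" and
      Kb: "\<forall>f M. continuous_on {0..b} f \<longrightarrow> (\<forall>x\<in>{0..b}. norm (f x) \<le> M) \<longrightarrow> norm (L f) \<le> K * M"
      using bounded_functional_bound[OF Lb] by blast
    show "\<exists>K\<ge>0. \<forall>f M. continuous_on {0..b - c} f \<longrightarrow> (\<forall>x\<in>{0..b - c}. norm (f x) \<le> M) \<longrightarrow>
        norm (L (\<lambda>s. f (max 0 (s - c)))) \<le> K * M"
      using c by (intro exI[of _ K] conjI K0 allI impI Kb[rule_format] cont) auto
  qed (auto intro!: bounded_functionalD(1,2)[OF Lb] cont)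
  moreover have "\<forall>\<epsilon>>0. \<exists>\<delta>>0. \<exists>K\<ge>0. \<forall>f M1 M2. continuous_on {0..b - c} f \<longrightarrow> (\<forall>x\<in>{0..b - c}. norm (f x) \<le> M1) \<longrightarrow>
        (\<forall>x\<in>{0..b - c - \<delta>}. norm (f x) \<le> M2) \<longrightarrow> norm (L (\<lambda>s. f (max 0 (s - c))) - H * f (b - c)) \<le> \<epsilon> * M1 + K * M2"
  proof (intro allI impI)
    fix \<epsilon> :: real assume "0 < \<epsilon>"
    then obtain \<delta> K where \<delta>: "0 < \<delta>" and K: "0 \<le> K" and
      LK: "\<forall>f M1 M2. continuous_on {0..b} f \<longrightarrow> (\<forall>x\<in>{0..b}. norm (f x) \<le> M1) \<longrightarrow>
        (\<forall>x\<in>{0..b - \<delta>}. norm (f x) \<le> M2) \<longrightarrow> norm (L f - H * f b) \<le> \<epsilon> * M1 + K * M2"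
      using L unfolding end_functional_def by blast
    show "\<exists>\<delta>>0. \<exists>K\<ge>0. \<forall>f M1 M2. continuous_on {0..b - c} f \<longrightarrow> (\<forall>x\<in>{0..b - c}. norm (f x) \<le> M1) \<longrightarrow>
        (\<forall>x\<in>{0..b - c - \<delta>}. norm (f x) \<le> M2) \<longrightarrow> norm (L (\<lambda>s. f (max 0 (s - c))) - H * f (b - c)) \<le> \<epsilon> * M1 + K * M2"
    proof (rule exI[of _ "min \<delta> (b - c)"], rule conjI, simp add: \<delta> c, rule exI[of _ K], intro conjI K allI impI)
      fix f :: "real \<Rightarrow> complex" and M1 M2
      assume f: "continuous_on {0..b - c} f" "\<forall>x\<in>{0..b - c}. norm (f x) \<le> M1"
        "\<forall>x\<in>{0..b - c - min \<delta> (b - c)}. norm (f x) \<le> M2"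
      have "norm (L (\<lambda>s. f (max 0 (s - c))) - H * f (max 0 (b - c))) \<le> \<epsilon> * M1 + K * M2"
        by (rule LK[rule_format, OF cont[OF f(1)]]) (use f c in auto)
      then show "norm (L (\<lambda>s. f (max 0 (s - c))) - H * f (b - c)) \<le> \<epsilon> * M1 + K * M2" using c by simp
    qed
  qed
  ultimately show ?thesis unfolding end_functional_def by blast
qed

text \<open>
  The functional takes equal values on the systems normalized at \<open>0\<close>. As the two
  pencils agree on the left half, it also takes equal values on the systems normalized at the
  midpoint and continued by constants, so the argument can be repeated on the right half.
\<close>
lemma uniqueness_by_halving:
  assumes "pencil_coeffs b p q" "pencil_coeffs b pt qt"
    and "fundamental_system b p q S S' C C'" "fundamental_system b pt qt St St' Ct Ct'"
    and "end_functional b H L" and H: "H \<noteq> 0"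
    and "\<And>\<mu>. L (S \<mu>) = L (St \<mu>)" "\<And>\<mu>. L (C \<mu>) = L (Ct \<mu>)"
  shows "(\<forall>x\<in>{0..<b * (1 - 1 / 2 ^ n)}. p x = pt x) \<and> negligible {x \<in> {0..<b * (1 - 1 / 2 ^ n)}. q x \<noteq> qt x}"
  using assms(1-5,7-8)
proof (induction n arbitrary: b p q pt qt S S' C C' St St' Ct Ct' L)
  case (Suc n)
  note co = Suc.prems(1,2) and fs = Suc.prems(3) and ft = Suc.prems(4) and L = Suc.prems(5)
  have Lb: "bounded_functional b L" using L by (simp add: end_functional_def)
  define c where "c = b / 2"
  have c: "0 < c" "c < b" "0 \<le> c" "c \<le> b" "b - c = c" using pencil_coeffs_D(1)[OF co(1)] by (auto simp: c_def)
  have LC: "L (Ct \<mu>) - L (C \<mu>) = (\<lambda>_. 0) \<mu> * L (S \<mu>)" for \<mu> using Suc.prems(7) by simp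
  note U = uniqueness_on_half_interval[OF co fs ft L H holomorphic_on_const Suc.prems(6) LC, folded c_def]
  have ceq: "S \<mu> c = St \<mu> c" "S' \<mu> c = St' \<mu> c" "C \<mu> c = Ct \<mu> c" "C' \<mu> c = Ct' \<mu> c" for \<mu>
    using U(3)[of c \<mu>] c by auto
  define Lc where "Lc f = L (\<lambda>s. f (max 0 (s - c)))" for f
  have transfer: "Lc (\<lambda>s. k1 * S \<mu> (c + s) + k2 * C \<mu> (c + s)) = Lc (\<lambda>s. k1 * St \<mu> (c + s) + k2 * Ct \<mu> (c + s))"
    for \<mu> k1 k2
  proof -
    note F = fundamental_systemD[OF fs, of \<mu>] and Ft = fundamental_systemD[OF ft, of \<mu>]
    have cont: "continuous_on {0..b} (\<lambda>s. f (c + max 0 (s - c)))" if "continuous_on {0..b} f" for f :: "real \<Rightarrow> complex"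
      by (rule continuous_on_compose2[OF that]) (use c in \<open>auto intro!: continuous_intros\<close>)
    let ?f = "\<lambda>s. k1 * S \<mu> (c + max 0 (s - c)) + k2 * C \<mu> (c + max 0 (s - c))"
    let ?g = "\<lambda>s. k1 * St \<mu> (c + max 0 (s - c)) + k2 * Ct \<mu> (c + max 0 (s - c))"
    have cf: "continuous_on {0..b} ?f" "continuous_on {0..b} ?g"
      by (intro continuous_intros cont F Ft)+
    have "L (\<lambda>s. ?f s - ?g s) = L (\<lambda>s. k1 * (S \<mu> s - St \<mu> s) + k2 * (C \<mu> s - Ct \<mu> s))"
    proof (rule bounded_functional_cong[OF Lb])
      show "continuous_on {0..b} (\<lambda>s. ?f s - ?g s)" by (intro continuous_intros cf)
      fix s assume s: "s \<in> {0..b}"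
      show "?f s - ?g s = k1 * (S \<mu> s - St \<mu> s) + k2 * (C \<mu> s - Ct \<mu> s)"
      proof (cases "s \<le> c")
        case True
        then show ?thesis using U(3)[of s \<mu>] s ceq by simp
      next
        case False
        then show ?thesis by (simp add: algebra_simps)
      qed
    qed
    also have "\<dots> = k1 * (L (S \<mu>) - L (St \<mu>)) + k2 * (L (C \<mu>) - L (Ct \<mu>))"
      using F Ft by (subst bounded_functionalD(1)[OF Lb])
        (auto simp: bounded_functionalD(2)[OF Lb] bounded_functionalD(3)[OF Lb] continuous_on_diff intro!: continuous_intros)
    also have "\<dots> = 0" using Suc.prems(6,7) by simp
    finally have "L ?f - L ?g = 0" using bounded_functionalD(3)[OF Lb cf] by simp
    then show ?thesis by (simp add: Lc_def)
  qed
  have IH: "(\<forall>x\<in>{0..<(b - c) * (1 - 1 / 2 ^ n)}. p (c + x) = pt (c + x)) \<and>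
      negligible {x \<in> {0..<(b - c) * (1 - 1 / 2 ^ n)}. q (c + x) \<noteq> qt (c + x)}"
  proof (rule Suc.IH)
    show "pencil_coeffs (b - c) (\<lambda>s. p (c + s)) (\<lambda>s. q (c + s))" "pencil_coeffs (b - c) (\<lambda>s. pt (c + s)) (\<lambda>s. qt (c + s))"
      using c by (intro pencil_coeffs_shift co; simp)+
    show "fundamental_system (b - c) (\<lambda>s. p (c + s)) (\<lambda>s. q (c + s))
     (\<lambda>\<mu> s. C \<mu> c * S \<mu> (c + s) + (- S \<mu> c) * C \<mu> (c + s)) (\<lambda>\<mu> s. C \<mu> c * S' \<mu> (c + s) + (- S \<mu> c) * C' \<mu> (c + s))
     (\<lambda>\<mu> s. (- C' \<mu> c) * S \<mu> (c + s) + S' \<mu> c * C \<mu> (c + s)) (\<lambda>\<mu> s. (- C' \<mu> c) * S' \<mu> (c + s) + S' \<mu> c * C' \<mu> (c + s))"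
      by (rule fundamental_system_shift[OF fs c(3,4)])
    show "fundamental_system (b - c) (\<lambda>s. pt (c + s)) (\<lambda>s. qt (c + s))
     (\<lambda>\<mu> s. Ct \<mu> c * St \<mu> (c + s) + (- St \<mu> c) * Ct \<mu> (c + s)) (\<lambda>\<mu> s. Ct \<mu> c * St' \<mu> (c + s) + (- St \<mu> c) * Ct' \<mu> (c + s))
     (\<lambda>\<mu> s. (- Ct' \<mu> c) * St \<mu> (c + s) + St' \<mu> c * Ct \<mu> (c + s)) (\<lambda>\<mu> s. (- Ct' \<mu> c) * St' \<mu> (c + s) + St' \<mu> c * Ct' \<mu> (c + s))"
      by (rule fundamental_system_shift[OF ft c(3,4)])
    show "end_functional (b - c) H Lc" unfolding Lc_def by (rule end_functional_shift[OF L c(3,2)])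
  qed (simp_all only: ceq transfer)
  have len: "b * (1 - 1 / 2 ^ Suc n) = c + (b - c) * (1 - 1 / 2 ^ n)" using c(5) by (simp add: c_def field_simps)
  have split: "x \<in> {0..c} \<or> x - c \<in> {0..<(b - c) * (1 - 1 / 2 ^ n)}" if "x \<in> {0..<b * (1 - 1 / 2 ^ Suc n)}" for x
    using that unfolding len by auto
  show ?case
  proof
    show "\<forall>x\<in>{0..<b * (1 - 1 / 2 ^ Suc n)}. p x = pt x"
    proof
      fix x assume "x \<in> {0..<b * (1 - 1 / 2 ^ Suc n)}"
      from split[OF this] show "p x = pt x"
        using U(1)[of x] IH[THEN conjunct1, rule_format, of "x - c"] by auto
    qed
    have "negligible ((+) c ` {x \<in> {0..<(b - c) * (1 - 1 / 2 ^ n)}. q (c + x) \<noteq> qt (c + x)})"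
      using IH by (intro negligible_translation) auto
    then have "negligible ({x \<in> {0..c}. q x \<noteq> qt x} \<union> (+) c ` {x \<in> {0..<(b - c) * (1 - 1 / 2 ^ n)}. q (c + x) \<noteq> qt (c + x)})"
      using U(2) by (intro negligible_Un)
    then show "negligible {x \<in> {0..<b * (1 - 1 / 2 ^ Suc n)}. q x \<noteq> qt x}"
    proof (rule negligible_subset)
      show "{x \<in> {0..<b * (1 - 1 / 2 ^ Suc n)}. q x \<noteq> qt x} \<subseteq>
        {x \<in> {0..c}. q x \<noteq> qt x} \<union> (+) c ` {x \<in> {0..<(b - c) * (1 - 1 / 2 ^ n)}. q (c + x) \<noteq> qt (c + x)}"
      proof
        fix x assume "x \<in> {x \<in> {0..<b * (1 - 1 / 2 ^ Suc n)}. q x \<noteq> qt x}"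
        then have x: "x \<in> {0..<b * (1 - 1 / 2 ^ Suc n)}" "q x \<noteq> qt x" by auto
        from split[OF x(1)] show "x \<in> {x \<in> {0..c}. q x \<noteq> qt x} \<union> (+) c ` {x \<in> {0..<(b - c) * (1 - 1 / 2 ^ n)}. q (c + x) \<noteq> qt (c + x)}"
          using x(2) by (auto intro!: image_eqI[of _ _ "x - c"])
      qed
    qed
  qed
qed simp

section \<open>The Stieltjes forms\<close>

definition stieltjes_sum :: "(real \<Rightarrow> complex) \<Rightarrow> (real \<Rightarrow> complex) \<Rightarrow> (real \<times> real set) set \<Rightarrow> complex" where
  "stieltjes_sum y \<sigma> P = (\<Sum>(t, K)\<in>P. y t * (\<sigma> (Sup K) - \<sigma> (Inf K)))"

definition mesh_less :: "(real \<times> real set) set \<Rightarrow> real \<Rightarrow> bool" where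
  "mesh_less P \<delta> \<longleftrightarrow> (\<forall>(t, K)\<in>P. Sup K - Inf K < \<delta>)"

lemma has_stieltjes_integral_iff:
  "has_stieltjes_integral a b y \<sigma> I \<longleftrightarrow>
     (\<forall>\<epsilon>>0. \<exists>\<delta>>0. \<forall>P. P tagged_division_of {a..b} \<longrightarrow> mesh_less P \<delta> \<longrightarrow> norm (stieltjes_sum y \<sigma> P - I) < \<epsilon>)"
  unfolding has_stieltjes_integral_def stieltjes_sum_def mesh_less_def ..

lemma has_stieltjes_integralD:
  assumes "has_stieltjes_integral a b y \<sigma> I" "0 < \<epsilon>"
  shows "\<exists>\<delta>>0. \<forall>P. P tagged_division_of {a..b} \<longrightarrow> mesh_less P \<delta> \<longrightarrow> norm (stieltjes_sum y \<sigma> P - I) < \<epsilon>"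
  using assms unfolding has_stieltjes_integral_iff by simp

text \<open>
  The nondecreasing function \<open>v\<close> plays the role of the total variation of
  \<open>\<sigma>\<close>.
\<close>
definition controls :: "real \<Rightarrow> (real \<Rightarrow> real) \<Rightarrow> (real \<Rightarrow> complex) \<Rightarrow> bool" where
  "controls T v \<sigma> \<longleftrightarrow> (\<forall>a b. 0 \<le> a \<longrightarrow> a \<le> b \<longrightarrow> b \<le> T \<longrightarrow> norm (\<sigma> b - \<sigma> a) \<le> v b - v a)"

lemma tagged_interval:
  fixes P :: "(real \<times> real set) set"
  assumes "P tagged_division_of {a..b}" "(t, K) \<in> P"
  shows "K = {Inf K..Sup K}" "Inf K \<le> t" "t \<le> Sup K" "a \<le> Inf K" "Sup K \<le> b" "t \<in> {a..b}" "Inf K \<le> Sup K"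
proof -
  have K: "K \<in> snd ` P" using assms(2) by force
  note i = interval_of_division[OF division_of_tagged_division[OF assms(1)] K]
  then show eq: "K = {Inf K..Sup K}" and "Inf K \<le> Sup K" by auto
  have t: "t \<in> K" "K \<subseteq> {a..b}" using assms by auto
  show "Inf K \<le> t" "t \<le> Sup K" using t(1) eq by (metis atLeastAtMost_iff)+
  show "a \<le> Inf K" "Sup K \<le> b" using i(3,4) t(2) by auto
  show "t \<in> {a..b}" using t by auto
qed

lemma controls_mono: "controls T v \<sigma> \<Longrightarrow> 0 \<le> a \<Longrightarrow> a \<le> b \<Longrightarrow> b \<le> T \<Longrightarrow> v a \<le> v b"
  unfolding controls_def by (meson diff_ge_0_iff_ge norm_ge_zero order_trans)

text \<open>
  The majorant is the variation over \<open>[0, x]\<close> as a function of \<open>x\<close>.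
\<close>
lemma bounded_variation_controlled:
  assumes bv: "bounded_variation_fn 0 T \<sigma>"
  shows "\<exists>v. controls T v \<sigma>"
proof -
  obtain B where B: "\<And>D. D division_of {0..T} \<Longrightarrow> (\<Sum>K\<in>D. norm (\<sigma> (Sup K) - \<sigma> (Inf K))) \<le> B"
    using bv unfolding bounded_variation_fn_def by metis
  define var where "var D = (\<Sum>K\<in>D. norm (\<sigma> (Sup K) - \<sigma> (Inf K)))" for D
  have ext: "var D + norm (\<sigma> b - \<sigma> a) = var (insert {a..b} D) \<and> insert {a..b} D division_of {0..b}"
    if D: "D division_of {0..a}" and ab: "0 \<le> a" "a < b" for D a b
  proof
    have "{a..b} \<notin> D"
    proof
      assume "{a..b} \<in> D"
      then have "{a..b} \<subseteq> {0..a}" using D by auto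
      then show False using ab by auto
    qed
    then show "var D + norm (\<sigma> b - \<sigma> a) = var (insert {a..b} D)"
      using D ab by (simp add: var_def division_of_finite)
    have 1: "{{a..b}} division_of {a..b}"
      using division_of_self[of a b] ab by (metis box_real(2) atLeastatMost_empty_iff2 less_imp_le not_le)
    have "D \<union> {{a..b}} division_of ({0..a} \<union> {a..b})"
    proof (rule division_disjoint_union[OF D 1])
      show "interior {0..a} \<inter> interior {a..b} = {}" by auto
    qed
    moreover have "{0..a} \<union> {a..b} = {0..b}" using ab by auto
    ultimately show "insert {a..b} D division_of {0..b}" by simp
  qed
  define V where "V x = {var D | D. D division_of {0..x}}" for x
  have ne: "V x \<noteq> {}" if "0 \<le> x" for x
    using division_of_self[of 0 x] that unfolding V_def by (auto intro!: exI[of _ "{{0..x}}"])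
  have bdd: "bdd_above (V x)" if "0 \<le> x" "x \<le> T" for x
  proof (rule bdd_aboveI[of _ B])
    fix r assume "r \<in> V x"
    then obtain D where D: "D division_of {0..x}" "r = var D" by (auto simp: V_def)
    show "r \<le> B"
    proof (cases "x = T")
      case True then show ?thesis using B[of D] D by (simp add: var_def)
    next
      case False
      then have "x < T" using that by simp
      from ext[OF D(1) that(1) this]
      have "var D + norm (\<sigma> T - \<sigma> x) \<le> B" using B by (simp add: var_def)
      then show ?thesis using D(2) norm_ge_zero[of "\<sigma> T - \<sigma> x"] by linarith
    qed
  qed
  show ?thesis
    unfolding controls_def
  proof (intro exI[of _ "\<lambda>x. Sup (V x)"] allI impI)
    fix a b assume ab: "0 \<le> a" "a \<le> b" "b \<le> T"
    show "norm (\<sigma> b - \<sigma> a) \<le> Sup (V b) - Sup (V a)"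
    proof (cases "a = b")
      case False
      then have "a < b" using ab by simp
      have "Sup (V a) \<le> Sup (V b) - norm (\<sigma> b - \<sigma> a)"
      proof (rule cSup_least[OF ne[OF ab(1)]])
        fix r assume "r \<in> V a"
        then obtain D where D: "D division_of {0..a}" "r = var D" by (auto simp: V_def)
        have "var D + norm (\<sigma> b - \<sigma> a) \<in> V b"
          using ext[OF D(1) ab(1) \<open>a < b\<close>] unfolding V_def by auto
        then have "var D + norm (\<sigma> b - \<sigma> a) \<le> Sup (V b)" using bdd ab by (intro cSup_upper) auto
        then show "r \<le> Sup (V b) - norm (\<sigma> b - \<sigma> a)" using D(2) by simp
      qed
      then show ?thesis by simp
    qed simp
  qed
qed

definition clamp_to :: "real set \<Rightarrow> real \<Rightarrow> real" where
  "clamp_to K x = max (Inf K) (min (Sup K) x)"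

text \<open>
  If the intervals meet, both sides are the increment over the intersection; otherwise both vanish.
\<close>
lemma clamp_increment_commute:
  assumes "Inf K \<le> Sup K" "Inf J \<le> Sup J"
  shows "f (clamp_to K (Sup J)) - f (clamp_to K (Inf J)) = (f (clamp_to J (Sup K)) - f (clamp_to J (Inf K)) :: 'a :: real_vector)"
proof -
  consider "Sup J < Inf K" | "Sup K < Inf J" | "Inf K \<le> Sup J" "Inf J \<le> Sup K" by linarith
  then show ?thesis
  proof cases
    case 1
    then have "clamp_to K (Sup J) = Inf K" "clamp_to K (Inf J) = Inf K" "clamp_to J (Sup K) = Sup J" "clamp_to J (Inf K) = Sup J"
      using assms by (auto simp: clamp_to_def)
    then show ?thesis by simp
  next
    case 2
    then have "clamp_to K (Sup J) = Sup K" "clamp_to K (Inf J) = Sup K" "clamp_to J (Sup K) = Inf J" "clamp_to J (Inf K) = Inf J"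
      using assms by (auto simp: clamp_to_def)
    then show ?thesis by simp
  next
    case 3
    then have "clamp_to K (Sup J) = clamp_to J (Sup K)" "clamp_to K (Inf J) = clamp_to J (Inf K)"
      using assms by (auto simp: clamp_to_def)
    then show ?thesis by simp
  qed
qed

lemma clamp_increment_disjoint:
  assumes "Inf K \<le> Sup K" "Inf J \<le> Sup J" "Sup J < Inf K \<or> Sup K < Inf J"
  shows "clamp_to K (Sup J) = clamp_to K (Inf J)"
  using assms by (auto simp: clamp_to_def)

lemma tagged_telescope:
  fixes f :: "real \<Rightarrow> 'a::real_normed_vector"
  assumes "P tagged_division_of {0..T}" "0 \<le> T"
  shows "(\<Sum>(t, K)\<in>P. f (Sup K) - f (Inf K)) = f T - f 0"
  using additive_tagged_division_1[OF assms(2,1), of f] by simp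

lemma tagged_clamp_telescope:
  fixes f :: "real \<Rightarrow> 'a::real_normed_vector"
  assumes P: "P tagged_division_of {0..T}" "0 \<le> T" and K: "0 \<le> Inf K" "Inf K \<le> Sup K" "Sup K \<le> T"
  shows "(\<Sum>(t, J)\<in>P. f (clamp_to K (Sup J)) - f (clamp_to K (Inf J))) = f (Sup K) - f (Inf K)"
proof -
  have "(\<Sum>(t, J)\<in>P. f (clamp_to K (Sup J)) - f (clamp_to K (Inf J))) = f (clamp_to K T) - f (clamp_to K 0)"
    using tagged_telescope[OF P, of "f \<circ> clamp_to K"] by simp
  moreover have "clamp_to K T = Sup K" "clamp_to K 0 = Inf K" unfolding clamp_to_def using K by linarith+
  ultimately show ?thesis by simp
qed

text \<open>
  Both sums are rewritten over the common refinement. There the tags of two intervals that meet are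
  less than twice the mesh apart.
\<close>
lemma stieltjes_sum_close:
  assumes T: "0 \<le> T" and v: "controls T v \<sigma>" and P: "P tagged_division_of {0..T}" "Q tagged_division_of {0..T}"
    and mesh: "mesh_less P \<delta>" "mesh_less Q \<delta>"
    and y: "\<forall>s\<in>{0..T}. \<forall>t\<in>{0..T}. \<bar>s - t\<bar> < 2 * \<delta> \<longrightarrow> norm (y s - y t) \<le> \<omega>"
  shows "norm (stieltjes_sum y \<sigma> P - stieltjes_sum y \<sigma> Q) \<le> \<omega> * (v T - v 0)"
proof -
  have fin: "finite P" "finite Q" using P by auto
  define h where "h f K J = f (clamp_to K (Sup J)) - f (clamp_to K (Inf J))" for f :: "real \<Rightarrow> complex" and K J
  define hv where "hv K J = v (clamp_to K (Sup J)) - v (clamp_to K (Inf J))" for K J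
  note IP = tagged_interval[OF P(1)] and IQ = tagged_interval[OF P(2)]
  have hcomm: "h \<sigma> K J = h \<sigma> J K" if "(t, K) \<in> P" "(s, J) \<in> Q" for t K s J
    unfolding h_def using IP[OF that(1)] IQ[OF that(2)] by (intro clamp_increment_commute)
  have "stieltjes_sum y \<sigma> P = (\<Sum>(t, K)\<in>P. \<Sum>(s, J)\<in>Q. y t * h \<sigma> K J)"
    unfolding stieltjes_sum_def
  proof (rule sum.cong[OF refl], clarify)
    fix t K assume tK: "(t, K) \<in> P"
    have "\<sigma> (Sup K) - \<sigma> (Inf K) = (\<Sum>(s, J)\<in>Q. h \<sigma> K J)"
      unfolding h_def using IP[OF tK] by (intro tagged_clamp_telescope[OF P(2) T, symmetric]) auto
    then show "y t * (\<sigma> (Sup K) - \<sigma> (Inf K)) = (\<Sum>(s, J)\<in>Q. y t * h \<sigma> K J)"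
      by (simp add: sum_distrib_left case_prod_beta)
  qed
  moreover have "stieltjes_sum y \<sigma> Q = (\<Sum>(t, K)\<in>P. \<Sum>(s, J)\<in>Q. y s * h \<sigma> K J)"
  proof -
    have "stieltjes_sum y \<sigma> Q = (\<Sum>(s, J)\<in>Q. \<Sum>(t, K)\<in>P. y s * h \<sigma> K J)"
      unfolding stieltjes_sum_def
    proof (rule sum.cong[OF refl], clarify)
      fix s J assume sJ: "(s, J) \<in> Q"
      have "\<sigma> (Sup J) - \<sigma> (Inf J) = (\<Sum>(t, K)\<in>P. h \<sigma> J K)"
        unfolding h_def using IQ[OF sJ] by (intro tagged_clamp_telescope[OF P(1) T, symmetric]) auto
      also have "\<dots> = (\<Sum>(t, K)\<in>P. h \<sigma> K J)"
        by (rule sum.cong) (use hcomm[OF _ sJ] in auto)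
      finally show "y s * (\<sigma> (Sup J) - \<sigma> (Inf J)) = (\<Sum>(t, K)\<in>P. y s * h \<sigma> K J)"
        by (simp add: sum_distrib_left case_prod_beta)
    qed
    also have "\<dots> = (\<Sum>(t, K)\<in>P. \<Sum>(s, J)\<in>Q. y s * h \<sigma> K J)"
      unfolding case_prod_beta by (rule sum.swap)
    finally show ?thesis .
  qed
  ultimately have "stieltjes_sum y \<sigma> P - stieltjes_sum y \<sigma> Q = (\<Sum>(t, K)\<in>P. \<Sum>(s, J)\<in>Q. (y t - y s) * h \<sigma> K J)"
    by (simp add: sum_subtractf[symmetric] case_prod_beta left_diff_distrib)
  also have "norm \<dots> \<le> (\<Sum>(t, K)\<in>P. \<Sum>(s, J)\<in>Q. \<omega> * hv K J)"
  proof (rule order_trans[OF norm_sum], rule sum_mono, clarify, rule order_trans[OF norm_sum], rule sum_mono, clarify)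
    fix t K s J assume tK: "(t, K) \<in> P" and sJ: "(s, J) \<in> Q"
    note K = IP[OF tK] and J = IQ[OF sJ]
    show "norm ((y t - y s) * h \<sigma> K J) \<le> \<omega> * hv K J"
    proof (cases "Sup J < Inf K \<or> Sup K < Inf J")
      case True
      then show ?thesis using clamp_increment_disjoint[OF K(7) J(7)] by (simp add: h_def hv_def)
    next
      case False
      have "Sup K - Inf K < \<delta>" "Sup J - Inf J < \<delta>" using mesh tK sJ by (auto simp: mesh_less_def)
      then have "\<bar>t - s\<bar> < 2 * \<delta>" using False K J by linarith
      then have *: "norm (y t - y s) \<le> \<omega>" using y K(6) J(6) by blast
      have "norm (h \<sigma> K J) \<le> hv K J"
        unfolding h_def hv_def using K J
        by (intro v[unfolded controls_def, rule_format]) (auto simp: clamp_to_def)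
      then show ?thesis unfolding norm_mult using * by (intro mult_mono) (auto intro: order_trans[OF norm_ge_zero])
    qed
  qed
  also have "\<dots> = (\<Sum>(t, K)\<in>P. \<omega> * (v (Sup K) - v (Inf K)))"
  proof (rule sum.cong[OF refl], clarify)
    fix t K assume tK: "(t, K) \<in> P"
    have "(\<Sum>(s, J)\<in>Q. hv K J) = v (Sup K) - v (Inf K)"
      unfolding hv_def using IP[OF tK] by (intro tagged_clamp_telescope[OF P(2) T]) auto
    then show "(\<Sum>(s, J)\<in>Q. \<omega> * hv K J) = \<omega> * (v (Sup K) - v (Inf K))"
      by (simp add: sum_distrib_left[symmetric] case_prod_beta)
  qed
  also have "\<dots> = \<omega> * (v T - v 0)"
    using tagged_telescope[OF P(1) T, of v] by (simp add: sum_distrib_left[symmetric] case_prod_beta)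
  finally show ?thesis .
qed

lemma fine_tagged_division_exists:
  assumes "0 < \<delta>"
  shows "\<exists>P. P tagged_division_of {a..b::real} \<and> mesh_less P \<delta>"
proof -
  have "gauge (\<lambda>x::real. ball x (\<delta> / 2))" using assms by auto
  then obtain P where P: "P tagged_division_of {a..b}" "(\<lambda>x. ball x (\<delta> / 2)) fine P"
    using fine_division_exists_real by blast
  have "mesh_less P \<delta>"
    unfolding mesh_less_def
  proof clarify
    fix t K assume tK: "(t, K) \<in> P"
    have "K \<subseteq> ball t (\<delta> / 2)" using P(2) tK by (auto simp: fine_def)
    moreover have "Inf K \<in> K" "Sup K \<in> K" using tagged_interval(1,7)[OF P(1) tK] by (metis atLeastAtMost_iff order_refl)+
    ultimately have "Inf K \<in> ball t (\<delta> / 2)" "Sup K \<in> ball t (\<delta> / 2)" by blast+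
    then have "\<bar>t - Inf K\<bar> < \<delta> / 2" "\<bar>t - Sup K\<bar> < \<delta> / 2" by (simp_all add: dist_real_def)
    then show "Sup K - Inf K < \<delta>" by linarith
  qed
  with P(1) show ?thesis by blast
qed

lemma mesh_less_mono: "mesh_less P \<delta> \<Longrightarrow> \<delta> \<le> \<delta>' \<Longrightarrow> mesh_less P \<delta>'"
  unfolding mesh_less_def by fastforce

lemma continuous_modulus:
  fixes y :: "real \<Rightarrow> complex"
  assumes "continuous_on {0..T} y" "0 < \<omega>"
  shows "\<exists>\<delta>>0. \<forall>s\<in>{0..T}. \<forall>t\<in>{0..T}. \<bar>s - t\<bar> < 2 * \<delta> \<longrightarrow> norm (y s - y t) \<le> \<omega>"
proof -
  have "uniformly_continuous_on {0..T} y" using assms(1) by (intro compact_uniformly_continuous) auto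
  then obtain d where d: "0 < d" "\<forall>s\<in>{0..T}. \<forall>t\<in>{0..T}. dist t s < d \<longrightarrow> dist (y t) (y s) < \<omega>"
    using assms(2) unfolding uniformly_continuous_on_def by blast
  show ?thesis
  proof (intro exI[of _ "d / 2"] conjI ballI impI)
    fix s t assume "s \<in> {0..T}" "t \<in> {0..T}" "\<bar>s - t\<bar> < 2 * (d / 2)"
    then have "dist (y s) (y t) < \<omega>" using d(2) by (auto simp: dist_real_def)
    then show "norm (y s - y t) \<le> \<omega>" by (simp add: dist_norm)
  qed (use d in simp)
qed

lemma has_stieltjes_integral_close:
  assumes I: "has_stieltjes_integral 0 T y \<sigma> I"
    and le: "\<exists>\<delta>>0. \<forall>P. P tagged_division_of {0..T} \<longrightarrow> mesh_less P \<delta> \<longrightarrow> norm (stieltjes_sum y \<sigma> P - c) \<le> C"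
  shows "norm (I - c) \<le> C"
proof (rule field_le_epsilon)
  fix e :: real assume e: "0 < e"
  obtain d1 where d1: "0 < d1" "\<forall>P. P tagged_division_of {0..T} \<longrightarrow> mesh_less P d1 \<longrightarrow> norm (stieltjes_sum y \<sigma> P - I) < e"
    using has_stieltjes_integralD[OF I e] by blast
  obtain d2 where d2: "0 < d2" "\<forall>P. P tagged_division_of {0..T} \<longrightarrow> mesh_less P d2 \<longrightarrow> norm (stieltjes_sum y \<sigma> P - c) \<le> C"
    using le by blast
  have "0 < min d1 d2" using d1(1) d2(1) by simp
  then obtain P where P: "P tagged_division_of {0..T}" "mesh_less P (min d1 d2)" using fine_tagged_division_exists by blast
  then have "norm (stieltjes_sum y \<sigma> P - I) < e" "norm (stieltjes_sum y \<sigma> P - c) \<le> C"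
    using d1(2) d2(2) mesh_less_mono by (meson min.cobounded1 min.cobounded2)+
  moreover have "norm (I - c) \<le> norm (stieltjes_sum y \<sigma> P - c) + norm (stieltjes_sum y \<sigma> P - I)"
    using norm_triangle_ineq4[of "stieltjes_sum y \<sigma> P - c" "stieltjes_sum y \<sigma> P - I"] by simp
  ultimately show "norm (I - c) \<le> C + e" by linarith
qed

lemma has_stieltjes_integral_unique:
  assumes "has_stieltjes_integral 0 T y \<sigma> I" "has_stieltjes_integral 0 T y \<sigma> J"
  shows "I = J"
proof -
  have "norm (I - J) \<le> 0 + e" if ep: "0 < e" for e
  proof (rule has_stieltjes_integral_close[OF assms(1)])
    obtain d where "0 < d" "\<forall>P. P tagged_division_of {0..T} \<longrightarrow> mesh_less P d \<longrightarrow> norm (stieltjes_sum y \<sigma> P - J) < e"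
      using has_stieltjes_integralD[OF assms(2) ep] by blast
    then show "\<exists>\<delta>>0. \<forall>P. P tagged_division_of {0..T} \<longrightarrow> mesh_less P \<delta> \<longrightarrow> norm (stieltjes_sum y \<sigma> P - J) \<le> 0 + e"
      by (intro exI[of _ d]) (simp add: less_imp_le)
  qed
  then have "norm (I - J) \<le> 0" by (rule field_le_epsilon)
  then show ?thesis by simp
qed

text \<open>Sums over divisions of small mesh form a Cauchy family.\<close>
lemma has_stieltjes_integral_exists:
  assumes T: "0 < T" and bv: "bounded_variation_fn 0 T \<sigma>" and y: "continuous_on {0..T} y"
  shows "\<exists>I. has_stieltjes_integral 0 T y \<sigma> I"
proof -
  obtain v where v: "controls T v \<sigma>" using bounded_variation_controlled[OF bv] by blast
  define W where "W = v T - v 0 + 1"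
  have W: "v T - v 0 \<le> W" "0 < W" using controls_mono[OF v, of 0 T] T by (auto simp: W_def)
  have close: "\<exists>\<delta>>0. \<forall>P Q. P tagged_division_of {0..T} \<longrightarrow> Q tagged_division_of {0..T} \<longrightarrow> mesh_less P \<delta> \<longrightarrow> mesh_less Q \<delta> \<longrightarrow>
     norm (stieltjes_sum y \<sigma> P - stieltjes_sum y \<sigma> Q) \<le> e" if e: "0 < e" for e
  proof -
    obtain \<delta> where \<delta>: "0 < \<delta>" "\<forall>s\<in>{0..T}. \<forall>t\<in>{0..T}. \<bar>s - t\<bar> < 2 * \<delta> \<longrightarrow> norm (y s - y t) \<le> e / W"
      using continuous_modulus[OF y, of "e / W"] e W by auto
    have "e / W * (v T - v 0) \<le> e / W * W" using e W by (intro mult_left_mono) auto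
    also have "\<dots> = e" using W by simp
    finally show ?thesis
      using stieltjes_sum_close[OF less_imp_le[OF T] v _ _ _ _ \<delta>(2)] \<delta>(1) by (meson order_trans)
  qed
  have "\<forall>n. \<exists>P. P tagged_division_of {0..T} \<and> mesh_less P (inverse (real (Suc n)))"
    by (intro allI fine_tagged_division_exists) simp
  then obtain P where P: "\<And>n. P n tagged_division_of {0..T}" "\<And>n. mesh_less (P n) (inverse (real (Suc n)))" by metis
  have fine: "\<exists>N. \<forall>n\<ge>N. mesh_less (P n) \<delta>" if \<delta>: "0 < \<delta>" for \<delta>
  proof -
    obtain N where N: "inverse (real (Suc N)) < \<delta>" using reals_Archimedean[OF \<delta>] by blast
    have "mesh_less (P n) \<delta>" if "N \<le> n" for n
    proof (rule mesh_less_mono[OF P(2)])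
      have "inverse (real (Suc n)) \<le> inverse (real (Suc N))" using that by (intro le_imp_inverse_le) auto
      then show "inverse (real (Suc n)) \<le> \<delta>" using N by linarith
    qed
    then show ?thesis by blast
  qed
  have "Cauchy (\<lambda>n. stieltjes_sum y \<sigma> (P n))"
  proof (rule CauchyI)
    fix e :: real assume "0 < e"
    then have e: "0 < e / 2" by simp
    obtain \<delta> where \<delta>: "0 < \<delta>" "\<forall>P Q. P tagged_division_of {0..T} \<longrightarrow> Q tagged_division_of {0..T} \<longrightarrow> mesh_less P \<delta> \<longrightarrow> mesh_less Q \<delta> \<longrightarrow>
       norm (stieltjes_sum y \<sigma> P - stieltjes_sum y \<sigma> Q) \<le> e / 2" using close[OF e] by blast
    obtain N where N: "\<forall>n\<ge>N. mesh_less (P n) \<delta>" using fine[OF \<delta>(1)] by blast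
    show "\<exists>M. \<forall>m\<ge>M. \<forall>n\<ge>M. norm (stieltjes_sum y \<sigma> (P m) - stieltjes_sum y \<sigma> (P n)) < e"
    proof (intro exI[of _ N] allI impI)
      fix m n assume "N \<le> m" "N \<le> n"
      then have "norm (stieltjes_sum y \<sigma> (P m) - stieltjes_sum y \<sigma> (P n)) \<le> e / 2" using \<delta>(2) P(1) N by blast
      then show "norm (stieltjes_sum y \<sigma> (P m) - stieltjes_sum y \<sigma> (P n)) < e" using e by linarith
    qed
  qed
  then obtain I where I: "(\<lambda>n. stieltjes_sum y \<sigma> (P n)) \<longlonglongrightarrow> I"
    using Cauchy_convergent_iff convergent_def by metis
  have "has_stieltjes_integral 0 T y \<sigma> I"
    unfolding has_stieltjes_integral_iff
  proof (intro allI impI)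
    fix e :: real assume "0 < e"
    then have e: "0 < e / 2" by simp
    obtain \<delta> where \<delta>: "0 < \<delta>" "\<forall>P Q. P tagged_division_of {0..T} \<longrightarrow> Q tagged_division_of {0..T} \<longrightarrow> mesh_less P \<delta> \<longrightarrow> mesh_less Q \<delta> \<longrightarrow>
       norm (stieltjes_sum y \<sigma> P - stieltjes_sum y \<sigma> Q) \<le> e / 2" using close[OF e] by blast
    obtain N where N: "\<forall>n\<ge>N. mesh_less (P n) \<delta>" using fine[OF \<delta>(1)] by blast
    show "\<exists>\<delta>>0. \<forall>P. P tagged_division_of {0..T} \<longrightarrow> mesh_less P \<delta> \<longrightarrow> norm (stieltjes_sum y \<sigma> P - I) < e"
    proof (intro exI[of _ \<delta>] conjI \<delta>(1) allI impI)
      fix R assume R: "R tagged_division_of {0..T}" "mesh_less R \<delta>"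
      have "(\<lambda>n. norm (stieltjes_sum y \<sigma> R - stieltjes_sum y \<sigma> (P n))) \<longlonglongrightarrow> norm (stieltjes_sum y \<sigma> R - I)"
        by (intro tendsto_intros I)
      moreover have "\<forall>n\<ge>N. norm (stieltjes_sum y \<sigma> R - stieltjes_sum y \<sigma> (P n)) \<le> e / 2"
        using \<delta>(2) R P(1) N by blast
      ultimately have "norm (stieltjes_sum y \<sigma> R - I) \<le> e / 2"
        by (intro LIMSEQ_le_const2) blast+
      then show "norm (stieltjes_sum y \<sigma> R - I) < e" using e by linarith
    qed
  qed
  then show ?thesis by blast
qed

lemma U_form_has_stieltjes_integral:
  assumes "0 < T" "bounded_variation_fn 0 T \<sigma>" "continuous_on {0..T} y"
  shows "has_stieltjes_integral 0 T y \<sigma> (U_form T \<sigma> y)"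
proof -
  obtain I where I: "has_stieltjes_integral 0 T y \<sigma> I" using has_stieltjes_integral_exists[OF assms] by blast
  have "U_form T \<sigma> y = I" unfolding U_form_def stieltjes_integral_def
    by (rule the_equality, rule I, rule has_stieltjes_integral_unique[OF _ I])
  then show ?thesis using I by simp
qed

lemma U_form_close:
  assumes "0 < T" "bounded_variation_fn 0 T \<sigma>" "continuous_on {0..T} y"
    and "\<exists>\<delta>>0. \<forall>P. P tagged_division_of {0..T} \<longrightarrow> mesh_less P \<delta> \<longrightarrow> norm (stieltjes_sum y \<sigma> P - c) \<le> C"
  shows "norm (U_form T \<sigma> y - c) \<le> C"
  by (rule has_stieltjes_integral_close[OF U_form_has_stieltjes_integral[OF assms(1-3)] assms(4)])

lemma has_stieltjes_integral_add:
  assumes "has_stieltjes_integral 0 T y \<sigma> I" "has_stieltjes_integral 0 T z \<sigma> J"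
  shows "has_stieltjes_integral 0 T (\<lambda>x. y x + z x) \<sigma> (I + J)"
  unfolding has_stieltjes_integral_iff
proof (intro allI impI)
  fix e :: real assume "0 < e"
  then have e: "0 < e / 2" by simp
  obtain d1 where d1: "0 < d1" "\<forall>P. P tagged_division_of {0..T} \<longrightarrow> mesh_less P d1 \<longrightarrow> norm (stieltjes_sum y \<sigma> P - I) < e / 2"
    using has_stieltjes_integralD[OF assms(1) e] by blast
  obtain d2 where d2: "0 < d2" "\<forall>P. P tagged_division_of {0..T} \<longrightarrow> mesh_less P d2 \<longrightarrow> norm (stieltjes_sum z \<sigma> P - J) < e / 2"
    using has_stieltjes_integralD[OF assms(2) e] by blast
  show "\<exists>\<delta>>0. \<forall>P. P tagged_division_of {0..T} \<longrightarrow> mesh_less P \<delta> \<longrightarrow> norm (stieltjes_sum (\<lambda>x. y x + z x) \<sigma> P - (I + J)) < e"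
  proof (intro exI[of _ "min d1 d2"] conjI allI impI)
    fix P assume P: "P tagged_division_of {0..T}" "mesh_less P (min d1 d2)"
    then have "norm (stieltjes_sum y \<sigma> P - I) < e / 2" "norm (stieltjes_sum z \<sigma> P - J) < e / 2"
      using d1(2) d2(2) mesh_less_mono by (meson min.cobounded1 min.cobounded2)+
    then have "norm ((stieltjes_sum y \<sigma> P - I) + (stieltjes_sum z \<sigma> P - J)) < e"
      using norm_triangle_ineq[of "stieltjes_sum y \<sigma> P - I" "stieltjes_sum z \<sigma> P - J"] by linarith
    moreover have "stieltjes_sum (\<lambda>x. y x + z x) \<sigma> P = stieltjes_sum y \<sigma> P + stieltjes_sum z \<sigma> P"
      by (simp add: stieltjes_sum_def sum.distrib case_prod_beta distrib_right)
    ultimately show "norm (stieltjes_sum (\<lambda>x. y x + z x) \<sigma> P - (I + J)) < e"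
      by (simp add: algebra_simps)
  qed (use d1 d2 in simp)
qed

lemma has_stieltjes_integral_cmult:
  assumes "has_stieltjes_integral 0 T y \<sigma> I"
  shows "has_stieltjes_integral 0 T (\<lambda>x. c * y x) \<sigma> (c * I)"
  unfolding has_stieltjes_integral_iff
proof (intro allI impI)
  fix e :: real assume "0 < e"
  have cp: "0 < norm c + 1" by (simp add: add_nonneg_pos)
  then have e: "0 < e / (norm c + 1)" using \<open>0 < e\<close> by simp
  obtain d where d: "0 < d" "\<forall>P. P tagged_division_of {0..T} \<longrightarrow> mesh_less P d \<longrightarrow> norm (stieltjes_sum y \<sigma> P - I) < e / (norm c + 1)"
    using has_stieltjes_integralD[OF assms(1) e] by blast
  show "\<exists>\<delta>>0. \<forall>P. P tagged_division_of {0..T} \<longrightarrow> mesh_less P \<delta> \<longrightarrow> norm (stieltjes_sum (\<lambda>x. c * y x) \<sigma> P - c * I) < e"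
  proof (intro exI[of _ d] conjI allI impI d(1))
    fix P assume P: "P tagged_division_of {0..T}" "mesh_less P d"
    have *: "norm (stieltjes_sum y \<sigma> P - I) < e / (norm c + 1)" using d(2) P by blast
    have "stieltjes_sum (\<lambda>x. c * y x) \<sigma> P - c * I = c * (stieltjes_sum y \<sigma> P - I)"
      by (simp add: stieltjes_sum_def sum_distrib_left case_prod_beta right_diff_distrib mult.assoc)
    then have "norm (stieltjes_sum (\<lambda>x. c * y x) \<sigma> P - c * I) = norm c * norm (stieltjes_sum y \<sigma> P - I)" by (simp add: norm_mult)
    also have "\<dots> \<le> (norm c + 1) * norm (stieltjes_sum y \<sigma> P - I)" by (intro mult_right_mono) auto
    also have "\<dots> < (norm c + 1) * (e / (norm c + 1))" using * cp by (intro mult_strict_left_mono)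
    also have "\<dots> = e" using cp by simp
    finally show "norm (stieltjes_sum (\<lambda>x. c * y x) \<sigma> P - c * I) < e" .
  qed
qed

lemma norm_stieltjes_sum_le:
  assumes "controls T v \<sigma>" "P tagged_division_of {0..T}" "\<And>t K. (t, K) \<in> P \<Longrightarrow> norm (y t) \<le> m t K"
  shows "norm (stieltjes_sum y \<sigma> P) \<le> (\<Sum>(t, K)\<in>P. m t K * (v (Sup K) - v (Inf K)))"
  unfolding stieltjes_sum_def
proof (rule order_trans[OF norm_sum], rule sum_mono, clarify)
  fix t K assume tK: "(t, K) \<in> P"
  note K = tagged_interval[OF assms(2) tK]
  have "norm (\<sigma> (Sup K) - \<sigma> (Inf K)) \<le> v (Sup K) - v (Inf K)"
    using assms(1) K unfolding controls_def by blast
  then show "norm (y t * (\<sigma> (Sup K) - \<sigma> (Inf K))) \<le> m t K * (v (Sup K) - v (Inf K))"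
    unfolding norm_mult using assms(3)[OF tK] by (intro mult_mono) (auto intro: order_trans[OF norm_ge_zero])
qed

lemma U_form_linear:
  assumes "0 < T" "bounded_variation_fn 0 T \<sigma>" "continuous_on {0..T} y" "continuous_on {0..T} z"
  shows "U_form T \<sigma> (\<lambda>x. y x + z x) = U_form T \<sigma> y + U_form T \<sigma> z"
    "U_form T \<sigma> (\<lambda>x. c * y x) = c * U_form T \<sigma> y"
proof -
  note Uy = U_form_has_stieltjes_integral[OF assms(1-3)] and Uz = U_form_has_stieltjes_integral[OF assms(1,2,4)]
  have "continuous_on {0..T} (\<lambda>x. y x + z x)" "continuous_on {0..T} (\<lambda>x. c * y x)" using assms by (auto intro: continuous_intros)
  note U = this[THEN U_form_has_stieltjes_integral[OF assms(1,2)]]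
  show "U_form T \<sigma> (\<lambda>x. y x + z x) = U_form T \<sigma> y + U_form T \<sigma> z"
    by (rule has_stieltjes_integral_unique[OF U(1) has_stieltjes_integral_add[OF Uy Uz]])
  show "U_form T \<sigma> (\<lambda>x. c * y x) = c * U_form T \<sigma> y"
    by (rule has_stieltjes_integral_unique[OF U(2) has_stieltjes_integral_cmult[OF Uy]])
qed

lemma reflected_U_form_bounded:
  assumes T: "0 < T" and bv: "bounded_variation_fn 0 T \<sigma>"
  shows "bounded_functional T (\<lambda>y. U_form T \<sigma> (\<lambda>x. y (T - x)))"
  unfolding bounded_functional_def
proof (intro conjI allI impI)
  have cont: "continuous_on {0..T} (\<lambda>x. y (T - x))" if "continuous_on {0..T} y" for y :: "real \<Rightarrow> complex"
    by (rule continuous_on_compose2[OF that]) (auto intro!: continuous_intros)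
  show "U_form T \<sigma> (\<lambda>x. y (T - x) + z (T - x)) = U_form T \<sigma> (\<lambda>x. y (T - x)) + U_form T \<sigma> (\<lambda>x. z (T - x))"
    if "continuous_on {0..T} y" "continuous_on {0..T} z" for y z
    using that by (intro U_form_linear(1)[OF T bv] cont)
  show "U_form T \<sigma> (\<lambda>x. c * y (T - x)) = c * U_form T \<sigma> (\<lambda>x. y (T - x))"
    if "continuous_on {0..T} y" for c y
    using that by (intro U_form_linear(2)[OF T bv] cont)
  obtain v where v: "controls T v \<sigma>" using bounded_variation_controlled[OF bv] by blast
  have T0: "0 \<le> T" using T by simp
  show "\<exists>K\<ge>0. \<forall>f M. continuous_on {0..T} f \<longrightarrow> (\<forall>x\<in>{0..T}. norm (f x) \<le> M) \<longrightarrow> norm (U_form T \<sigma> (\<lambda>x. f (T - x))) \<le> K * M"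
  proof (intro exI[of _ "v T - v 0"] conjI allI impI)
    fix f :: "real \<Rightarrow> complex" and M assume f: "continuous_on {0..T} f" "\<forall>x\<in>{0..T}. norm (f x) \<le> M"
    have "norm (U_form T \<sigma> (\<lambda>x. f (T - x)) - 0) \<le> (v T - v 0) * M"
    proof (rule U_form_close[OF T bv cont[OF f(1)]], intro exI[of _ 1] conjI allI impI)
      fix P assume P: "P tagged_division_of {0..T}"
      have "norm (stieltjes_sum (\<lambda>x. f (T - x)) \<sigma> P) \<le> (\<Sum>(t, K)\<in>P. M * (v (Sup K) - v (Inf K)))"
        by (rule norm_stieltjes_sum_le[OF v P]) (use f(2) tagged_interval(6)[OF P] in auto)
      also have "\<dots> = (v T - v 0) * M"
        using tagged_telescope[OF P T0, of v] by (simp add: sum_distrib_left[symmetric] case_prod_beta)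
      finally show "norm (stieltjes_sum (\<lambda>x. f (T - x)) \<sigma> P - 0) \<le> (v T - v 0) * M" by simp
    qed simp
    then show "norm (U_form T \<sigma> (\<lambda>x. f (T - x))) \<le> (v T - v 0) * M" by simp
  qed (use controls_mono[OF v, of 0 T] T in simp)
qed

text \<open>
  The values of a nondecreasing function on \<open>(0, T]\<close> come arbitrarily close to their
  infimum \<open>\<nu>\<close>. Measured from \<open>\<nu>\<close>, the majorant of
  \<open>\<sigma>\<close> is therefore small near \<open>0\<close>, and it still controls
  \<open>\<sigma>\<close> once its value at \<open>0\<close> is replaced by the right limit there.
\<close>
lemma controls_after_jump:
  assumes T: "0 < T" and v: "controls T v \<sigma>"
  shows "\<exists>l w. (\<sigma> \<longlongrightarrow> l) (at_right 0) \<and> controls T w (\<lambda>x. if x = 0 then l else \<sigma> x) \<and> w 0 = 0 \<and>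
     (\<forall>e>0. \<exists>\<eta>>0. \<eta> \<le> T \<and> w \<eta> \<le> e)"
proof -
  define \<nu> where "\<nu> = Inf (v ` {0<..T})"
  have bdd: "bdd_below (v ` {0<..T})" using controls_mono[OF v, of 0] by (intro bdd_belowI2[of _ "v 0"]) auto
  have ne: "v ` {0<..T} \<noteq> {}" using T by auto
  have \<nu>: "\<nu> \<le> v x" if "0 < x" "x \<le> T" for x unfolding \<nu>_def using that bdd by (intro cInf_lower) auto
  have small: "\<exists>\<eta>>0. \<eta> \<le> T \<and> v \<eta> - \<nu> < e" if e: "0 < e" for e
  proof -
    have "Inf (v ` {0<..T}) < \<nu> + e" using e by (simp add: \<nu>_def)
    then obtain r where "r \<in> v ` {0<..T}" "r < \<nu> + e" using cInf_lessD[OF ne] by blast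
    then show ?thesis by auto
  qed
  define s where "s n = T * inverse (real (Suc n))" for n
  have s: "0 < s n" "s n \<le> T" for n
    using T by (auto simp: s_def inverse_eq_divide divide_le_eq)
  have s0: "s \<longlonglongrightarrow> 0" unfolding s_def using tendsto_mult[OF tendsto_const[of T] LIMSEQ_inverse_real_of_nat] by simp
  have ev: "\<exists>N. \<forall>n\<ge>N. s n \<le> x" if "0 < x" for x
  proof -
    have "\<forall>\<^sub>F n in sequentially. s n < x" using s0 that by (rule order_tendstoD)
    then show ?thesis unfolding eventually_sequentially by (meson less_imp_le)
  qed
  have inc: "norm (\<sigma> x - \<sigma> y) \<le> v x - \<nu>" if "0 < y" "y \<le> x" "x \<le> T" for x y
  proof -
    have "norm (\<sigma> x - \<sigma> y) \<le> v x - v y" using v that unfolding controls_def by auto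
    then show ?thesis using \<nu>[of y] that by linarith
  qed
  have "Cauchy (\<lambda>n. \<sigma> (s n))"
  proof (rule CauchyI)
    fix e :: real assume e: "0 < e"
    obtain \<eta> where \<eta>: "0 < \<eta>" "\<eta> \<le> T" "v \<eta> - \<nu> < e" using small[OF e] by blast
    obtain N where N: "\<forall>n\<ge>N. s n \<le> \<eta>" using ev[OF \<eta>(1)] by blast
    have *: "norm (\<sigma> a - \<sigma> b) < e" if "0 < a" "a \<le> \<eta>" "0 < b" "b \<le> \<eta>" "b \<le> a" for a b
      using inc[of b a] that \<eta> controls_mono[OF v, of a \<eta>] by linarith
    show "\<exists>M. \<forall>m\<ge>M. \<forall>n\<ge>M. norm (\<sigma> (s m) - \<sigma> (s n)) < e"
    proof (intro exI[of _ N] allI impI)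
      fix m n assume "N \<le> m" "N \<le> n"
      then show "norm (\<sigma> (s m) - \<sigma> (s n)) < e"
        using *[of "s m" "s n"] *[of "s n" "s m"] N s by (cases "s n \<le> s m") (auto simp: norm_minus_commute)
    qed
  qed
  then obtain l where l: "(\<lambda>n. \<sigma> (s n)) \<longlonglongrightarrow> l" using Cauchy_convergent_iff convergent_def by metis
  have lb: "norm (\<sigma> x - l) \<le> v x - \<nu>" if x: "0 < x" "x \<le> T" for x
  proof -
    obtain N where N: "\<forall>n\<ge>N. s n \<le> x" using ev[OF x(1)] by blast
    have "(\<lambda>n. norm (\<sigma> x - \<sigma> (s n))) \<longlonglongrightarrow> norm (\<sigma> x - l)" by (intro tendsto_intros l)
    moreover have "\<forall>n\<ge>N. norm (\<sigma> x - \<sigma> (s n)) \<le> v x - \<nu>" using inc[OF s(1) _ x(2)] N by blast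
    ultimately show ?thesis by (intro LIMSEQ_le_const2) blast+
  qed
  have lim: "(\<sigma> \<longlongrightarrow> l) (at_right 0)"
  proof (rule tendstoI)
    fix e :: real assume e: "0 < e"
    obtain \<eta> where \<eta>: "0 < \<eta>" "\<eta> \<le> T" "v \<eta> - \<nu> < e" using small[OF e] by blast
    show "\<forall>\<^sub>F x in at_right 0. dist (\<sigma> x) l < e"
      unfolding eventually_at_right[OF \<eta>(1)]
    proof (intro exI[of _ \<eta>] conjI \<eta>(1) allI impI)
      fix x assume "0 < x" "x < \<eta>"
      then show "dist (\<sigma> x) l < e"
        using lb[of x] \<eta> controls_mono[OF v, of x \<eta>] by (simp add: dist_norm)
    qed
  qed
  define w where "w x = (if x = 0 then 0 else v x - \<nu>)" for x
  have "controls T w (\<lambda>x. if x = 0 then l else \<sigma> x)"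
    unfolding controls_def
  proof (intro allI impI)
    fix a b assume ab: "0 \<le> a" "a \<le> b" "b \<le> T"
    consider "a = 0" "b = 0" | "a = 0" "0 < b" | "0 < a" using ab by linarith
    then show "norm ((if b = 0 then l else \<sigma> b) - (if a = 0 then l else \<sigma> a)) \<le> w b - w a"
    proof cases
      case 2 then show ?thesis using lb[of b] ab by (simp add: w_def)
    next
      case 3 then show ?thesis using v ab unfolding controls_def by (simp add: w_def)
    qed (simp add: w_def)
  qed
  moreover have "\<forall>e>0. \<exists>\<eta>>0. \<eta> \<le> T \<and> w \<eta> \<le> e"
  proof (intro allI impI)
    fix e :: real assume "0 < e"
    then obtain \<eta> where "0 < \<eta>" "\<eta> \<le> T" "v \<eta> - \<nu> < e" using small by blast
    then show "\<exists>\<eta>>0. \<eta> \<le> T \<and> w \<eta> \<le> e" by (intro exI[of _ \<eta>]) (auto simp: w_def)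
  qed
  ultimately show ?thesis using lim by (intro exI[of _ l] exI[of _ w]) (auto simp: w_def)
qed

text \<open>
  The integrator is the sum of a step of height \<open>H\<close> at \<open>0\<close> and a function
  \<open>\<sigma>0\<close> of small variation on \<open>[0, \<eta>]\<close>. In the Stieltjes sums
  the step contributes nearly \<open>H\<close> times the value at \<open>0\<close>; the contribution
  of \<open>\<sigma>0\<close> is estimated separately on \<open>[0, \<eta>]\<close> and on the rest.
  Under the reflection \<open>0\<close> becomes the end \<open>T\<close>.
\<close>
lemma reflected_U_form_end_functional:
  assumes T: "0 < T" and bv: "bounded_variation_fn 0 T \<sigma>"
  shows "end_functional T (jump_at_0 \<sigma>) (\<lambda>y. U_form T \<sigma> (\<lambda>x. y (T - x)))"
  unfolding end_functional_def
proof (intro conjI reflected_U_form_bounded[OF T bv] allI impI)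
  fix \<epsilon> :: real assume \<epsilon>: "0 < \<epsilon>"
  have T0: "0 \<le> T" using T by simp
  obtain v where v: "controls T v \<sigma>" using bounded_variation_controlled[OF bv] by blast
  obtain l w where l: "(\<sigma> \<longlongrightarrow> l) (at_right 0)" and w: "controls T w (\<lambda>x. if x = 0 then l else \<sigma> x)" "w 0 = 0"
    and small: "\<forall>e>0. \<exists>\<eta>>0. \<eta> \<le> T \<and> w \<eta> \<le> e"
    using controls_after_jump[OF T v] by blast
  define H where "H = jump_at_0 \<sigma>"
  have H: "H = l - \<sigma> 0" unfolding H_def jump_at_0_def using tendsto_Lim[OF _ l] by simp
  define \<sigma>0 where "\<sigma>0 x = (if x = 0 then l else \<sigma> x)" for x
  define hstep where "hstep x = (if 0 < x then H else 0)" for x :: real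
  have w0: "controls T w \<sigma>0" using w(1) unfolding \<sigma>0_def[abs_def] .
  obtain \<eta> where \<eta>: "0 < \<eta>" "\<eta> \<le> T" "w \<eta> \<le> \<epsilon>" using small \<epsilon> by blast
  have wT: "0 \<le> w T" using controls_mono[OF w0, of 0 T] T w(2) by simp
  show "\<exists>\<delta>>0. \<exists>K\<ge>0. \<forall>f M1 M2. continuous_on {0..T} f \<longrightarrow> (\<forall>x\<in>{0..T}. norm (f x) \<le> M1) \<longrightarrow>
        (\<forall>x\<in>{0..T - \<delta>}. norm (f x) \<le> M2) \<longrightarrow> norm (U_form T \<sigma> (\<lambda>x. f (T - x)) - jump_at_0 \<sigma> * f T) \<le> \<epsilon> * M1 + K * M2"
  proof (rule exI[of _ "\<eta> / 2"], rule conjI, simp add: \<eta>, rule exI[of _ "w T"], intro conjI wT allI impI)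
    fix f :: "real \<Rightarrow> complex" and M1 M2
    assume f: "continuous_on {0..T} f" "\<forall>x\<in>{0..T}. norm (f x) \<le> M1" "\<forall>x\<in>{0..T - \<eta> / 2}. norm (f x) \<le> M2"
    define y where "y x = f (T - x)" for x
    have y: "continuous_on {0..T} y" unfolding y_def
      by (rule continuous_on_compose2[OF f(1)]) (auto intro!: continuous_intros)
    have M1: "norm (y x) \<le> M1" if "x \<in> {0..T}" for x using f(2) that by (auto simp: y_def)
    have M2: "norm (y x) \<le> M2" if "x \<in> {\<eta> / 2..T}" for x using f(3) that by (auto simp: y_def)
    have M0: "0 \<le> M1" "0 \<le> M2"
      using order_trans[OF norm_ge_zero M1[of T]] order_trans[OF norm_ge_zero M2[of T]] T \<eta> by auto
    have "norm (U_form T \<sigma> y - H * y 0) \<le> (\<epsilon> * M1 + w T * M2) + e" if e: "0 < e" for e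
    proof (rule U_form_close[OF T bv y])
      define \<omega> where "\<omega> = e / (norm H + 1)"
      have Hp: "0 < norm H + 1" by (simp add: add_nonneg_pos)
      have \<omega>: "0 < \<omega>" "\<omega> * norm H \<le> e" using e Hp by (auto simp: \<omega>_def field_simps)
      obtain \<delta> where \<delta>: "0 < \<delta>" "\<forall>s\<in>{0..T}. \<forall>t\<in>{0..T}. \<bar>s - t\<bar> < 2 * \<delta> \<longrightarrow> norm (y s - y t) \<le> \<omega>"
        using continuous_modulus[OF y \<omega>(1)] by blast
      show "\<exists>\<delta>>0. \<forall>P. P tagged_division_of {0..T} \<longrightarrow> mesh_less P \<delta> \<longrightarrow> norm (stieltjes_sum y \<sigma> P - H * y 0) \<le> (\<epsilon> * M1 + w T * M2) + e"
      proof (intro exI[of _ "min \<delta> (\<eta> / 2)"] conjI allI impI)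
        fix P assume P: "P tagged_division_of {0..T}" and mesh: "mesh_less P (min \<delta> (\<eta> / 2))"
        note I = tagged_interval[OF P]
        have "stieltjes_sum y \<sigma> P = stieltjes_sum y \<sigma>0 P + stieltjes_sum y hstep P"
        proof -
          have "\<sigma> (Sup K) - \<sigma> (Inf K) = (\<sigma>0 (Sup K) - \<sigma>0 (Inf K)) + (hstep (Sup K) - hstep (Inf K))" if "(t, K) \<in> P" for t K
          proof -
            have "\<sigma> b - \<sigma> a = (\<sigma>0 b - \<sigma>0 a) + (hstep b - hstep a)" if "0 \<le> a" "a \<le> b" for a b
              using that by (cases "a = 0"; cases "b = 0") (auto simp: \<sigma>0_def hstep_def H)
            then show ?thesis using I[OF that] by blast
          qed
          then have "stieltjes_sum y \<sigma> P = (\<Sum>(t, K)\<in>P. y t * (\<sigma>0 (Sup K) - \<sigma>0 (Inf K)) + y t * (hstep (Sup K) - hstep (Inf K)))"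
            unfolding stieltjes_sum_def by (intro sum.cong) (auto simp: distrib_left)
          then show ?thesis by (simp add: stieltjes_sum_def sum.distrib case_prod_beta)
        qed
        moreover have "stieltjes_sum y hstep P - H * y 0 = stieltjes_sum (\<lambda>t. y t - y 0) hstep P"
        proof -
          have "(\<Sum>(t, K)\<in>P. y 0 * (hstep (Sup K) - hstep (Inf K))) = y 0 * H"
            using tagged_telescope[OF P T0, of hstep] T by (simp add: sum_distrib_left[symmetric] case_prod_beta hstep_def)
          then show ?thesis
            by (simp add: stieltjes_sum_def left_diff_distrib sum_subtractf case_prod_beta mult.commute)
        qed
        ultimately have "norm (stieltjes_sum y \<sigma> P - H * y 0) \<le> norm (stieltjes_sum y \<sigma>0 P) + norm (stieltjes_sum (\<lambda>t. y t - y 0) hstep P)"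
          by (metis add_diff_eq norm_triangle_ineq)
        also have "norm (stieltjes_sum (\<lambda>t. y t - y 0) hstep P) \<le> e"
        proof -
          define hstep' where "hstep' x = (if 0 < x then norm H else 0)" for x :: real
          have "norm (stieltjes_sum (\<lambda>t. y t - y 0) hstep P) \<le> (\<Sum>(t, K)\<in>P. \<omega> * (hstep' (Sup K) - hstep' (Inf K)))"
            unfolding stieltjes_sum_def
          proof (rule order_trans[OF norm_sum], rule sum_mono, clarify)
            fix t K assume tK: "(t, K) \<in> P"
            note K = I[OF tK]
            show "norm ((y t - y 0) * (hstep (Sup K) - hstep (Inf K))) \<le> \<omega> * (hstep' (Sup K) - hstep' (Inf K))"
            proof (cases "Inf K = 0 \<and> 0 < Sup K")
              case True
              have "Sup K - Inf K < \<delta>" using mesh tK by (auto simp: mesh_less_def)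
              then have "\<bar>t - 0\<bar> < 2 * \<delta>" using True K by linarith
              then have "norm (y t - y 0) \<le> \<omega>" using \<delta>(2) K(6) T by auto
              then show ?thesis using True by (simp add: hstep_def hstep'_def norm_mult mult_right_mono)
            next
              case False
              then have "hstep (Sup K) = hstep (Inf K)" "hstep' (Sup K) = hstep' (Inf K)"
                using K(4,7) by (auto simp: hstep_def hstep'_def)
              then show ?thesis by simp
            qed
          qed
          also have "\<dots> = \<omega> * norm H"
            using tagged_telescope[OF P T0, of hstep'] T by (simp add: sum_distrib_left[symmetric] case_prod_beta hstep'_def)
          finally show ?thesis using \<omega>(2) by linarith
        qed
        also have "norm (stieltjes_sum y \<sigma>0 P) \<le> \<epsilon> * M1 + w T * M2"
        proof -
          have "norm (stieltjes_sum y \<sigma>0 P) \<le> (\<Sum>(t, K)\<in>P. (if Sup K \<le> \<eta> then M1 else M2) * (w (Sup K) - w (Inf K)))"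
          proof (rule norm_stieltjes_sum_le[OF w0 P])
            fix t K assume tK: "(t, K) \<in> P"
            note K = I[OF tK]
            have "Sup K - Inf K < \<eta> / 2" using mesh tK by (auto simp: mesh_less_def)
            then show "norm (y t) \<le> (if Sup K \<le> \<eta> then M1 else M2)"
              using M1[OF K(6)] M2[of t] K by auto
          qed
          also have "\<dots> \<le> (\<Sum>(t, K)\<in>P. M1 * (w (min \<eta> (Sup K)) - w (min \<eta> (Inf K))) + M2 * (w (Sup K) - w (Inf K)))"
          proof (rule sum_mono, clarify)
            fix t K assume tK: "(t, K) \<in> P"
            note K = I[OF tK]
            have 1: "0 \<le> M2 * (w (Sup K) - w (Inf K))"
              using M0 controls_mono[OF w0, of "Inf K" "Sup K"] K by (intro mult_nonneg_nonneg) auto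
            have 2: "0 \<le> M1 * (w (min \<eta> (Sup K)) - w (min \<eta> (Inf K)))"
              using M0 controls_mono[OF w0, of "min \<eta> (Inf K)" "min \<eta> (Sup K)"] K \<eta> by (intro mult_nonneg_nonneg) (auto simp: min_def)
            show "(if Sup K \<le> \<eta> then M1 else M2) * (w (Sup K) - w (Inf K)) \<le>
               M1 * (w (min \<eta> (Sup K)) - w (min \<eta> (Inf K))) + M2 * (w (Sup K) - w (Inf K))"
            proof (cases "Sup K \<le> \<eta>")
              case True
              then have "min \<eta> (Sup K) = Sup K" "min \<eta> (Inf K) = Inf K" using K by auto
              then show ?thesis using 1 True by simp
            qed (use 2 in simp)
          qed
          also have "\<dots> = M1 * (w (min \<eta> T) - w (min \<eta> 0)) + M2 * (w T - w 0)"
            using tagged_telescope[OF P T0, of "\<lambda>x. w (min \<eta> x)"] tagged_telescope[OF P T0, of w]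
            by (simp add: sum.distrib sum_distrib_left[symmetric] case_prod_beta)
          also have "\<dots> = M1 * w \<eta> + M2 * w T" using \<eta> w(2) by simp
          also have "\<dots> \<le> \<epsilon> * M1 + w T * M2" using M0 \<eta>(3) mult_left_mono[OF \<eta>(3) M0(1)] by (simp add: mult.commute)
          finally show ?thesis .
        qed
        finally show "norm (stieltjes_sum y \<sigma> P - H * y 0) \<le> (\<epsilon> * M1 + w T * M2) + e" by simp
      qed (use \<delta> \<eta> in simp)
    qed
    then have "norm (U_form T \<sigma> y - H * y 0) \<le> \<epsilon> * M1 + w T * M2" by (rule field_le_epsilon)
    then show "norm (U_form T \<sigma> (\<lambda>x. f (T - x)) - jump_at_0 \<sigma> * f T) \<le> \<epsilon> * M1 + w T * M2"
      by (simp add: y_def[abs_def] H_def)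
  qed
qed

section \<open>Solutions of the pencil as Caratheodory pairs\<close>

lemma AE_lebesgue_on_open_interval_iff:
  "(AE x in lebesgue_on {0<..<T::real}. P x) \<longleftrightarrow> (\<exists>N. negligible N \<and> (\<forall>x\<in>{0<..<T} - N. P x))"
proof
  assume "AE x in lebesgue_on {0<..<T}. P x"
  then obtain N where N: "N \<in> null_sets (lebesgue_on {0<..<T})" "{x \<in> space (lebesgue_on {0<..<T}). \<not> P x} \<subseteq> N"
    unfolding eventually_ae_filter by blast
  have "N \<in> null_sets lebesgue" using N(1) by (subst (asm) null_sets_restrict_space) auto
  then show "\<exists>N. negligible N \<and> (\<forall>x\<in>{0<..<T} - N. P x)"
    using N(2) by (intro exI[of _ N]) (auto simp: negligible_iff_null_sets)
next
  assume "\<exists>N. negligible N \<and> (\<forall>x\<in>{0<..<T} - N. P x)"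
  then obtain N where N: "negligible N" "\<And>x. x \<in> {0<..<T} - N \<Longrightarrow> P x" by blast
  have "AE x in lebesgue. x \<in> {0<..<T} \<longrightarrow> P x"
    by (rule AE_I'[of N]) (use N in \<open>auto simp: negligible_iff_null_sets\<close>)
  then show "AE x in lebesgue_on {0<..<T}. P x" by (subst AE_restrict_space_iff) auto
qed

lemma pencil_solution_imp_pair:
  assumes co: "pencil_coeffs T p q" and y: "pencil_solution T p q \<mu> y"
  shows "pencil_pair T p q \<mu> y (D_on T y)"
  unfolding pencil_pair_def
proof
  note T = pencil_coeffs_D(1)[OF co]
  have acz: "absolutely_continuous_fn 0 T (D_on T y)" and diff: "\<forall>x\<in>{0..T}. y differentiable (at x within {0..T})"
    and ae: "AE x in lebesgue_on {0<..<T}. \<exists>y2. (D_on T y has_vector_derivative y2) (at x) \<and> y2 + (\<mu>\<^sup>2 - 2 * \<mu> * p x - q x) * y x = 0"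
    using y unfolding pencil_solution_def by auto
  show yz: "has_ac_density T y (D_on T y)"
  proof (rule ac_density_C1)
    show "(y has_vector_derivative D_on T y x) (at x within {0..T})" if "x \<in> {0..T}" for x
      unfolding D_on_def using diff that vector_derivative_works by blast
  qed (rule absolutely_continuous_fn_continuous[OF acz])
  obtain N where N: "negligible N" "\<forall>x\<in>{0<..<T} - N. \<exists>y2. (D_on T y has_vector_derivative y2) (at x) \<and> y2 + (\<mu>\<^sup>2 - 2 * \<mu> * p x - q x) * y x = 0"
    using ae unfolding AE_lebesgue_on_open_interval_iff by blast
  show "has_ac_density T (D_on T y) (\<lambda>x. (q x + 2 * \<mu> * p x - \<mu>\<^sup>2) * y x)"
  proof (rule ac_densityI[OF acz])
    show "(\<lambda>x. (q x + 2 * \<mu> * p x - \<mu>\<^sup>2) * y x) absolutely_integrable_on {0..T}"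
      using absolutely_integrable_continuous_mult[OF ac_density_continuous[OF yz] potential_absolutely_integrable[OF co, of \<mu>]]
      by (simp add: mult.commute)
    show "negligible (N \<union> {0, T})" using N(1) by simp
    fix x assume x: "x \<in> {0..T} - (N \<union> {0, T})"
    then obtain y2 where y2: "(D_on T y has_vector_derivative y2) (at x)" "y2 + (\<mu>\<^sup>2 - 2 * \<mu> * p x - q x) * y x = 0"
      using N(2) by force
    have "y2 = (q x + 2 * \<mu> * p x - \<mu>\<^sup>2) * y x" using y2(2) by (simp add: algebra_simps add_eq_0_iff2)
    with y2(1) show "(D_on T y has_vector_derivative (q x + 2 * \<mu> * p x - \<mu>\<^sup>2) * y x) (at x)" by simp
  qed
qed

lemma pair_imp_pencil_solution:
  assumes co: "pencil_coeffs T p q" and yz: "pencil_pair T p q \<mu> y z"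
  shows "pencil_solution T p q \<mu> y" "x \<in> {0..T} \<Longrightarrow> D_on T y x = z x"
proof -
  note T = pencil_coeffs_D(1)[OF co]
  have ac: "has_ac_density T y z" "has_ac_density T z (\<lambda>x. (q x + 2 * \<mu> * p x - \<mu>\<^sup>2) * y x)"
    using yz unfolding pencil_pair_def by auto
  note der = pencil_pair_derivative[OF yz]
  have diff: "y differentiable (at x within {0..T})" if "x \<in> {0..T}" for x
    using der[OF that] by (rule differentiableI_vector)
  have Dz: "D_on T y x = z x" if x: "x \<in> {0..T}" for x
    unfolding D_on_def
    using has_vector_derivative_unique_Icc[OF T x _ der[OF x]] diff[OF x] vector_derivative_works by blast
  then show "x \<in> {0..T} \<Longrightarrow> D_on T y x = z x" .
  have acD: "absolutely_continuous_fn 0 T (D_on T y)"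
    using ac_density_absolutely_continuous[OF ac(2)] ac_density_absolutely_continuous[OF ac(2)]
    by (rule absolutely_continuous_fn_dominated[of _ _ _ _ 1]) (auto simp: Dz)
  obtain N where N: "negligible N" "\<And>x. x \<in> {0..T} - N \<Longrightarrow> (z has_vector_derivative (q x + 2 * \<mu> * p x - \<mu>\<^sup>2) * y x) (at x)"
    by (rule ac_density_derivative[OF ac(2)]) blast
  have "AE x in lebesgue_on {0<..<T}. \<exists>y2. (D_on T y has_vector_derivative y2) (at x) \<and> y2 + (\<mu>\<^sup>2 - 2 * \<mu> * p x - q x) * y x = 0"
    unfolding AE_lebesgue_on_open_interval_iff
  proof (intro exI[of _ N] conjI N(1) ballI)
    fix x assume x: "x \<in> {0<..<T} - N"
    have "(D_on T y has_vector_derivative (q x + 2 * \<mu> * p x - \<mu>\<^sup>2) * y x) (at x)"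
    proof (rule has_vector_derivative_transform_within_open[OF N(2), of _ "{0<..<T}"])
      show "z t = D_on T y t" if "t \<in> {0<..<T}" for t using Dz[of t] that by simp
    qed (use x in auto)
    moreover have "(q x + 2 * \<mu> * p x - \<mu>\<^sup>2) * y x + (\<mu>\<^sup>2 - 2 * \<mu> * p x - q x) * y x = 0" by algebra
    ultimately show "\<exists>y2. (D_on T y has_vector_derivative y2) (at x) \<and> y2 + (\<mu>\<^sup>2 - 2 * \<mu> * p x - q x) * y x = 0"
      by blast
  qed
  then show "pencil_solution T p q \<mu> y"
    unfolding pencil_solution_def
    using ac_density_absolutely_continuous[OF ac(1)] diff acD by blast
qed

lemma X1_X2_pairs:
  assumes co: "pencil_coeffs T p q"
  shows "pencil_pair T p q \<mu> (X1 T p q \<mu>) (D_on T (X1 T p q \<mu>))" "X1 T p q \<mu> 0 = 1" "D_on T (X1 T p q \<mu>) 0 = 0"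
    "pencil_pair T p q \<mu> (X2 T p q \<mu>) (D_on T (X2 T p q \<mu>))" "X2 T p q \<mu> 0 = 0" "D_on T (X2 T p q \<mu>) 0 = 1"
proof -
  have T: "0 \<in> {0..T}" using pencil_coeffs_D(1)[OF co] by simp
  have ex: "\<exists>y. pencil_solution T p q \<mu> y \<and> y 0 = y0 \<and> D_on T y 0 = z0" for y0 z0
  proof -
    obtain y z where "\<forall>\<mu>. pencil_pair T p q \<mu> (y \<mu>) (z \<mu>) \<and> y \<mu> 0 = y0 \<and> z \<mu> 0 = z0"
      using pencil_pair_exists[OF co, of y0 z0] by blast
    then show ?thesis using pair_imp_pencil_solution[OF co, of \<mu> "y \<mu>" "z \<mu>"] T by (intro exI[of _ "y \<mu>"]) auto
  qed
  have 1: "pencil_solution T p q \<mu> (X1 T p q \<mu>) \<and> X1 T p q \<mu> 0 = 1 \<and> D_on T (X1 T p q \<mu>) 0 = 0"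
    unfolding X1_def by (rule someI_ex[OF ex])
  have 2: "pencil_solution T p q \<mu> (X2 T p q \<mu>) \<and> X2 T p q \<mu> 0 = 0 \<and> D_on T (X2 T p q \<mu>) 0 = 1"
    unfolding X2_def by (rule someI_ex[OF ex])
  show "pencil_pair T p q \<mu> (X1 T p q \<mu>) (D_on T (X1 T p q \<mu>))" "X1 T p q \<mu> 0 = 1" "D_on T (X1 T p q \<mu>) 0 = 0"
    "pencil_pair T p q \<mu> (X2 T p q \<mu>) (D_on T (X2 T p q \<mu>))" "X2 T p q \<mu> 0 = 0" "D_on T (X2 T p q \<mu>) 0 = 1"
    using 1 2 pencil_solution_imp_pair[OF co] by auto
qed

section \<open>The characteristic functions in terms of the system normalized at the right end\<close>

definition reflected_form :: "real \<Rightarrow> (real \<Rightarrow> complex) \<Rightarrow> (real \<Rightarrow> complex) \<Rightarrow> complex" where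
  "reflected_form T \<sigma> y = U_form T \<sigma> (\<lambda>x. y (T - x))"

text \<open>
  The reflection of a solution \<open>y\<close> has the initial data \<open>y T\<close> and \<open>-
  z T\<close>, which are its coordinates in the reflected fundamental system.
\<close>
lemma U_form_via_right_end:
  assumes co: "pencil_coeffs T p q" and fs: "fundamental_system T (\<lambda>s. p (T - s)) (\<lambda>s. q (T - s)) S S' C C'"
    and bv: "bounded_variation_fn 0 T \<sigma>" and yz: "pencil_pair T p q \<mu> y z"
  shows "U_form T \<sigma> y = y T * reflected_form T \<sigma> (C \<mu>) - z T * reflected_form T \<sigma> (S \<mu>)"
proof -
  note T = pencil_coeffs_D(1)[OF co]
  note F = fundamental_systemD[OF fs, of \<mu>]
  have L: "bounded_functional T (reflected_form T \<sigma>)"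
    unfolding reflected_form_def[abs_def] by (rule reflected_U_form_bounded[OF T bv])
  have lc: "pencil_pair T (\<lambda>s. p (T - s)) (\<lambda>s. q (T - s)) \<mu> (\<lambda>s. y T * C \<mu> s + (- z T) * S \<mu> s) (\<lambda>s. y T * C' \<mu> s + (- z T) * S' \<mu> s)"
    by (rule pencil_pair_lincomb[OF F(2,1)])
  have "y (T - s) = y T * C \<mu> s + (- z T) * S \<mu> s" if "s \<in> {0..T}" for s
    by (rule pencil_pair_unique(1)[OF pencil_coeffs_reflect[OF co] pencil_pair_reflect[OF yz] lc _ _ that])
       (use F in simp_all)
  then have "reflected_form T \<sigma> (\<lambda>s. y (T - s)) = reflected_form T \<sigma> (\<lambda>s. y T * C \<mu> s + (- z T) * S \<mu> s)"
    by (rule bounded_functional_cong[OF L pencil_pair_continuous(1)[OF pencil_pair_reflect[OF yz]]])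
  also have "\<dots> = y T * reflected_form T \<sigma> (C \<mu>) + (- z T) * reflected_form T \<sigma> (S \<mu>)"
  proof -
    have "reflected_form T \<sigma> (\<lambda>s. y T * C \<mu> s + (- z T) * S \<mu> s)
        = reflected_form T \<sigma> (\<lambda>s. y T * C \<mu> s) + reflected_form T \<sigma> (\<lambda>s. (- z T) * S \<mu> s)"
      using F(7,9) by (intro bounded_functionalD(1)[OF L] continuous_intros)
    then show ?thesis using F(7,9) by (simp only: bounded_functionalD(2)[OF L])
  qed
  finally show ?thesis by (simp add: reflected_form_def)
qed

text \<open>
  The systems normalized at the two ends are related by a matrix whose determinant is a Wronskian
  and hence \<open>1\<close> up to sign.
\<close>
lemma characteristic_functions_via_right_end:
  assumes co: "pencil_coeffs T p q" and fs: "fundamental_system T (\<lambda>s. p (T - s)) (\<lambda>s. q (T - s)) S S' C C'"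
    and bv: "bounded_variation_fn 0 T \<sigma>1" "bounded_variation_fn 0 T \<sigma>2"
  shows "char_Delta1 T \<sigma>1 p q \<mu> = reflected_form T \<sigma>1 (S \<mu>)"
    "char_omega T \<sigma>1 \<sigma>2 p q \<mu> = reflected_form T \<sigma>1 (S \<mu>) * reflected_form T \<sigma>2 (C \<mu>)
       - reflected_form T \<sigma>1 (C \<mu>) * reflected_form T \<sigma>2 (S \<mu>)"
proof -
  note T = pencil_coeffs_D(1)[OF co]
  note X = X1_X2_pairs[OF co, of \<mu>]
  define x1 where "x1 = X1 T p q \<mu> T"
  define x2 where "x2 = X2 T p q \<mu> T"
  define d1 where "d1 = D_on T (X1 T p q \<mu>) T"
  define d2 where "d2 = D_on T (X2 T p q \<mu>) T"
  have W: "x1 * d2 - d1 * x2 = 1"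
    using pencil_pair_wronskian[OF X(1,4), of T] X(2,3,5,6) T by (simp add: x1_def x2_def d1_def d2_def)
  note U = U_form_via_right_end[OF co fs bv(1) X(1)] U_form_via_right_end[OF co fs bv(1) X(4)]
     U_form_via_right_end[OF co fs bv(2) X(1)] U_form_via_right_end[OF co fs bv(2) X(4)]
  define D where "D = reflected_form T \<sigma>1 (S \<mu>)"
  define A where "A = reflected_form T \<sigma>1 (C \<mu>)"
  define E where "E = reflected_form T \<sigma>2 (S \<mu>)"
  define B where "B = reflected_form T \<sigma>2 (C \<mu>)"
  note U' = U[folded x1_def x2_def d1_def d2_def D_def A_def E_def B_def]
  have "char_Delta1 T \<sigma>1 p q \<mu> = (x1 * d2 - d1 * x2) * D"
    unfolding char_Delta1_def V1_form_def U' x1_def[symmetric] x2_def[symmetric] by (simp add: algebra_simps)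
  then show "char_Delta1 T \<sigma>1 p q \<mu> = reflected_form T \<sigma>1 (S \<mu>)" unfolding W D_def by simp
  have "char_omega T \<sigma>1 \<sigma>2 p q \<mu> = (x1 * d2 - d1 * x2) * (D * B - A * E)"
    unfolding char_omega_def U' by (simp add: algebra_simps)
  then show "char_omega T \<sigma>1 \<sigma>2 p q \<mu> = reflected_form T \<sigma>1 (S \<mu>) * reflected_form T \<sigma>2 (C \<mu>)
       - reflected_form T \<sigma>1 (C \<mu>) * reflected_form T \<sigma>2 (S \<mu>)"
    unfolding W D_def A_def E_def B_def by simp
qed

text \<open>
  The Weyl solution vanishes at \<open>T\<close>, so its reflection is a multiple of the sine-type
  solution.
\<close>
lemma weyl_function_via_right_end:
  assumes co: "pencil_coeffs T p q" and fs: "fundamental_system T (\<lambda>s. p (T - s)) (\<lambda>s. q (T - s)) S S' C C'"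
    and bv: "bounded_variation_fn 0 T \<sigma>1" "bounded_variation_fn 0 T \<sigma>2"
    and D: "reflected_form T \<sigma>1 (S \<mu>) \<noteq> 0"
  shows "weyl_M T \<sigma>1 \<sigma>2 p q \<mu> = reflected_form T \<sigma>2 (S \<mu>) / reflected_form T \<sigma>1 (S \<mu>)"
proof -
  note T = pencil_coeffs_D(1)[OF co]
  note F = fundamental_systemD[OF fs, of \<mu>]
  define D where "D = reflected_form T \<sigma>1 (S \<mu>)"
  have D0: "D \<noteq> 0" using assms(5) by (simp add: D_def)
  have "pencil_pair T (\<lambda>s. p (T - (T - s))) (\<lambda>s. q (T - (T - s))) \<mu> (\<lambda>s. S \<mu> (T - s)) (\<lambda>s. - S' \<mu> (T - s))"
    by (rule pencil_pair_reflect[OF F(1)])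
  then have pp: "pencil_pair T p q \<mu> (\<lambda>s. S \<mu> (T - s)) (\<lambda>s. - S' \<mu> (T - s))" by simp
  have pp': "pencil_pair T p q \<mu> (\<lambda>s. (1 / D) * S \<mu> (T - s)) (\<lambda>s. (1 / D) * (- S' \<mu> (T - s)))"
    using pencil_pair_lincomb[OF pp pp, of "1 / D" 0] by simp
  have "U_form T \<sigma>1 (\<lambda>s. (1 / D) * S \<mu> (T - s)) = 1"
    using U_form_via_right_end[OF co fs bv(1) pp'] F(3,4) D0 by (simp add: D_def)
  moreover have "V1_form T (\<lambda>s. (1 / D) * S \<mu> (T - s)) = 0" by (simp add: V1_form_def F(3))
  ultimately have ex: "\<exists>y. pencil_solution T p q \<mu> y \<and> U_form T \<sigma>1 y = 1 \<and> V1_form T y = 0"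
    using pair_imp_pencil_solution(1)[OF co pp'] by blast
  define \<Phi> where "\<Phi> = Phi T \<sigma>1 p q \<mu>"
  have \<Phi>: "pencil_solution T p q \<mu> \<Phi>" "U_form T \<sigma>1 \<Phi> = 1" "\<Phi> T = 0"
    using someI_ex[OF ex] unfolding \<Phi>_def Phi_def V1_form_def by auto
  note pair = pencil_solution_imp_pair[OF co \<Phi>(1)]
  have "- D_on T \<Phi> T * D = 1"
    using U_form_via_right_end[OF co fs bv(1) pair] \<Phi>(2,3) by (simp add: D_def)
  then have "- D_on T \<Phi> T = 1 / D" using D0 by (simp add: field_simps)
  then have "U_form T \<sigma>2 \<Phi> = 1 / D * reflected_form T \<sigma>2 (S \<mu>)"
    using U_form_via_right_end[OF co fs bv(2) pair] \<Phi>(3) by (metis (no_types, lifting) diff_0 minus_mult_left mult_zero_left)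
  then show ?thesis unfolding weyl_M_def by (simp add: \<Phi>_def D_def)
qed

section \<open>The uniqueness theorem\<close>

text \<open>
  Both characteristic functions have the growth of a sine-type solution, so the quotient is
  constant. The constant is \<open>1\<close> because the leading coefficients \<open>H exp (\<i>
  \<integral>p)\<close> along the positive imaginary axis are the same.
\<close>
lemma char_function_determined:
  assumes co: "pencil_coeffs b p q" "pencil_coeffs b pt qt"
    and fs: "fundamental_system b p q S S' C C'" and ft: "fundamental_system b pt qt St St' Ct Ct'"
    and L: "end_functional b H L" and H: "H \<noteq> 0" and Q: "integral {0..b} p = integral {0..b} pt"
    and F: "F holomorphic_on UNIV" "\<And>\<mu>. L (St \<mu>) = F \<mu> * L (S \<mu>)"
  shows "L (St \<mu>) = L (S \<mu>)"
proof -
  have b: "0 < b" using pencil_coeffs_D(1)[OF co(1)] .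
  have Lb: "bounded_functional b L" using L by (simp add: end_functional_def)
  obtain K1 where K1: "0 \<le> K1" "\<forall>\<mu>. 1 \<le> norm \<mu> \<longrightarrow> norm (L (S \<mu>)) \<le> K1 * exp (b * \<bar>Im \<mu>\<bar>) / norm \<mu>"
    using char_function_upper_bound[OF co(1) fs Lb] by blast
  obtain K2 where K2: "0 \<le> K2" "\<forall>\<mu>. 1 \<le> norm \<mu> \<longrightarrow> norm (L (St \<mu>)) \<le> K2 * exp (b * \<bar>Im \<mu>\<bar>) / norm \<mu>"
    using char_function_upper_bound[OF co(2) ft Lb] by blast
  obtain c R where c: "0 < c" and R: "1 \<le> R" "\<forall>\<mu>. R \<le> \<bar>Im \<mu>\<bar> \<longrightarrow> c * exp (b * \<bar>Im \<mu>\<bar>) / norm \<mu> \<le> norm (L (S \<mu>))"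
    using char_function_lower_bound[OF co(1) fs L H] by blast
  define K where "K = max K1 K2"
  have mono: "k * exp (b * \<bar>Im z\<bar>) / norm z \<le> K * exp (b * \<bar>Im z\<bar>) / norm z" if "k \<le> K" for k and z :: complex
    using that by (intro divide_right_mono mult_right_mono) auto
  have "\<exists>k. \<forall>z. F z = k"
  proof (rule entire_quotient_constant[OF F(1) weakly_entire_functional[OF fundamental_system_weakly_entire(1)[OF co(1) fs] Lb], of b K c R])
    show "norm (L (S z)) \<le> K * exp (b * \<bar>Im z\<bar>) / norm z" if "1 \<le> norm z" for z
      using K1(2)[rule_format, OF that] mono[of K1 z] by (simp add: K_def)
    show "norm (F z * L (S z)) \<le> K * exp (b * \<bar>Im z\<bar>) / norm z" if "1 \<le> norm z" for z
      using K2(2)[rule_format, OF that] mono[of K2 z] by (simp add: K_def F(2))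
  qed (use b c R in auto)
  then obtain k where k: "\<And>z. F z = k" by blast
  have "k = 1"
  proof (rule eq_1_if_scaled_limits[OF _ H])
    fix e :: real assume e: "0 < e"
    obtain R1 where R1: "\<forall>\<mu>. R1 \<le> Im \<mu> \<longrightarrow> norm (- 2 * \<i> * \<mu> * L (S \<mu>) * exp (\<i> * \<mu> * b - \<i> * integral {0..b} p) - H) \<le> e"
      using char_function_asymptotics[OF co(1) fs L e] by blast
    obtain R2 where R2: "\<forall>\<mu>. R2 \<le> Im \<mu> \<longrightarrow> norm (- 2 * \<i> * \<mu> * L (St \<mu>) * exp (\<i> * \<mu> * b - \<i> * integral {0..b} pt) - H) \<le> e"
      using char_function_asymptotics[OF co(2) ft L e] by blast
    define \<mu> where "\<mu> = Complex 0 (max R1 R2)"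
    have "norm (- 2 * \<i> * \<mu> * L (St \<mu>) * exp (\<i> * \<mu> * b - \<i> * integral {0..b} pt) - H) \<le> e"
      "norm (- 2 * \<i> * \<mu> * L (S \<mu>) * exp (\<i> * \<mu> * b - \<i> * integral {0..b} p) - H) \<le> e"
      by (intro R1[rule_format] R2[rule_format]; simp add: \<mu>_def)+
    moreover have "- 2 * \<i> * \<mu> * L (St \<mu>) * exp (\<i> * \<mu> * b - \<i> * integral {0..b} pt)
       = k * (- 2 * \<i> * \<mu> * L (S \<mu>) * exp (\<i> * \<mu> * b - \<i> * integral {0..b} p))"
      using F(2)[of \<mu>] by (simp add: Q k)
    ultimately show "\<exists>w v. norm (w - H) \<le> e \<and> norm (v - H) \<le> e \<and> w = k * v" by blast
  qed
  then show ?thesis using F(2)[of \<mu>] k[of \<mu>] by simp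
qed

theorem theorem1:
  fixes T :: real
    and p q pt qt \<sigma>1 \<sigma>2 :: "real \<Rightarrow> complex"
  assumes "T > 0"
    and "absolutely_continuous_fn 0 T p" and "absolutely_continuous_fn 0 T pt"
    and "q absolutely_integrable_on {0<..<T}" and "qt absolutely_integrable_on {0<..<T}"
    and "integral {0..T} p = integral {0..T} pt"
    and "bounded_variation_fn 0 T \<sigma>1" and "bounded_variation_fn 0 T \<sigma>2"
    and "\<forall>t\<in>{0<..<T}. continuous (at_right t) \<sigma>1"
    and "\<forall>t\<in>{0<..<T}. continuous (at_right t) \<sigma>2"
    and "jump_at_0 \<sigma>1 \<noteq> 0"
    and "\<exists>\<mu>. char_omega T \<sigma>1 \<sigma>2 p q \<mu> \<noteq> 0"
    and "\<exists>\<mu>. char_omega T \<sigma>1 \<sigma>2 pt qt \<mu> \<noteq> 0"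
    and "Lambda1_set T \<sigma>1 p q \<inter> Xi_set T \<sigma>1 \<sigma>2 p q = {}"
    and "\<forall>\<mu>. \<mu> \<notin> Lambda1_set T \<sigma>1 p q \<union> Lambda1_set T \<sigma>1 pt qt \<longrightarrow>
           weyl_M T \<sigma>1 \<sigma>2 p q \<mu> = weyl_M T \<sigma>1 \<sigma>2 pt qt \<mu>"
    and "\<forall>\<mu>. char_omega T \<sigma>1 \<sigma>2 p q \<mu> = char_omega T \<sigma>1 \<sigma>2 pt qt \<mu>"
  shows "(\<forall>x\<in>{0<..<T}. p x = pt x) \<and> (AE x in lebesgue_on {0<..<T}. q x = qt x)"
proof -
  note T = assms(1) and bv = assms(7,8)
  have co: "pencil_coeffs T p q" "pencil_coeffs T pt qt"
    using assms(1-5) absolutely_continuous_fn_continuous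
    unfolding pencil_coeffs_def absolutely_integrable_on_Icc_iff_Ioo by auto
  define pr where "pr s = p (T - s)" for s
  define qr where "qr s = q (T - s)" for s
  define prt where "prt s = pt (T - s)" for s
  define qrt where "qrt s = qt (T - s)" for s
  have cor: "pencil_coeffs T pr qr" "pencil_coeffs T prt qrt"
    unfolding pr_def qr_def prt_def qrt_def by (intro pencil_coeffs_reflect co)+
  obtain S S' C C' where fs: "fundamental_system T pr qr S S' C C'" using fundamental_system_exists[OF cor(1)] by blast
  obtain St St' Ct Ct' where ft: "fundamental_system T prt qrt St St' Ct Ct'" using fundamental_system_exists[OF cor(2)] by blast
  note WE = fundamental_system_weakly_entire[OF cor(1) fs] fundamental_system_weakly_entire[OF cor(2) ft]
  define L1 where "L1 = reflected_form T \<sigma>1"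
  define L2 where "L2 = reflected_form T \<sigma>2"
  define H where "H = jump_at_0 \<sigma>1"
  have H: "H \<noteq> 0" using assms(11) by (simp add: H_def)
  have L: "end_functional T H L1"
    unfolding L1_def H_def reflected_form_def[abs_def] by (rule reflected_U_form_end_functional[OF T bv(1)])
  have Lb: "bounded_functional T L1" "bounded_functional T L2"
    unfolding L1_def L2_def reflected_form_def[abs_def] by (intro reflected_U_form_bounded[OF T] bv)+
  note hol = weakly_entire_functional[OF WE(1) Lb(1)] weakly_entire_functional[OF WE(3) Lb(1)]
    weakly_entire_functional[OF WE(5) Lb(1)] weakly_entire_functional[OF WE(7) Lb(1)]
    weakly_entire_functional[OF WE(1) Lb(2)] weakly_entire_functional[OF WE(3) Lb(2)]
    weakly_entire_functional[OF WE(5) Lb(2)] weakly_entire_functional[OF WE(7) Lb(2)]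
  note char = characteristic_functions_via_right_end[OF co(1) fs[unfolded pr_def[abs_def] qr_def[abs_def]] bv, folded L1_def L2_def]
  note chart = characteristic_functions_via_right_end[OF co(2) ft[unfolded prt_def[abs_def] qrt_def[abs_def]] bv, folded L1_def L2_def]
  note weyl = weyl_function_via_right_end[OF co(1) fs[unfolded pr_def[abs_def] qr_def[abs_def]] bv, folded L1_def L2_def]
  note weylt = weyl_function_via_right_end[OF co(2) ft[unfolded prt_def[abs_def] qrt_def[abs_def]] bv, folded L1_def L2_def]
  obtain c1 R1 where R1: "0 < c1" "1 \<le> R1" "\<forall>\<mu>. R1 \<le> \<bar>Im \<mu>\<bar> \<longrightarrow> c1 * exp (T * \<bar>Im \<mu>\<bar>) / norm \<mu> \<le> norm (L1 (S \<mu>))"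
    using char_function_lower_bound[OF cor(1) fs L H] by blast
  obtain c2 R2 where R2: "0 < c2" "1 \<le> R2" "\<forall>\<mu>. R2 \<le> \<bar>Im \<mu>\<bar> \<longrightarrow> c2 * exp (T * \<bar>Im \<mu>\<bar>) / norm \<mu> \<le> norm (L1 (St \<mu>))"
    using char_function_lower_bound[OF cor(2) ft L H] by blast
  \<comment> \<open>On this half plane both denominators are nonzero, so that the Weyl functions are genuine quotients.\<close>
  define Up where "Up = {\<mu>. max R1 R2 < Im \<mu>}"
  have Up: "open Up" "Up \<noteq> {}"
  proof -
    show "open Up" unfolding Up_def by (rule open_halfspace_Im_gt)
    have "Complex 0 (max R1 R2 + 1) \<in> Up" by (auto simp: Up_def)
    then show "Up \<noteq> {}" by blast
  qed
  have nz: "L1 (S \<mu>) \<noteq> 0" "L1 (St \<mu>) \<noteq> 0" if "\<mu> \<in> Up" for \<mu>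
  proof -
    have \<mu>: "R1 \<le> \<bar>Im \<mu>\<bar>" "R2 \<le> \<bar>Im \<mu>\<bar>" "0 < norm \<mu>"
      using that R1(2) abs_Im_le_cmod[of \<mu>] unfolding Up_def by auto
    have "0 < c1 * exp (T * \<bar>Im \<mu>\<bar>) / norm \<mu>" "0 < c2 * exp (T * \<bar>Im \<mu>\<bar>) / norm \<mu>"
      using R1(1) R2(1) \<mu>(3) by (intro divide_pos_pos mult_pos_pos; simp)+
    then show "L1 (S \<mu>) \<noteq> 0" "L1 (St \<mu>) \<noteq> 0"
      using R1(3)[rule_format, OF \<mu>(1)] R2(3)[rule_format, OF \<mu>(2)] by auto
  qed
  have ratio: "L2 (S \<mu>) / L1 (S \<mu>) = L2 (St \<mu>) / L1 (St \<mu>)" if "\<mu> \<in> Up" for \<mu>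
  proof -
    have "\<mu> \<notin> Lambda1_set T \<sigma>1 p q \<union> Lambda1_set T \<sigma>1 pt qt"
      using nz[OF that] by (simp add: Lambda1_set_def char chart)
    then have "weyl_M T \<sigma>1 \<sigma>2 p q \<mu> = weyl_M T \<sigma>1 \<sigma>2 pt qt \<mu>" using assms(15) by blast
    then show ?thesis using weyl[OF nz(1)[OF that]] weylt[OF nz(2)[OF that]] by simp
  qed
  have cross: "L1 (S \<mu>) * L2 (St \<mu>) = L1 (St \<mu>) * L2 (S \<mu>)" for \<mu>
  proof (rule analytic_continuation_open[OF Up(1) open_UNIV Up(2) connected_UNIV subset_UNIV
        holomorphic_on_mult[OF hol(1) hol(7)] holomorphic_on_mult[OF hol(3) hol(5)]])
    show "L1 (S z) * L2 (St z) = L1 (St z) * L2 (S z)" if "z \<in> Up" for z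
      using ratio[OF that] nz[OF that] by (simp add: field_simps)
  qed simp
  \<comment> \<open>At a zero of the denominator \<open>L1 S\<close> the formula for \<open>\<omega>\<close> leaves only the product \<open>L1 C \<cdot> L2 S\<close>, up to sign.\<close>
  have coprime: "L2 (S \<mu>) \<noteq> 0" if "L1 (S \<mu>) = 0" for \<mu>
  proof -
    have "\<mu> \<in> Lambda1_set T \<sigma>1 p q" using that by (simp add: Lambda1_set_def char)
    then have "char_omega T \<sigma>1 \<sigma>2 p q \<mu> \<noteq> 0" using assms(14) by (auto simp: Xi_set_def)
    then show ?thesis using that by (auto simp: char)
  qed
  obtain F where F: "F holomorphic_on UNIV" "\<forall>\<mu>. L1 (St \<mu>) = F \<mu> * L1 (S \<mu>)"
    using coprime_entire_divides[OF hol(1) hol(5) hol(7) hol(3) cross coprime] by blast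
  have Q: "integral {0..T} pr = integral {0..T} prt"
  proof -
    have "integral {0..T} (\<lambda>s. f (T - s)) = integral {0..T} f" if "continuous_on {0..T} f" for f :: "real \<Rightarrow> complex"
      using has_integral_reflect_shift_real[OF integrable_integral[OF integrable_continuous_real[OF that]], of T]
      by (simp add: integral_unique)
    then show ?thesis using assms(6) pencil_coeffs_D(2)[OF co(1)] pencil_coeffs_D(2)[OF co(2)]
      unfolding pr_def prt_def by simp
  qed
  have D_eq: "L1 (St \<mu>) = L1 (S \<mu>)" for \<mu>
    by (rule char_function_determined[OF cor fs ft L H Q F(1) F(2)[rule_format]])
  have E_eq: "L2 (St \<mu>) = L2 (S \<mu>)" for \<mu>
  proof (rule analytic_continuation_open[OF Up(1) open_UNIV Up(2) connected_UNIV subset_UNIV hol(7) hol(5)])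
    show "L2 (St z) = L2 (S z)" if "z \<in> Up" for z using cross[of z] D_eq[of z] nz[OF that] by simp
  qed simp
  \<comment> \<open>Equality of the functions \<open>\<omega>\<close>, now that both pencils share \<open>L1 S\<close> and \<open>L2 S\<close>.\<close>
  have rel: "L1 (S \<mu>) * (L2 (Ct \<mu>) - L2 (C \<mu>)) = (L1 (Ct \<mu>) - L1 (C \<mu>)) * L2 (S \<mu>)" for \<mu>
    using assms(16)[rule_format, of \<mu>] unfolding char chart D_eq E_eq by (simp add: algebra_simps)
  obtain h where h: "h holomorphic_on UNIV" "\<forall>\<mu>. L1 (Ct \<mu>) - L1 (C \<mu>) = h \<mu> * L1 (S \<mu>)"
    using coprime_entire_divides[OF hol(1) hol(5) holomorphic_on_diff[OF hol(8) hol(6)] holomorphic_on_diff[OF hol(4) hol(2)] rel coprime]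
    by blast
  have h0: "h \<mu> = 0" for \<mu>
    by (rule uniqueness_on_half_interval(4)[OF cor fs ft L H h(1) D_eq[symmetric] h(2)[rule_format]])
  have "L1 (C \<mu>) = L1 (Ct \<mu>)" for \<mu> using h(2)[rule_format, of \<mu>] h0[of \<mu>] by simp
  note halves = uniqueness_by_halving[OF cor fs ft L H D_eq[symmetric] this]
  have reach: "\<exists>n. s \<in> {0..<T * (1 - 1 / 2 ^ n)}" if s: "0 \<le> s" "s < T" for s
  proof -
    have "0 < (T - s) / T" using s T by simp
    then obtain n where n: "(1 / 2) ^ n < (T - s) / T" using real_arch_pow_inv[of "(T - s) / T" "1/2"] by auto
    then have "T * (1 / 2 ^ n) < T - s" using T by (simp add: power_one_over field_simps)
    then have "s < T * (1 - 1 / 2 ^ n)" by (simp add: algebra_simps)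
    then show ?thesis using s by auto
  qed
  have "p x = pt x" if x: "x \<in> {0<..<T}" for x
  proof -
    obtain n where "T - x \<in> {0..<T * (1 - 1 / 2 ^ n)}" using reach[of "T - x"] x by auto
    then have "pr (T - x) = prt (T - x)" using halves[of n] by blast
    then show ?thesis by (simp add: pr_def prt_def)
  qed
  moreover have "AE x in lebesgue_on {0<..<T}. q x = qt x"
    unfolding AE_lebesgue_on_open_interval_iff
  proof (intro exI conjI ballI)
    let ?N = "\<Union>n. {s \<in> {0..<T * (1 - 1 / 2 ^ n)}. qr s \<noteq> qrt s}"
    have "negligible ?N"
    proof (rule negligible_countable_Union)
      fix X assume "X \<in> range (\<lambda>n::nat. {s \<in> {0..<T * (1 - 1 / 2 ^ n)}. qr s \<noteq> qrt s})"
      then show "negligible X" using halves by blast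
    qed simp
    then show "negligible ((\<lambda>s. T - s) ` ?N)"
      by (intro negligible_differentiable_image_negligible) (auto intro!: derivative_intros)
    fix x assume x: "x \<in> {0<..<T} - (\<lambda>s. T - s) ` ?N"
    obtain n where n: "T - x \<in> {0..<T * (1 - 1 / 2 ^ n)}" using reach[of "T - x"] x by auto
    have "T - x \<notin> ?N"
    proof
      assume "T - x \<in> ?N"
      then have "T - (T - x) \<in> (\<lambda>s. T - s) ` ?N" by (rule imageI)
      then show False using x by simp
    qed
    then have "qr (T - x) = qrt (T - x)" using n by blast
    then show "q x = qt x" by (simp add: qr_def qrt_def)
  qed
  ultimately show ?thesis by blast
qed

end
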